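(* Let $p$ be a prime, let $e^{i\beta}$ be a primitive $p$-th root of unity, and let $M_\beta = G/\Gamma_\beta$ be the compact $7$-dimensional quotient of $G = SU(2)\ltimes\mathbb{H}$ by the discrete subgroup $\Gamma_\beta = \langle A_\beta\rangle\ltimes\mathbb{Z}^4$ (defined in the context). Then for some open interval $(b,c)\subset\mathbb{R}$ there exists on the product $M_\beta\times(b,c)$ a Riemannian metric with discrete holonomy contained in $SU(4)$.
   Context: $\mathbb{H}\cong\mathbb{R}^4$ denotes the quaternions and $SU(2)$ is identified with the group of unit quaternions. The Lie group $G = SU(2)\ltimes\mathbb{H}$ has the product $(A,q)\cdot(A',q') = (AA', Aq'+q)$ for $A,A'\in SU(2)$, $q,q'\in\mathbb{H}$, where $Aq'$ is quaternionic multiplication (equivalently the standard action of $SU(2)$ on $\mathbb{C}^2\cong\mathbb{H}$). $\langle A_\beta\rangle\subset SU(2)$ is the cyclic subgroup generated by $A_\beta = \begin{pmatrix} e^{i\beta} & 0\\ 0 & e^{-i\beta}\end{pmatrix}$, and $\Gamma_\beta = \langle A_\beta\rangle\ltimes\mathbb{Z}^4 = \{(A_\beta^m, r) : m\in\mathbb{Z},\ r\in\mathbb{Z}^4\}$, with $\mathbb{Z}^4\subset\mathbb{R}^4\cong\mathbb{H}$; it is taken to be a discrete subgroup of $G$ (the semidirect product notation presupposes that $A_\beta$ maps $\mathbb{Z}^4$ to itself). The quotient $M_\beta = G/\Gamma_\beta$ is the space of orbits of $\Gamma_\beta$ acting on $G$ by left translations, i.e. the class of $(A',q')$ is $\{(A_\beta^m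 A', A_\beta^m q'+r) : m\in\mathbb{Z},\ r\in\mathbb{Z}^4\}$. Holonomy means the holonomy group of the Levi-Civita connection of the metric on the $8$-manifold $M_\beta\times(b,c)$, and $SU(4)\subset SO(8)$ in the standard way. *)

theory Defs
  imports
    "HOL-Analysis.Analysis"
    "HOL-Algebra.Generated_Groups"
    "HOL-Computational_Algebra.Primes"
begin

section \<open>Smooth manifolds\<close>

primrec Ck_on ::
  "nat \<Rightarrow> ('a::real_normed_vector \<Rightarrow> 'b::real_normed_vector) \<Rightarrow> 'a set \<Rightarrow> bool" where
  "Ck_on 0 f S \<longleftrightarrow> continuous_on S f"
| "Ck_on (Suc k) f S \<longleftrightarrow>
     f differentiable_on S \<and> (\<forall>v. Ck_on k (\<lambda>x. frechet_derivative f (at x) v) S)"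

text \<open>Only used for open \<open>S\<close>.\<close>

definition smooth_on ::
  "('a::real_normed_vector \<Rightarrow> 'b::real_normed_vector) \<Rightarrow> 'a set \<Rightarrow> bool" where
  "smooth_on f S \<longleftrightarrow> (\<forall>k. Ck_on k f S)"

text \<open>A chart \<open>(U, \<psi>)\<close> consists of its domain and a coordinate map into the model space \<open>'e\<close>;
  the values of \<open>\<psi>\<close> outside \<open>U\<close> are irrelevant.\<close>

type_synonym ('a, 'e) chart = "'a set \<times> ('a \<Rightarrow> 'e)"

abbreviation chart_inv :: "('a, 'e) chart \<Rightarrow> 'e \<Rightarrow> 'a" where
  "chart_inv c \<equiv> inv_into (fst c) (snd c)"

definition transition :: "('a, 'e) chart \<Rightarrow> ('a, 'e) chart \<Rightarrow> 'e \<Rightarrow> 'e" where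
  "transition c d = snd d \<circ> chart_inv c"

definition smooth_manifold ::
  "'a topology \<Rightarrow> ('a, 'e::euclidean_space) chart set \<Rightarrow> bool" where
  "smooth_manifold X \<A> \<longleftrightarrow>
     Hausdorff_space X \<and> second_countable X \<and> topspace X = (\<Union>c\<in>\<A>. fst c) \<and>
     (\<forall>(U, \<psi>)\<in>\<A>. openin X U \<and> open (\<psi> ` U) \<and>
        homeomorphic_map (subtopology X U) (top_of_set (\<psi> ` U)) \<psi>) \<and>
     (\<forall>c\<in>\<A>. \<forall>d\<in>\<A>. smooth_on (transition c d) (snd c ` (fst c \<inter> fst d)))"

text \<open>The charts of an embedded submanifold \<open>S\<close> of a Euclidean space: their inverses are local
  parametrisations of \<open>S\<close>, i.e. smooth immersions into the ambient space.\<close>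

definition submanifold_atlas ::
  "'a::euclidean_space set \<Rightarrow> ('a, 'e::euclidean_space) chart set" where
  "submanifold_atlas S =
     {(V, \<phi>). openin (top_of_set S) V \<and> open (\<phi> ` V) \<and>
        homeomorphism V (\<phi> ` V) \<phi> (inv_into V \<phi>) \<and>
        smooth_on (inv_into V \<phi>) (\<phi> ` V) \<and>
        (\<forall>x\<in>\<phi> ` V. inj (frechet_derivative (inv_into V \<phi>) (at x)))}"

definition quotient_topology :: "'a topology \<Rightarrow> ('a \<Rightarrow> 'b) \<Rightarrow> 'b topology" where
  "quotient_topology X \<pi> =
     topology (\<lambda>U. U \<subseteq> \<pi> ` topspace X \<and> openin X {x \<in> topspace X. \<pi> x \<in> U})"

lemma openin_quotient_topology:
  "openin (quotient_topology X \<pi>) U \<longleftrightarrow>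
     U \<subseteq> \<pi> ` topspace X \<and> openin X {x \<in> topspace X. \<pi> x \<in> U}"
proof -
  let ?P = "\<lambda>U. U \<subseteq> \<pi> ` topspace X \<and> openin X {x \<in> topspace X. \<pi> x \<in> U}"
  have "?P (S \<inter> T)" if "?P S" "?P T" for S T
  proof -
    have "{x \<in> topspace X. \<pi> x \<in> S \<inter> T} =
      {x \<in> topspace X. \<pi> x \<in> S} \<inter> {x \<in> topspace X. \<pi> x \<in> T}" by auto
    then show ?thesis using that by auto
  qed
  moreover have "?P (\<Union>\<K>)" if "\<forall>K\<in>\<K>. ?P K" for \<K>
  proof -
    have "{x \<in> topspace X. \<pi> x \<in> \<Union>\<K>} = (\<Union>K\<in>\<K>. {x \<in> topspace X. \<pi> x \<in> K})" by auto
    then show ?thesis using that by auto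
  qed
  ultimately have "istopology ?P"
    unfolding istopology_def by blast
  then show ?thesis
    by (simp add: quotient_topology_def topology_inverse')
qed

text \<open>The charts of the quotient by a covering \<open>\<pi>\<close>: a chart whose domain \<open>V\<close> is mapped injectively
  descends to \<open>\<pi> ` V\<close>.\<close>

definition quotient_atlas :: "('a \<Rightarrow> 'b) \<Rightarrow> ('a, 'e) chart set \<Rightarrow> ('b, 'e) chart set" where
  "quotient_atlas \<pi> \<A> = {(\<pi> ` V, \<phi> \<circ> inv_into V \<pi>) | V \<phi>. (V, \<phi>) \<in> \<A> \<and> inj_on \<pi> V}"

text \<open>Product of a manifold with the open interval \<open>(b, c)\<close>.\<close>

definition times_interval_topology ::
  "'a topology \<Rightarrow> real \<Rightarrow> real \<Rightarrow> ('a \<times> real) topology" where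
  "times_interval_topology X b c = prod_topology X (top_of_set {b<..<c})"

definition times_interval_atlas ::
  "('a, 'e) chart set \<Rightarrow> real \<Rightarrow> real \<Rightarrow> ('a \<times> real, 'e \<times> real) chart set" where
  "times_interval_atlas \<A> b c = (\<lambda>(U, \<psi>). (U \<times> {b<..<c}, map_prod \<psi> id)) ` \<A>"


section \<open>Riemannian metrics and holonomy\<close>

text \<open>A metric is given by its local expressions: \<open>g c x\<close> is the inner product in the chart \<open>c\<close>
  at the point with coordinates \<open>x\<close>.\<close>

definition riemannian_metric ::
  "('a, 'e::euclidean_space) chart set \<Rightarrow>
   (('a, 'e) chart \<Rightarrow> 'e \<Rightarrow> 'e \<Rightarrow> 'e \<Rightarrow> real) \<Rightarrow> bool" where
  "riemannian_metric \<A> g \<longleftrightarrow>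
     (\<forall>c\<in>\<A>. \<forall>x\<in>snd c ` fst c.
        bilinear (g c x) \<and> (\<forall>v w. g c x v w = g c x w v) \<and> (\<forall>v. v \<noteq> 0 \<longrightarrow> g c x v v > 0)) \<and>
     (\<forall>c\<in>\<A>. \<forall>v w. smooth_on (\<lambda>x. g c x v w) (snd c ` fst c)) \<and>
     (\<forall>c\<in>\<A>. \<forall>d\<in>\<A>. \<forall>x\<in>snd c ` (fst c \<inter> fst d). \<forall>v w.
        g c x v w = g d (transition c d x)
          (frechet_derivative (transition c d) (at x) v)
          (frechet_derivative (transition c d) (at x) w))"

text \<open>The Levi-Civita connection in a chart is \<open>\<nabla>\<^sub>u Y = D Y u + B u Y\<close>, where the Christoffel
  map \<open>B\<close> at \<open>x\<close> is determined by being torsion-free (symmetric) and metric.\<close>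

definition levi_civita ::
  "(('a, 'e::euclidean_space) chart \<Rightarrow> 'e \<Rightarrow> 'e \<Rightarrow> 'e \<Rightarrow> real) \<Rightarrow>
   ('a, 'e) chart \<Rightarrow> 'e \<Rightarrow> 'e \<Rightarrow> 'e \<Rightarrow> 'e" where
  "levi_civita g c x = (THE B. bilinear B \<and> (\<forall>u v. B u v = B v u) \<and>
     (\<forall>u v w. frechet_derivative (\<lambda>y. g c y v w) (at x) u = g c x (B u v) w + g c x v (B u w)))"

definition adjacent :: "real set \<Rightarrow> real \<Rightarrow> real \<Rightarrow> bool" where
  "adjacent S a b \<longleftrightarrow> a \<in> S \<and> b \<in> S \<and> a < b \<and> S \<inter> {a<..<b} = {}"

text \<open>Continuous curves \<open>[0,1] \<rightarrow> X\<close> that are \<open>C\<^sup>1\<close>, up to the endpoints, on each closed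
  piece of the subdivision \<open>S\<close>.\<close>

definition piecewise_C1_curve ::
  "'a topology \<Rightarrow> ('a, 'e::euclidean_space) chart set \<Rightarrow> real set \<Rightarrow> (real \<Rightarrow> 'a) \<Rightarrow> bool" where
  "piecewise_C1_curve X \<A> S \<gamma> \<longleftrightarrow>
     continuous_map (top_of_set {0..1}) X \<gamma> \<and>
     finite S \<and> {0, 1} \<subseteq> S \<and> S \<subseteq> {0..1} \<and>
     (\<forall>a b. adjacent S a b \<longrightarrow> (\<forall>(U, \<psi>)\<in>\<A>. \<exists>D.
        continuous_on {t \<in> {a..b}. \<gamma> t \<in> U} D \<and>
        (\<forall>t\<in>{t \<in> {a..b}. \<gamma> t \<in> U}.
           ((\<psi> \<circ> \<gamma>) has_vector_derivative D t) (at t within {a..b}))))"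

text \<open>A vector field along \<open>\<gamma>\<close> is given by its components \<open>Y t c\<close> in all charts \<open>c\<close> around \<open>\<gamma> t\<close>.\<close>

definition parallel_along ::
  "('a, 'e::euclidean_space) chart set \<Rightarrow>
   (('a, 'e) chart \<Rightarrow> 'e \<Rightarrow> 'e \<Rightarrow> 'e \<Rightarrow> real) \<Rightarrow>
   real set \<Rightarrow> (real \<Rightarrow> 'a) \<Rightarrow> (real \<Rightarrow> ('a, 'e) chart \<Rightarrow> 'e) \<Rightarrow> bool" where
  "parallel_along \<A> g S \<gamma> Y \<longleftrightarrow>
     (\<forall>t\<in>{0..1}. \<forall>c\<in>\<A>. \<forall>d\<in>\<A>. \<gamma> t \<in> fst c \<inter> fst d \<longrightarrow>
        Y t d = frechet_derivative (transition c d) (at (snd c (\<gamma> t))) (Y t c)) \<and>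
     (\<forall>a b. adjacent S a b \<longrightarrow> (\<forall>c\<in>\<A>. \<forall>t\<in>{a..b}. \<gamma> t \<in> fst c \<longrightarrow>
        ((\<lambda>s. Y s c) has_vector_derivative
           - levi_civita g c (snd c (\<gamma> t))
               (vector_derivative (snd c \<circ> \<gamma>) (at t within {a..b})) (Y t c))
          (at t within {a..b})))"

text \<open>The holonomy group at \<open>p\<close>, the tangent space at \<open>p\<close> being identified with the model space
  by means of a chart \<open>c\<close> around \<open>p\<close>.\<close>

definition holonomy_group ::
  "'a topology \<Rightarrow> ('a, 'e::euclidean_space) chart set \<Rightarrow>
   (('a, 'e) chart \<Rightarrow> 'e \<Rightarrow> 'e \<Rightarrow> 'e \<Rightarrow> real) \<Rightarrow>
   ('a, 'e) chart \<Rightarrow> 'a \<Rightarrow> ('e \<Rightarrow>\<^sub>L 'e) set" where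
  "holonomy_group X \<A> g c p =
     {h. \<exists>S \<gamma>. piecewise_C1_curve X \<A> S \<gamma> \<and> \<gamma> 0 = p \<and> \<gamma> 1 = p \<and>
        (\<forall>v. \<exists>Y. parallel_along \<A> g S \<gamma> Y \<and> Y 0 c = v \<and> Y 1 c = blinfun_apply h v)}"


section \<open>The group \<open>G = SU(2) \<ltimes> \<complex>\<^sup>2\<close> and the quotient \<open>M\<close>\<close>

definition SU :: "(complex^'n^'n) set" where
  "SU = {A. A ** map_matrix cnj (transpose A) = mat 1 \<and> det A = 1}"

definition SU_group :: "(complex^'n^'n) monoid" where
  "SU_group = \<lparr>carrier = SU, mult = (**), one = mat 1\<rparr>"

text \<open>The quaternions are realised as \<open>\<complex>\<^sup>2\<close>, unit quaternions acting as \<open>SU(2)\<close>.\<close>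

definition G :: "((complex^2^2) \<times> (complex^2)) monoid" where
  "G = \<lparr>carrier = SU \<times> UNIV,
        mult = (\<lambda>(A, q) (A', q'). (A ** A', A *v q' + q)),
        one = (mat 1, 0)\<rparr>"

definition A_mat :: "real \<Rightarrow> complex^2^2" where
  "A_mat \<beta> = vector [vector [cis \<beta>, 0], vector [0, cis (- \<beta>)]]"

text \<open>The copy of \<open>\<int>\<^sup>4\<close> in \<open>\<complex>\<^sup>2\<close> given by an identification \<open>\<phi>\<close> of \<open>\<real>\<^sup>4\<close> with \<open>\<complex>\<^sup>2\<close>.\<close>

definition Z4_lattice :: "(real^4 \<Rightarrow> complex^2) \<Rightarrow> (complex^2) set" where
  "Z4_lattice \<phi> = \<phi> ` {r. \<forall>i. r $ i \<in> \<int>}"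

definition Gam :: "(real^4 \<Rightarrow> complex^2) \<Rightarrow> real \<Rightarrow> ((complex^2^2) \<times> (complex^2)) set" where
  "Gam \<phi> \<beta> = generate SU_group {A_mat \<beta>} \<times> Z4_lattice \<phi>"

text \<open>The orbits of \<open>\<Gamma>\<^sub>\<beta>\<close> under left translation are the right cosets \<open>\<Gamma>\<^sub>\<beta> x\<close>.\<close>

definition orbit ::
  "(real^4 \<Rightarrow> complex^2) \<Rightarrow> real \<Rightarrow> (complex^2^2) \<times> (complex^2) \<Rightarrow>
   ((complex^2^2) \<times> (complex^2)) set" where
  "orbit \<phi> \<beta> x = Gam \<phi> \<beta> #>\<^bsub>G\<^esub> x"

definition M_top :: "(real^4 \<Rightarrow> complex^2) \<Rightarrow> real \<Rightarrow> ((complex^2^2) \<times> (complex^2)) set topology"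
  where "M_top \<phi> \<beta> = quotient_topology (top_of_set (carrier G)) (orbit \<phi> \<beta>)"

definition M_atlas ::
  "(real^4 \<Rightarrow> complex^2) \<Rightarrow> real \<Rightarrow> (((complex^2^2) \<times> (complex^2)) set, real^7) chart set" where
  "M_atlas \<phi> \<beta> = quotient_atlas (orbit \<phi> \<beta>) (submanifold_atlas (carrier G))"

end

theory Submission
  imports Defs
begin

text \<open>In polar coordinates \<open>A, t \<mapsto> t A e\<^sub>1\<close>, the product \<open>SU(2) \<times> (b, c)\<close> with \<open>b > 0\<close> is an open
  shell in \<open>\<complex>\<^sup>2\<close>, so \<open>((A, q), t) \<mapsto> (t A e\<^sub>1, q)\<close> identifies \<open>G \<times> (b, c)\<close> with an open subset of the
  flat space \<open>\<complex>\<^sup>4\<close>. The element \<open>(A\<^sub>\<beta>\<^sup>m, r)\<close> of the group acts there as the isometry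
  \<open>(x, y) \<mapsto> (A\<^sub>\<beta>\<^sup>m x, A\<^sub>\<beta>\<^sup>m y + r)\<close>, so the flat metric descends to the quotient. Its parallel fields
  are the constant ones in the developing map, hence the holonomy consists of the linear parts
  \<open>diag(A\<^sub>\<beta>\<^sup>m, A\<^sub>\<beta>\<^sup>m)\<close>, which form a finite subgroup of \<open>SU(4)\<close>.\<close>

section \<open>Calculus of smooth maps\<close>

text \<open>The quotient atlas contains every chart induced by a parametrisation that is a smooth
  immersion and whose domain the quotient map sends injectively. Smoothness of transitions and
  invertibility of the developing map must therefore be proved for arbitrary charts. The first holds
  because a continuous lift of a smooth map through an immersion is smooth, the second because a
  matrix in SU(2) is determined by its first column, a unit vector. Explicit charts serve only to
  cover \<open>G\<close>.

  No solution of the transport equation is constructed: an upper bound for the holonomy follows by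
  tracking any given parallel field, which is locally constant in the developing map and changes by
  an element of \<open>H\<close> between charts.

  The finite order of \<open>A_mat \<beta>\<close> enters twice. The linear parts form a finite set,
  hence the holonomy is discrete; and the gap between 1 and the other \<open>p\<close>-th roots of
  unity, with the gap of the lattice, bounds below the displacement of every nontrivial group
  element, which makes the quotient Hausdorff and locally injective. Left translations act on the
  first column and keep its norm, so the radius is untouched.\<close>

lemma
  assumes "smooth_on f S"
  shows smooth_on_imp_continuous_on: "continuous_on S f"
    and smooth_on_imp_differentiable_on: "f differentiable_on S"
    and smooth_on_frechet_derivative: "smooth_on (\<lambda>x. frechet_derivative f (at x) v) S"
proof -
  have k: "Ck_on k f S" for k using assms unfolding smooth_on_def by blast
  show "continuous_on S f" using k[of 0] by (simp only: Ck_on.simps)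
  show "f differentiable_on S" using k[of "Suc 0"] by (simp only: Ck_on.simps)
  show "smooth_on (\<lambda>x. frechet_derivative f (at x) v) S"
    unfolding smooth_on_def
  proof
    fix j show "Ck_on j (\<lambda>x. frechet_derivative f (at x) v) S" using k[of "Suc j"] by simp
  qed
qed

lemma smooth_on_differentiable_at:
  assumes "smooth_on f S" "open S" "x \<in> S"
  shows "f differentiable at x"
  using smooth_on_imp_differentiable_on[OF assms(1)] assms(2,3)
  by (simp add: differentiable_on_eq_differentiable_at)

lemma smooth_on_has_derivative:
  assumes "smooth_on f S" "open S" "x \<in> S"
  shows "(f has_derivative frechet_derivative f (at x)) (at x)"
  using smooth_on_differentiable_at[OF assms] frechet_derivative_works by blast

text \<open>The derivatives are taken in the full space, so equality on \<open>S\<close> passes to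
  them only because \<open>S\<close> is open.\<close>

lemma Ck_on_cong:
  fixes f :: "'a::real_normed_vector \<Rightarrow> 'b::real_normed_vector"
  assumes "open S" "\<And>x. x \<in> S \<Longrightarrow> f x = g x" "Ck_on k f S"
  shows "Ck_on k g S"
  using assms(2,3)
proof (induction k arbitrary: f g)
  case 0
  then show ?case by (metis Ck_on.simps(1) continuous_on_cong)
next
  case (Suc k)
  have f: "f differentiable at x" if "x \<in> S" for x
    using Suc.prems(2) that assms(1) by (simp add: differentiable_on_eq_differentiable_at)
  have d: "(g has_derivative frechet_derivative f (at x)) (at x)" if "x \<in> S" for x
    using has_derivative_transform_within_open[OF _ assms(1) that] f[OF that]
    by (metis Suc.prems(1) frechet_derivative_works)
  have "frechet_derivative f (at x) v = frechet_derivative g (at x) v" if "x \<in> S" for x v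
    using frechet_derivative_at[OF d[OF that]] by simp
  then have "Ck_on k (\<lambda>x. frechet_derivative g (at x) v) S" for v
    using Suc.IH[of "\<lambda>x. frechet_derivative f (at x) v" "\<lambda>x. frechet_derivative g (at x) v"]
      Suc.prems(2) by simp
  moreover have "g differentiable_on S"
    using d by (meson differentiable_def differentiable_at_withinI differentiable_on_def)
  ultimately show ?case by simp
qed

text \<open>Replaces the chosen \<open>frechet_derivative\<close> by any explicit formula
  \<open>f'\<close>; all the closure inductions below run through this rule.\<close>

lemma Ck_on_SucI:
  assumes "open S" "\<And>x. x \<in> S \<Longrightarrow> (f has_derivative f' x) (at x)"
    "\<And>v. Ck_on k (\<lambda>x. f' x v) S"
  shows "Ck_on (Suc k) f S"
proof -
  have "f' x v = frechet_derivative f (at x) v" if "x \<in> S" for x v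
    using frechet_derivative_at[OF assms(2)[OF that]] by simp
  then have "Ck_on k (\<lambda>x. frechet_derivative f (at x) v) S" for v
    by (rule Ck_on_cong[OF assms(1) _ assms(3)])
  moreover have "f differentiable_on S"
    using assms(2) by (meson differentiable_def differentiable_at_withinI differentiable_on_def)
  ultimately show ?thesis by simp
qed

lemma Ck_on_subset: "Ck_on k f S \<Longrightarrow> T \<subseteq> S \<Longrightarrow> Ck_on k f T"
  by (induction k arbitrary: f) (auto intro: continuous_on_subset differentiable_on_subset)

lemma Ck_on_Suc_imp: "Ck_on (Suc k) f S \<Longrightarrow> Ck_on k f S"
proof (induction k arbitrary: f)
  case 0
  then show ?case by (simp add: differentiable_imp_continuous_on)
qed auto

lemma Ck_on_const: "Ck_on k (\<lambda>x. c) S"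
proof (induction k arbitrary: c)
  case (Suc k)
  then show ?case by simp
qed simp

lemma Ck_on_bounded_linear:
  assumes "bounded_linear f" shows "Ck_on k f S"
proof (cases k)
  case (Suc j)
  have "frechet_derivative f (at x) = f" for x
    using frechet_derivative_at bounded_linear_imp_has_derivative[OF assms] by metis
  then show ?thesis
    using Suc bounded_linear_imp_differentiable_on[OF assms] Ck_on_const by auto
qed (use assms linear_continuous_on in auto)

text \<open>The product rule turns the derivative into a sum of two terms of the same bilinear
  shape, so the induction generalises over \<open>f\<close> and \<open>g\<close>. Closure under sums
  is needed inside it and is therefore proved first.\<close>

lemma Ck_on_bilinear:
  fixes f :: "'a::real_normed_vector \<Rightarrow> 'b::real_normed_vector" and g :: "'a \<Rightarrow> 'c::real_normed_vector"
    and h :: "'b \<Rightarrow> 'c \<Rightarrow> 'd::real_normed_vector"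
  assumes "bounded_bilinear h" "open S" "Ck_on k f S" "Ck_on k g S"
  shows "Ck_on k (\<lambda>x. h (f x) (g x)) S"
proof -
  interpret h: bounded_bilinear h by fact
  have add: "Ck_on k (\<lambda>x. f x + g x) S"
    if "Ck_on k f S" "Ck_on k g S" for k and f g :: "'a \<Rightarrow> 'd"
    using that
  proof (induction k arbitrary: f g)
    case 0
    then show ?case by (simp add: continuous_on_add)
  next
    case (Suc k)
    have "((\<lambda>x. f x + g x) has_derivative
        (\<lambda>v. frechet_derivative f (at x) v + frechet_derivative g (at x) v)) (at x)"
      if "x \<in> S" for x
      using Suc.prems that assms(2)
      by (intro has_derivative_add)
        (auto simp: differentiable_on_eq_differentiable_at frechet_derivative_works[symmetric])
    then show ?case
      using Suc by (intro Ck_on_SucI[OF assms(2)]) auto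
  qed
  show ?thesis using assms(3,4)
  proof (induction k arbitrary: f g)
    case 0
    then show ?case by (simp add: h.continuous_on)
  next
    case (Suc k)
    have d: "((\<lambda>x. h (f x) (g x)) has_derivative
        (\<lambda>v. h (f x) (frechet_derivative g (at x) v) + h (frechet_derivative f (at x) v) (g x))) (at x)"
      if "x \<in> S" for x
      using Suc.prems that assms(2)
      by (intro h.FDERIV)
        (auto simp: differentiable_on_eq_differentiable_at frechet_derivative_works[symmetric])
    have "Ck_on k f S" "Ck_on k g S" using Suc.prems Ck_on_Suc_imp by blast+
    then show ?case
      using Suc by (intro Ck_on_SucI[OF assms(2) d] add Suc.IH) auto
  qed
qed

lemma Ck_on_linear_compose:
  assumes "bounded_linear h" "open S" "Ck_on k f S"
  shows "Ck_on k (\<lambda>x. h (f x)) S"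
proof -
  interpret bounded_linear h by fact
  \<comment> \<open>A linear map is recovered from this bilinear one by freezing the scalar at
    1.\<close>
  have "bounded_bilinear (\<lambda>(r::real) y. r *\<^sub>R h y)"
    using bounded_bilinear.comp[OF bounded_bilinear_scaleR bounded_linear_ident assms(1)] .
  from Ck_on_bilinear[OF this assms(2) Ck_on_const[of _ 1] assms(3)] show ?thesis by simp
qed

lemma Ck_on_Pair:
  assumes "open S" "Ck_on k f S" "Ck_on k g S"
  shows "Ck_on k (\<lambda>x. (f x, g x)) S"
  using assms(2,3)
proof (induction k arbitrary: f g)
  case (Suc k)
  have d: "((\<lambda>x. (f x, g x)) has_derivative
      (\<lambda>v. (frechet_derivative f (at x) v, frechet_derivative g (at x) v))) (at x)"
    if "x \<in> S" for x
    using Suc.prems that assms(1)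
    by (intro has_derivative_Pair)
      (auto simp: differentiable_on_eq_differentiable_at frechet_derivative_works[symmetric])
  show ?case
    using Suc by (intro Ck_on_SucI[OF assms(1) d] Suc.IH) auto
qed (simp add: continuous_on_Pair)

lemma Ck_on_add:
  assumes "open S" "Ck_on k f S" "Ck_on k g S"
  shows "Ck_on k (\<lambda>x. f x + g x) S"
proof -
  have "bounded_linear (\<lambda>p::'b \<times> 'b. fst p + snd p)"
    by (intro bounded_linear_add bounded_linear_fst bounded_linear_snd)
  from Ck_on_linear_compose[OF this assms(1) Ck_on_Pair[OF assms]] show ?thesis by simp
qed

lemma Ck_on_sum:
  assumes "open S" "\<And>i. i \<in> I \<Longrightarrow> Ck_on k (f i) S"
  shows "Ck_on k (\<lambda>x. \<Sum>i\<in>I. f i x) S"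
  using assms(2)
  by (induction I rule: infinite_finite_induct) (auto intro!: Ck_on_add Ck_on_const assms(1))

lemma Ck_on_prod:
  fixes f :: "'i \<Rightarrow> 'a::real_normed_vector \<Rightarrow> real"
  assumes "open S" "\<And>i. i \<in> I \<Longrightarrow> Ck_on k (f i) S"
  shows "Ck_on k (\<lambda>x. \<Prod>i\<in>I. f i x) S"
  using assms(2)
  by (induction I rule: infinite_finite_induct)
    (auto intro!: Ck_on_bilinear[OF bounded_bilinear_mult] Ck_on_const assms(1))

text \<open>\<open>Ck_on\<close> speaks of derivatives in a fixed direction, whereas the chain rule
  differentiates \<open>f\<close> in the moving direction \<open>Dg v\<close>. Expanding that
  direction in \<open>Basis\<close> leaves only fixed directions of \<open>f\<close>, with
  coefficients of class \<open>k\<close>.\<close>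

lemma Ck_on_compose:
  fixes f :: "'a::euclidean_space \<Rightarrow> 'b::real_normed_vector" and g :: "'c::real_normed_vector \<Rightarrow> 'a"
  assumes "open S" "open T" "g ` S \<subseteq> T" "Ck_on k f T" "Ck_on k g S"
  shows "Ck_on k (\<lambda>x. f (g x)) S"
  using assms(4,5)
proof (induction k arbitrary: f)
  case 0
  then have "continuous_on T f" "continuous_on S g" by simp_all
  from continuous_on_compose2[OF this assms(3)] show ?case by simp
next
  case (Suc k)
  have f: "(f has_derivative frechet_derivative f (at y)) (at y)" if "y \<in> T" for y
    using Suc.prems that assms(2)
    by (auto simp: differentiable_on_eq_differentiable_at frechet_derivative_works[symmetric])
  have g: "(g has_derivative frechet_derivative g (at x)) (at x)" if "x \<in> S" for x
    using Suc.prems that assms(1)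
    by (auto simp: differentiable_on_eq_differentiable_at frechet_derivative_works[symmetric])
  have d: "((\<lambda>x. f (g x)) has_derivative
      (\<lambda>v. \<Sum>b\<in>Basis. (frechet_derivative g (at x) v \<bullet> b) *\<^sub>R frechet_derivative f (at (g x)) b)) (at x)"
    if x: "x \<in> S" for x
  proof -
    have gx: "g x \<in> T" using x assms(3) by auto
    interpret bounded_linear "frechet_derivative f (at (g x))"
      using f[OF gx] has_derivative_bounded_linear by blast
    have "frechet_derivative f (at (g x)) w =
        (\<Sum>b\<in>Basis. (w \<bullet> b) *\<^sub>R frechet_derivative f (at (g x)) b)" for w
      using arg_cong[OF euclidean_representation[of w, symmetric],
          of "frechet_derivative f (at (g x))"] unfolding sum scaleR .
    then show ?thesis
      by (intro has_derivative_eq_rhs[OF has_derivative_compose[OF g[OF x] f[OF gx]]] ext)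
  qed
  have "Ck_on k g S" using Suc.prems Ck_on_Suc_imp by blast
  show ?case
  proof (rule Ck_on_SucI[OF assms(1) d])
    fix v
    show "Ck_on k (\<lambda>x. \<Sum>b\<in>Basis. (frechet_derivative g (at x) v \<bullet> b) *\<^sub>R
        frechet_derivative f (at (g x)) b) S"
    proof (intro Ck_on_sum Ck_on_bilinear[OF bounded_bilinear_scaleR] assms(1))
      fix b :: 'a assume "b \<in> Basis"
      have "Ck_on k (\<lambda>x. frechet_derivative g (at x) v) S" using Suc.prems by simp
      then show "Ck_on k (\<lambda>x. frechet_derivative g (at x) v \<bullet> b) S"
        by (rule Ck_on_linear_compose[OF bounded_linear_inner_left assms(1)])
      have "Ck_on k (\<lambda>y. frechet_derivative f (at y) b) T" using Suc.prems by simp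
      then show "Ck_on k (\<lambda>x. frechet_derivative f (at (g x)) b) S"
        using \<open>Ck_on k g S\<close> by (rule Suc.IH)
    qed
  qed
qed

text \<open>The derivative is again a product of copies of \<open>inverse\<close>, so the induction
  closes on itself.\<close>

lemma Ck_on_inverse: "Ck_on k (inverse :: real \<Rightarrow> real) (- {0})"
proof (induction k)
  case 0
  then show ?case by (auto intro!: continuous_intros)
next
  case (Suc k)
  have o: "open (- {0::real})" by (simp add: open_Compl)
  have d: "(inverse has_derivative (\<lambda>v. - (inverse x * v * inverse x))) (at x)"
    if "x \<in> - {0}" for x :: real
    using has_derivative_inverse'[of x UNIV] that by simp
  show ?case
  proof (rule Ck_on_SucI[OF o d])
    fix v :: real
    show "Ck_on k (\<lambda>x. - (inverse x * v * inverse x)) (- {0})"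
      by (intro Ck_on_linear_compose[OF bounded_linear_minus[OF bounded_linear_ident]]
          Ck_on_bilinear[OF bounded_bilinear_mult] Ck_on_const Suc o)
  qed auto
qed

lemma Ck_on_local:
  fixes f :: "'a::real_normed_vector \<Rightarrow> 'b::real_normed_vector"
  assumes "\<And>x. x \<in> S \<Longrightarrow> \<exists>T. open T \<and> x \<in> T \<and> Ck_on k f T"
  shows "Ck_on k f S"
  using assms
proof (induction k arbitrary: f)
  case 0
  have "continuous (at x) f" if "x \<in> S" for x
    using 0[OF that] by (auto simp: continuous_on_eq_continuous_at)
  then show ?case by (simp add: continuous_at_imp_continuous_on)
next
  case (Suc k)
  have "f differentiable_on S"
    unfolding differentiable_on_def
  proof
    fix x assume "x \<in> S"
    then obtain T where T: "open T" "x \<in> T" "Ck_on (Suc k) f T" using Suc.prems by blast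
    then have "f differentiable at x" by (simp add: differentiable_on_eq_differentiable_at)
    then show "f differentiable at x within S" by (rule differentiable_at_withinI)
  qed
  moreover have "Ck_on k (\<lambda>x. frechet_derivative f (at x) v) S" for v
  proof (rule Suc.IH)
    fix x assume "x \<in> S"
    then obtain T where "open T" "x \<in> T" "Ck_on (Suc k) f T" using Suc.prems by blast
    then show "\<exists>T. open T \<and> x \<in> T \<and> Ck_on k (\<lambda>x. frechet_derivative f (at x) v) T"
      by auto
  qed
  ultimately show ?case by simp
qed

lemma Ck_on_vec_nth:
  fixes f :: "'a::real_normed_vector \<Rightarrow> real^'n"
  assumes "open S" "\<And>i. Ck_on k (\<lambda>x. f x $ i) S"
  shows "Ck_on k f S"
proof -
  have eq: "(\<Sum>i\<in>UNIV. f x $ i *\<^sub>R (axis i 1 :: real^'n)) = f x" for x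
    by (simp add: basis_expansion flip: scalar_mult_eq_scaleR)
  have "Ck_on k (\<lambda>x. \<Sum>i\<in>UNIV. f x $ i *\<^sub>R (axis i 1 :: real^'n)) S"
    by (intro Ck_on_sum Ck_on_bilinear[OF bounded_bilinear_scaleR] Ck_on_const assms)
  then show ?thesis unfolding eq .
qed

lemma Ck_on_det:
  fixes f :: "'a::real_normed_vector \<Rightarrow> real^'n^'n"
  assumes "open S" "\<And>i j. Ck_on k (\<lambda>x. f x $ i $ j) S"
  shows "Ck_on k (\<lambda>x. det (f x)) S"
  unfolding det_def
  by (intro Ck_on_sum Ck_on_bilinear[OF bounded_bilinear_mult] Ck_on_prod Ck_on_const assms)

lemma Ck_on_divide:
  fixes f :: "'a::real_normed_vector \<Rightarrow> real"
  assumes "open S" "Ck_on k f S" "Ck_on k g S" "\<And>x. x \<in> S \<Longrightarrow> g x \<noteq> 0"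
  shows "Ck_on k (\<lambda>x. f x / g x) S"
proof -
  have "Ck_on k (\<lambda>x. inverse (g x)) S"
    by (rule Ck_on_compose[OF assms(1) _ _ Ck_on_inverse assms(3)])
      (use assms(4) in \<open>auto simp: open_Compl\<close>)
  then show ?thesis
    unfolding divide_inverse by (intro Ck_on_bilinear[OF bounded_bilinear_mult] assms)
qed

lemma smooth_on_cong:
  assumes "open S" "\<And>x. x \<in> S \<Longrightarrow> f x = g x" "smooth_on f S"
  shows "smooth_on g S"
  using Ck_on_cong[of S f g] assms unfolding smooth_on_def by blast

lemma smooth_on_subset: "smooth_on f S \<Longrightarrow> T \<subseteq> S \<Longrightarrow> smooth_on f T"
  using Ck_on_subset unfolding smooth_on_def by blast

lemma smooth_on_const: "smooth_on (\<lambda>x. c) S"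
  by (simp add: smooth_on_def Ck_on_const)

lemma smooth_on_bounded_linear: "bounded_linear f \<Longrightarrow> smooth_on f S"
  by (simp add: smooth_on_def Ck_on_bounded_linear)

lemma smooth_on_linear_compose:
  "bounded_linear h \<Longrightarrow> open S \<Longrightarrow> smooth_on f S \<Longrightarrow> smooth_on (\<lambda>x. h (f x)) S"
  by (simp add: smooth_on_def Ck_on_linear_compose)

lemma smooth_on_bilinear:
  "bounded_bilinear h \<Longrightarrow> open S \<Longrightarrow> smooth_on f S \<Longrightarrow> smooth_on g S \<Longrightarrow> smooth_on (\<lambda>x. h (f x) (g x)) S"
  by (simp add: smooth_on_def Ck_on_bilinear)

lemma smooth_on_add:
  "open S \<Longrightarrow> smooth_on f S \<Longrightarrow> smooth_on g S \<Longrightarrow> smooth_on (\<lambda>x. f x + g x) S"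
  by (simp add: smooth_on_def Ck_on_add)

lemma smooth_on_Pair:
  "open S \<Longrightarrow> smooth_on f S \<Longrightarrow> smooth_on g S \<Longrightarrow> smooth_on (\<lambda>x. (f x, g x)) S"
  by (simp add: smooth_on_def Ck_on_Pair)

lemma smooth_on_divide:
  fixes f g :: "'a::real_normed_vector \<Rightarrow> real"
  shows "open S \<Longrightarrow> smooth_on f S \<Longrightarrow> smooth_on g S \<Longrightarrow> (\<And>x. x \<in> S \<Longrightarrow> g x \<noteq> 0) \<Longrightarrow>
    smooth_on (\<lambda>x. f x / g x) S"
  by (simp add: smooth_on_def Ck_on_divide)

lemma smooth_on_compose:
  fixes f :: "'a::euclidean_space \<Rightarrow> 'b::real_normed_vector" and g :: "'c::real_normed_vector \<Rightarrow> 'a"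
  assumes "open S" "open T" "g ` S \<subseteq> T" "smooth_on f T" "smooth_on g S"
  shows "smooth_on (\<lambda>x. f (g x)) S"
  using Ck_on_compose[OF assms(1-3)] assms(4,5) unfolding smooth_on_def by blast

lemma smooth_on_local:
  assumes "\<And>x. x \<in> S \<Longrightarrow> \<exists>T. open T \<and> x \<in> T \<and> smooth_on f T"
  shows "smooth_on f S"
  unfolding smooth_on_def
proof
  fix k show "Ck_on k f S"
    using assms unfolding smooth_on_def by (intro Ck_on_local) blast
qed

section \<open>Lifts through immersions\<close>

lemma linear_axis_expansion:
  fixes f :: "real^'n \<Rightarrow> 'b::real_vector"
  assumes "linear f"
  shows "f w = (\<Sum>j\<in>UNIV. w $ j *\<^sub>R f (axis j 1))"
proof -
  interpret linear f by fact
  have "w = (\<Sum>j\<in>UNIV. w $ j *\<^sub>R axis j 1)"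
    by (simp add: basis_expansion flip: scalar_mult_eq_scaleR)
  from arg_cong[OF this, of f] show ?thesis unfolding sum scale .
qed

text \<open>A linear left inverse \<open>L\<close> of \<open>\<Psi>'\<close> gives
  \<open>k = L \<circ> \<Psi>\<close> with derivative the identity at \<open>u x\<close>, while
  \<open>k \<circ> u\<close> agrees near \<open>x\<close> with the differentiable map
  \<open>L \<circ> h\<close>. Continuity of \<open>u\<close> then suffices, as in the proof that a
  continuous local inverse is differentiable.\<close>

lemma immersion_lift_has_derivative:
  fixes \<Psi> :: "'e::euclidean_space \<Rightarrow> 'a::euclidean_space" and u :: "'c::real_normed_vector \<Rightarrow> 'e"
  assumes \<Psi>: "(\<Psi> has_derivative \<Psi>') (at (u x))" and "inj \<Psi>'"
    and u: "continuous (at x) u" and h: "(h has_derivative h') (at x)"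
    and T: "open T" "x \<in> T" "\<And>z. z \<in> T \<Longrightarrow> \<Psi> (u z) = h z"
  shows "u differentiable at x"
proof -
  have "linear \<Psi>'" by (rule has_derivative_linear[OF \<Psi>])
  then obtain L where L: "linear L" "L \<circ> \<Psi>' = id"
    using linear_injective_left_inverse[OF \<open>linear \<Psi>'\<close> \<open>inj \<Psi>'\<close>] by blast
  have bL: "bounded_linear L" using L(1) by (simp add: linear_conv_bounded_linear)
  define k where "k = (\<lambda>y. L (\<Psi> y))"
  define m where "m = (\<lambda>z. L (h z))"
  define u' where "u' = (\<lambda>v. L (h' v))"
  have "L (\<Psi>' v) = v" for v using L(2) by (metis comp_apply id_apply)
  then have k: "(k has_derivative (\<lambda>v. v)) (at (u x))"
    unfolding k_def using bounded_linear.has_derivative[OF bL \<Psi>] by simp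
  have m: "(m has_derivative u') (at x)"
    unfolding m_def u'_def by (rule bounded_linear.has_derivative[OF bL h])
  have km: "k (u z) = m z" if "z \<in> T" for z using T(3)[OF that] by (simp add: k_def m_def)
  have "bounded_linear u'" by (rule has_derivative_bounded_linear[OF m])
  then obtain C where C: "C > 0" "\<And>v. norm (u' v) \<le> norm v * C"
    using bounded_linear.pos_bounded by blast
  have main: "\<exists>d>0. \<forall>z. norm (z - x) < d \<longrightarrow>
      norm (u z - u x - (m z - m x)) \<le> e * norm (u z - u x) \<and>
      norm (m z - m x - u' (z - x)) \<le> e * norm (z - x)" if "e > 0" for e
  proof -
    obtain r where r: "r > 0" "\<And>y. norm (y - u x) < r \<Longrightarrow> norm (k y - k (u x) - (y - u x)) \<le> e * norm (y - u x)"
      using k \<open>e > 0\<close> unfolding has_derivative_at_alt by blast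
    obtain d1 where d1: "d1 > 0" "\<And>z. norm (z - x) < d1 \<Longrightarrow> norm (u z - u x) < r"
      using u r(1) unfolding continuous_at_eps_delta dist_norm by blast
    obtain d2 where d2: "d2 > 0" "\<And>z. norm (z - x) < d2 \<Longrightarrow> norm (m z - m x - u' (z - x)) \<le> e * norm (z - x)"
      using m \<open>e > 0\<close> unfolding has_derivative_at_alt by blast
    obtain d3 where d3: "d3 > 0" "\<And>z. norm (z - x) < d3 \<Longrightarrow> z \<in> T"
      using T(1,2) unfolding open_dist dist_norm by blast
    show ?thesis
    proof (intro exI[of _ "min d1 (min d2 d3)"] conjI allI impI)
      fix z assume z: "norm (z - x) < min d1 (min d2 d3)"
      have "norm (k (u z) - k (u x) - (u z - u x)) \<le> e * norm (u z - u x)"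
        using z by (intro r d1) simp
      moreover have "k (u z) = m z" "k (u x) = m x" using z d3 T(2) km by auto
      ultimately show "norm (u z - u x - (m z - m x)) \<le> e * norm (u z - u x)"
        by (simp add: norm_minus_commute)
      show "norm (m z - m x - u' (z - x)) \<le> e * norm (z - x)" using z d2 by simp
    qed (use d1 d2 d3 in auto)
  qed
  have "(u has_derivative u') (at x)"
    unfolding has_derivative_at_alt
  proof (intro conjI allI impI)
    fix e :: real assume "e > 0"
    \<comment> \<open>With \<open>e' < 1/2\<close> the term \<open>e' * U\<close> can be absorbed,
      which gives \<open>U \<le> 2 * (C + 1) * N\<close>. The total error is then at most
      \<open>e' * (2 * (C + 1) + 1) * N\<close>, whence this divisor.\<close>
    have "e / (2 * (C + 1) + 1) > 0" using \<open>e > 0\<close> C(1) by simp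
    then obtain e' where e': "e' > 0" "e' < 1/2" "e' < e / (2 * (C + 1) + 1)"
      using field_lbound_gt_zero[of "1/2" "e / (2 * (C + 1) + 1)"] by auto
    have e'': "e' * (2 * (C + 1) + 1) \<le> e"
      using e'(3) C(1) by (simp add: field_simps)
    obtain d where d: "d > 0" "\<And>z. norm (z - x) < d \<Longrightarrow>
      norm (u z - u x - (m z - m x)) \<le> e' * norm (u z - u x) \<and>
      norm (m z - m x - u' (z - x)) \<le> e' * norm (z - x)"
      using main[OF e'(1)] by blast
    show "\<exists>d>0. \<forall>z. norm (z - x) < d \<longrightarrow> norm (u z - u x - u' (z - x)) \<le> e * norm (z - x)"
    proof (intro exI[of _ d] conjI allI impI)
      fix z assume z: "norm (z - x) < d"
      define N where "N = norm (z - x)"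
      define U where "U = norm (u z - u x)"
      have N: "N \<ge> 0" and U: "U \<ge> 0" by (auto simp: N_def U_def)
      have 1: "norm (u z - u x - (m z - m x)) \<le> e' * U" "norm (m z - m x - u' (z - x)) \<le> e' * N"
        using d(2)[OF z] by (auto simp: U_def N_def)
      have "norm (m z - m x) \<le> norm (m z - m x - u' (z - x)) + norm (u' (z - x))"
        by (metis add.commute diff_add_cancel norm_triangle_ineq)
      also have "\<dots> \<le> e' * N + N * C" using 1(2) C(2)[of "z - x"] by (simp add: N_def)
      also have "\<dots> \<le> N * (C + 1)" using mult_right_mono[of e' 1 N] e'(2) N by (simp add: algebra_simps)
      finally have 2: "norm (m z - m x) \<le> N * (C + 1)" .
      have "U \<le> norm (u z - u x - (m z - m x)) + norm (m z - m x)"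
        unfolding U_def by (metis diff_add_cancel norm_triangle_ineq)
      also have "\<dots> \<le> (1/2) * U + N * (C + 1)" using 1(1) 2 mult_right_mono[of e' "1/2" U] e'(2) U by linarith
      finally have 3: "U \<le> 2 * (C + 1) * N" by (simp add: algebra_simps)
      have "norm (u z - u x - u' (z - x)) \<le> norm (u z - u x - (m z - m x)) + norm (m z - m x - u' (z - x))"
        using norm_triangle_ineq[of "u z - u x - (m z - m x)" "m z - m x - u' (z - x)"] by simp
      also have "\<dots> \<le> e' * U + e' * N" using 1 by linarith
      also have "\<dots> \<le> e' * (2 * (C + 1) * N) + e' * N" using 3 e'(1) by simp
      also have "\<dots> = e' * (2 * (C + 1) + 1) * N" by (simp add: algebra_simps)
      also have "\<dots> \<le> e * N" using e'' N by (rule mult_right_mono)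
      finally show "norm (u z - u x - u' (z - x)) \<le> e * norm (z - x)" by (simp add: N_def)
    qed (fact d(1))
  qed fact
  then show ?thesis by (auto simp: differentiable_def)
qed

text \<open>The derivative of a lift solves the normal equations of the immersion, so Cramer's rule
  exhibits it as smooth in the lift itself; this bootstraps the regularity of the lift.\<close>

lemma immersion_lift_smooth:
  fixes \<Psi> :: "real^'n \<Rightarrow> 'a::euclidean_space" and u :: "'c::real_normed_vector \<Rightarrow> real^'n"
  assumes V: "open V" "smooth_on \<Psi> V" "\<And>y. y \<in> V \<Longrightarrow> inj (frechet_derivative \<Psi> (at y))"
    and S: "open S" "continuous_on S u" "u ` S \<subseteq> V" "smooth_on (\<lambda>x. \<Psi> (u x)) S"
  shows "smooth_on u S"
proof -
  define h where "h = (\<lambda>x. \<Psi> (u x))"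
  define P where "P i y = frechet_derivative \<Psi> (at y) (axis i 1)" for i y
  \<comment> \<open>\<open>A y\<close> is the Gram matrix of the partial derivatives of
    \<open>\<Psi>\<close>, and \<open>b v x\<close> the right-hand side of the normal equations at
    \<open>u x\<close>.\<close>
  define A where "A y = (\<chi> i j. P j y \<bullet> P i y)" for y
  define b where "b v x = (\<chi> i. frechet_derivative h (at x) v \<bullet> P i (u x))" for v x
  have uV: "u x \<in> V" if "x \<in> S" for x using that S(3) by auto
  have \<Psi>: "(\<Psi> has_derivative frechet_derivative \<Psi> (at y)) (at y)" if "y \<in> V" for y
    using smooth_on_has_derivative[OF V(2,1) that] .
  have h: "(h has_derivative frechet_derivative h (at x)) (at x)" if "x \<in> S" for x
    unfolding h_def using smooth_on_has_derivative[OF S(4,1) that] .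
  have du: "u differentiable at x" if "x \<in> S" for x
    using S(2) that S(1)
    by (intro immersion_lift_has_derivative[OF \<Psi>[OF uV] V(3)[OF uV] _ h S(1)])
      (auto simp: h_def continuous_on_eq_continuous_at)
  then have u: "(u has_derivative frechet_derivative u (at x)) (at x)" if "x \<in> S" for x
    using that frechet_derivative_works by blast
  have A: "A y *v w = (\<chi> i. frechet_derivative \<Psi> (at y) w \<bullet> P i y)" if "y \<in> V" for y w
  proof -
    have "frechet_derivative \<Psi> (at y) w = (\<Sum>j\<in>UNIV. w $ j *\<^sub>R P j y)"
      unfolding P_def by (rule linear_axis_expansion[OF has_derivative_linear[OF \<Psi>[OF that]]])
    then show ?thesis
      by (simp add: A_def matrix_vector_mult_def vec_eq_iff inner_sum_left mult.commute)
  qed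
  have detA: "det (A y) \<noteq> 0" if "y \<in> V" for y
  proof -
    interpret bounded_linear "frechet_derivative \<Psi> (at y)"
      by (rule has_derivative_bounded_linear[OF \<Psi>[OF that]])
    \<comment> \<open>The quadratic form of the Gram matrix at \<open>w\<close> is the squared norm
      of \<open>D\<Psi> w\<close>, so a kernel vector is killed by the injective derivative.\<close>
    have "w = 0" if w: "A y *v w = 0" for w
    proof -
      let ?d = "frechet_derivative \<Psi> (at y) w"
      have "?d = (\<Sum>j\<in>UNIV. w $ j *\<^sub>R P j y)"
        unfolding P_def by (rule linear_axis_expansion[OF has_derivative_linear[OF \<Psi>[OF \<open>y \<in> V\<close>]]])
      then have "?d \<bullet> ?d = (\<Sum>j\<in>UNIV. w $ j * (?d \<bullet> P j y))"
        by (metis (no_types, lifting) inner_scaleR_right inner_sum_right sum.cong)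
      also have "\<dots> = 0" using w unfolding A[OF \<open>y \<in> V\<close>] by (simp add: vec_eq_iff)
      finally have "?d = 0" by simp
      then show "w = 0" using V(3)[OF \<open>y \<in> V\<close>] zero by (metis injD)
    qed
    then show ?thesis
      by (metis invertible_det_nz invertible_left_inverse matrix_left_invertible_ker)
  qed
  have Du: "frechet_derivative u (at x) v =
      (\<chi> k. det (\<chi> i j. if j = k then b v x $ i else A (u x) $ i $ j) / det (A (u x)))"
    if x: "x \<in> S" for x v
  proof -
    have "(h has_derivative (\<lambda>v. frechet_derivative \<Psi> (at (u x)) (frechet_derivative u (at x) v))) (at x)"
      unfolding h_def by (rule has_derivative_compose[OF u[OF x] \<Psi>[OF uV[OF x]]])
    then have "frechet_derivative h (at x) = (\<lambda>v. frechet_derivative \<Psi> (at (u x)) (frechet_derivative u (at x) v))"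
      using frechet_derivative_at by metis
    then have "A (u x) *v frechet_derivative u (at x) v = b v x"
      by (simp add: A[OF uV[OF x]] b_def)
    then show ?thesis using cramer[OF detA[OF uV[OF x]]] by blast
  qed
  have "Ck_on k u S" for k
  proof (induction k)
    case 0
    then show ?case using S(2) by simp
  next
    case (Suc k)
    have Pk: "Ck_on k (\<lambda>x. P i (u x)) S" for i
    proof (rule Ck_on_compose[OF S(1) V(1) S(3) _ Suc])
      show "Ck_on k (P i) V"
        using smooth_on_frechet_derivative[OF V(2)] unfolding P_def smooth_on_def by blast
    qed
    have Ak: "Ck_on k (\<lambda>x. A (u x) $ i $ j) S" for i j
      unfolding A_def by (simp add: Ck_on_bilinear[OF bounded_bilinear_inner S(1) Pk Pk])
    have "Ck_on k (\<lambda>x. frechet_derivative h (at x) v) S" for v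
      using smooth_on_frechet_derivative[OF S(4)] unfolding h_def smooth_on_def by blast
    then have bk: "Ck_on k (\<lambda>x. b v x $ i) S" for v i
      unfolding b_def by (simp add: Ck_on_bilinear[OF bounded_bilinear_inner S(1) _ Pk])
    show ?case
    proof (rule Ck_on_SucI[OF S(1) u])
      fix v
      have "Ck_on k (\<lambda>x. \<chi> k. det (\<chi> i j. if j = k then b v x $ i else A (u x) $ i $ j) / det (A (u x))) S"
      proof (rule Ck_on_vec_nth[OF S(1)], simp only: vec_lambda_beta, rule Ck_on_divide[OF S(1)])
        fix l
        show "Ck_on k (\<lambda>x. det (A (u x))) S" by (rule Ck_on_det[OF S(1) Ak])
        show "Ck_on k (\<lambda>x. det (\<chi> i j. if j = l then b v x $ i else A (u x) $ i $ j)) S"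
        proof (rule Ck_on_det[OF S(1)])
          fix i j show "Ck_on k (\<lambda>x. (\<chi> i j. if j = l then b v x $ i else A (u x) $ i $ j) $ i $ j) S"
            using Ak bk by (cases "j = l") auto
        qed
      qed (use detA uV in auto)
      then show "Ck_on k (\<lambda>x. frechet_derivative u (at x) v) S"
        by (rule Ck_on_cong[OF S(1), rotated]) (simp add: Du)
    qed
  qed
  then show ?thesis by (simp add: smooth_on_def)
qed

section \<open>Pullbacks of the flat metric\<close>

text \<open>The mean value theorem is applied to a first difference in direction \<open>v\<close>,
  then to \<open>f'\<close> evaluated at \<open>u\<close>. The second difference on the left is
  symmetric in \<open>u\<close> and \<open>v\<close>, which is the point of the lemma.\<close>

lemma second_difference_mean_value:
  fixes f :: "'a::real_normed_vector \<Rightarrow> real"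
  assumes f: "\<And>y. y \<in> S \<Longrightarrow> (f has_derivative f' y) (at y)"
    and f': "\<And>y. y \<in> S \<Longrightarrow> ((\<lambda>y. f' y u) has_derivative f'' y) (at y)"
    and h: "0 < h" and S: "\<And>s t. 0 \<le> s \<Longrightarrow> s \<le> h \<Longrightarrow> 0 \<le> t \<Longrightarrow> t \<le> h \<Longrightarrow> x + s *\<^sub>R u + t *\<^sub>R v \<in> S"
  obtains s t where "0 < s" "s < h" "0 < t" "t < h"
    "f (x + h *\<^sub>R u + h *\<^sub>R v) - f (x + h *\<^sub>R u) - f (x + h *\<^sub>R v) + f x
      = h * h * f'' (x + s *\<^sub>R u + t *\<^sub>R v) v"
proof -
  have d1: "((\<lambda>s. f (x + s *\<^sub>R u + t *\<^sub>R v)) has_real_derivative f' (x + s *\<^sub>R u + t *\<^sub>R v) u) (at s)"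
    if "0 \<le> s" "s \<le> h" "0 \<le> t" "t \<le> h" for s t
  proof -
    have y: "x + s *\<^sub>R u + t *\<^sub>R v \<in> S" using S that by blast
    interpret bounded_linear "f' (x + s *\<^sub>R u + t *\<^sub>R v)"
      by (rule has_derivative_bounded_linear[OF f[OF y]])
    have "((\<lambda>s. x + s *\<^sub>R u + t *\<^sub>R v) has_derivative (\<lambda>r. r *\<^sub>R u)) (at s)"
      by (auto intro!: derivative_eq_intros)
    from has_derivative_compose[OF this f[OF y]] show ?thesis
      unfolding has_field_derivative_def by (rule has_derivative_eq_rhs) (auto simp: scaleR)
  qed
  have d2: "((\<lambda>t. f' (x + s *\<^sub>R u + t *\<^sub>R v) u) has_real_derivative f'' (x + s *\<^sub>R u + t *\<^sub>R v) v) (at t)"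
    if "0 \<le> s" "s \<le> h" "0 \<le> t" "t \<le> h" for s t
  proof -
    have y: "x + s *\<^sub>R u + t *\<^sub>R v \<in> S" using S that by blast
    interpret bounded_linear "f'' (x + s *\<^sub>R u + t *\<^sub>R v)"
      by (rule has_derivative_bounded_linear[OF f'[OF y]])
    have "((\<lambda>t. x + s *\<^sub>R u + t *\<^sub>R v) has_derivative (\<lambda>r. r *\<^sub>R v)) (at t)"
      by (auto intro!: derivative_eq_intros)
    from has_derivative_compose[OF this f'[OF y]] show ?thesis
      unfolding has_field_derivative_def by (rule has_derivative_eq_rhs) (auto simp: scaleR)
  qed
  let ?g = "\<lambda>s. f (x + s *\<^sub>R u + h *\<^sub>R v) - f (x + s *\<^sub>R u + 0 *\<^sub>R v)"
  have "\<exists>z. 0 < z \<and> z < h \<and> ?g h - ?g 0 = (h - 0) *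
      (f' (x + z *\<^sub>R u + h *\<^sub>R v) u - f' (x + z *\<^sub>R u + 0 *\<^sub>R v) u)"
    using h by (intro MVT2 DERIV_diff d1) auto
  then obtain s where s: "0 < s" "s < h"
    "?g h - ?g 0 = h * (f' (x + s *\<^sub>R u + h *\<^sub>R v) u - f' (x + s *\<^sub>R u + 0 *\<^sub>R v) u)"
    by auto
  have "\<exists>z. 0 < z \<and> z < h \<and> f' (x + s *\<^sub>R u + h *\<^sub>R v) u - f' (x + s *\<^sub>R u + 0 *\<^sub>R v) u =
      (h - 0) * f'' (x + s *\<^sub>R u + z *\<^sub>R v) v"
    using h s(1,2) by (intro MVT2 d2) auto
  then obtain t where t: "0 < t" "t < h"
    "f' (x + s *\<^sub>R u + h *\<^sub>R v) u - f' (x + s *\<^sub>R u + 0 *\<^sub>R v) u = h * f'' (x + s *\<^sub>R u + t *\<^sub>R v) v"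
    by auto
  show thesis
    using s(3) unfolding t(3) by (intro that[OF s(1,2) t(1,2)]) (simp add: algebra_simps)
qed

text \<open>The same second difference is expressed by both mixed derivatives at nearby points;
  continuity of these derivatives at \<open>x\<close> brings the two values together.\<close>

lemma second_derivative_symmetric_real:
  fixes f :: "'a::real_normed_vector \<Rightarrow> real"
  assumes f: "smooth_on f S" and S: "open S" "x \<in> S"
  shows "frechet_derivative (\<lambda>y. frechet_derivative f (at y) u) (at x) v
    = frechet_derivative (\<lambda>y. frechet_derivative f (at y) v) (at x) u"
proof -
  define D where "D = (\<lambda>u v y. frechet_derivative (\<lambda>y. frechet_derivative f (at y) u) (at y) v)"
  have cont: "isCont (D u v) x" for u v
    using smooth_on_imp_continuous_on[OF smooth_on_frechet_derivative[OF smooth_on_frechet_derivative[OF f]]] S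
    by (auto simp: D_def continuous_on_eq_continuous_at)
  have f1: "(f has_derivative frechet_derivative f (at y)) (at y)" if "y \<in> S" for y
    using smooth_on_has_derivative[OF f S(1) that] .
  have f2: "((\<lambda>y. frechet_derivative f (at y) u) has_derivative (\<lambda>v. D u v y)) (at y)" if "y \<in> S" for y u
    unfolding D_def using smooth_on_has_derivative[OF smooth_on_frechet_derivative[OF f] S(1) that] .
  have "\<bar>D u v x - D v u x\<bar> \<le> e" if "e > 0" for e
  proof -
    obtain d1 where d1: "d1 > 0" "\<And>y. dist y x < d1 \<Longrightarrow> dist (D u v y) (D u v x) < e / 2"
      using cont[of u v] half_gt_zero[OF \<open>e > 0\<close>] unfolding continuous_at_eps_delta by blast
    obtain d2 where d2: "d2 > 0" "\<And>y. dist y x < d2 \<Longrightarrow> dist (D v u y) (D v u x) < e / 2"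
      using cont[of v u] half_gt_zero[OF \<open>e > 0\<close>] unfolding continuous_at_eps_delta by blast
    obtain d3 where d3: "d3 > 0" "\<And>y. dist y x < d3 \<Longrightarrow> y \<in> S"
      using S unfolding open_dist by blast
    define d where "d = min d1 (min d2 d3)"
    have "d > 0" using d1 d2 d3 by (simp add: d_def)
    \<comment> \<open>This keeps the whole parallelogram with sides \<open>h u\<close> and
      \<open>h v\<close> within \<open>d / 2\<close> of \<open>x\<close>; the summand 1 covers the
      case \<open>u = v = 0\<close>.\<close>
    define h where "h = d / (2 * (norm u + norm v + 1))"
    have pos: "norm u + norm v + 1 > 0" by (smt (verit) norm_ge_zero)
    have h: "h > 0" using pos \<open>d > 0\<close> by (simp add: h_def)
    have near: "dist (x + s *\<^sub>R u + t *\<^sub>R v) x < d"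
      if "0 \<le> s" "s \<le> h" "0 \<le> t" "t \<le> h" for s t
    proof -
      have "norm (s *\<^sub>R u + t *\<^sub>R v) \<le> s * norm u + t * norm v"
        using norm_triangle_ineq[of "s *\<^sub>R u" "t *\<^sub>R v"] that by simp
      also have "\<dots> \<le> h * norm u + h * norm v"
        using that by (intro add_mono mult_right_mono) auto
      also have "\<dots> \<le> h * (norm u + norm v + 1)" using h by (simp add: algebra_simps)
      also have "\<dots> = d / 2" using pos by (simp add: h_def field_simps)
      finally show ?thesis using \<open>d > 0\<close> by (simp add: dist_norm add.assoc)
    qed
    have swap: "x + s *\<^sub>R v + t *\<^sub>R u = x + t *\<^sub>R u + s *\<^sub>R v" for s t by simp
    have in1: "x + s *\<^sub>R u + t *\<^sub>R v \<in> S" if "0 \<le> s" "s \<le> h" "0 \<le> t" "t \<le> h" for s t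
      using near[OF that] d3 by (simp add: d_def)
    have in2: "x + s *\<^sub>R v + t *\<^sub>R u \<in> S" if "0 \<le> s" "s \<le> h" "0 \<le> t" "t \<le> h" for s t
      unfolding swap using in1 that by blast
    obtain s t where st: "0 < s" "s < h" "0 < t" "t < h"
      "f (x + h *\<^sub>R u + h *\<^sub>R v) - f (x + h *\<^sub>R u) - f (x + h *\<^sub>R v) + f x
        = h * h * D u v (x + s *\<^sub>R u + t *\<^sub>R v)"
      by (rule second_difference_mean_value[of S f, OF f1 f2[of _ u] h in1])
    obtain s' t' where st': "0 < s'" "s' < h" "0 < t'" "t' < h"
      "f (x + h *\<^sub>R v + h *\<^sub>R u) - f (x + h *\<^sub>R v) - f (x + h *\<^sub>R u) + f x
        = h * h * D v u (x + s' *\<^sub>R v + t' *\<^sub>R u)"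
      by (rule second_difference_mean_value[of S f, OF f1 f2[of _ v] h in2])
    have "h * h * D u v (x + s *\<^sub>R u + t *\<^sub>R v) = h * h * D v u (x + s' *\<^sub>R v + t' *\<^sub>R u)"
      using st(5) st'(5) unfolding swap by linarith
    then have eq: "D u v (x + s *\<^sub>R u + t *\<^sub>R v) = D v u (x + s' *\<^sub>R v + t' *\<^sub>R u)"
      using h by simp
    have "dist (D u v (x + s *\<^sub>R u + t *\<^sub>R v)) (D u v x) < e / 2"
      using near[of s t] st d1 by (simp add: d_def)
    moreover have "dist (D v u (x + s' *\<^sub>R v + t' *\<^sub>R u)) (D v u x) < e / 2"
      unfolding swap using near[of t' s'] st' d2 by (simp add: d_def)
    ultimately show ?thesis unfolding eq dist_real_def by linarith
  qed
  then have "\<bar>D u v x - D v u x\<bar> \<le> 0" by (rule field_le_epsilon) simp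
  then show ?thesis by (simp add: D_def)
qed

lemma second_derivative_symmetric:
  fixes f :: "'a::real_normed_vector \<Rightarrow> 'b::euclidean_space"
  assumes f: "smooth_on f S" and S: "open S" "x \<in> S"
  shows "frechet_derivative (\<lambda>y. frechet_derivative f (at y) u) (at x) v
    = frechet_derivative (\<lambda>y. frechet_derivative f (at y) v) (at x) u"
proof (rule euclidean_eqI)
  fix b :: 'b assume "b \<in> Basis"
  define fb where "fb = (\<lambda>y. f y \<bullet> b)"
  have fb: "smooth_on fb S"
    unfolding fb_def by (rule smooth_on_linear_compose[OF bounded_linear_inner_left S(1) f])
  have inner: "frechet_derivative (\<lambda>y. g y \<bullet> b) (at y) = (\<lambda>w. frechet_derivative g (at y) w \<bullet> b)"
    if "smooth_on g S" "y \<in> S" for g y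
    using frechet_derivative_at[OF has_derivative_inner_left[OF smooth_on_has_derivative[OF that(1) S(1) that(2)]]]
    by metis
  have D2: "frechet_derivative (\<lambda>y. frechet_derivative fb (at y) u) (at x) =
      (\<lambda>v. frechet_derivative (\<lambda>y. frechet_derivative f (at y) u) (at x) v \<bullet> b)" for u
  proof -
    have "frechet_derivative (\<lambda>y. frechet_derivative fb (at y) u) (at x) =
        frechet_derivative (\<lambda>y. frechet_derivative f (at y) u \<bullet> b) (at x)"
    proof (rule frechet_derivative_transform_within_open[OF _ S])
      show "(\<lambda>y. frechet_derivative fb (at y) u) differentiable at x"
        by (rule smooth_on_differentiable_at[OF smooth_on_frechet_derivative[OF fb] S])
      show "frechet_derivative fb (at y) u = frechet_derivative f (at y) u \<bullet> b" if "y \<in> S" for y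
        using inner[OF f that] by (simp add: fb_def)
    qed
    then show ?thesis using inner[OF smooth_on_frechet_derivative[OF f] S(2)] by simp
  qed
  show "frechet_derivative (\<lambda>y. frechet_derivative f (at y) u) (at x) v \<bullet> b =
      frechet_derivative (\<lambda>y. frechet_derivative f (at y) v) (at x) u \<bullet> b"
    using second_derivative_symmetric_real[OF fb S, of u v] unfolding D2 .
qed

text \<open>The pullback metric is flat: its Christoffel map is the second derivative of \<open>L\<close>
  read in the frame \<open>dL\<close>.\<close>

lemma levi_civita_pullback:
  fixes L :: "'e::euclidean_space \<Rightarrow> 'f::euclidean_space"
  assumes L: "smooth_on L S" and S: "open S" "x \<in> S"
    and bij: "bij (frechet_derivative L (at x))"
    and g: "\<And>y v w. y \<in> S \<Longrightarrow> g c y v w = frechet_derivative L (at y) v \<bullet> frechet_derivative L (at y) w"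
  shows "frechet_derivative L (at x) (levi_civita g c x u v)
    = frechet_derivative (\<lambda>y. frechet_derivative L (at y) v) (at x) u"
proof -
  let ?D = "frechet_derivative L (at x)"
  define D2 where "D2 u v = frechet_derivative (\<lambda>y. frechet_derivative L (at y) v) (at x) u" for u v
  define B where "B u v = inv_into UNIV ?D (D2 u v)" for u v
  have D: "?D (B u v) = D2 u v" for u v
    unfolding B_def using bij by (simp add: bij_is_surj surj_f_inv_f)
  have dD: "((\<lambda>y. frechet_derivative L (at y) v) has_derivative (\<lambda>u. D2 u v)) (at x)" for v
    unfolding D2_def by (rule smooth_on_has_derivative[OF smooth_on_frechet_derivative[OF L] S])
  have linD: "linear ?D"
    using smooth_on_has_derivative[OF L S] has_derivative_linear by metis
  then interpret D: linear ?D .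
  have sym: "D2 u v = D2 v u" for u v
    unfolding D2_def by (rule second_derivative_symmetric[OF L S])
  have lin1: "linear (\<lambda>u. D2 u v)" for v using has_derivative_linear[OF dD] .
  have lin2: "linear (\<lambda>v. D2 u v)" for u using lin1[of u] by (simp add: sym)
  have injD: "v = w" if "?D v = ?D w" for v w using bij that by (meson bij_is_inj injD)
  have surj: "?D (inv_into UNIV ?D y) = y" for y using bij by (simp add: bij_is_surj surj_f_inv_f)
  have "linear (inv_into UNIV ?D)"
    by (rule linearI; rule injD) (simp_all add: D.add D.scale surj)
  then have bil: "bilinear B"
    unfolding bilinear_def B_def
    using linear_compose[OF lin1, unfolded o_def] linear_compose[OF lin2, unfolded o_def] by blast
  have dg: "frechet_derivative (\<lambda>y. g c y v w) (at x) u = D2 u v \<bullet> ?D w + ?D v \<bullet> D2 u w" for u v w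
  proof -
    have "((\<lambda>y. frechet_derivative L (at y) v \<bullet> frechet_derivative L (at y) w) has_derivative
        (\<lambda>u. ?D v \<bullet> D2 u w + D2 u v \<bullet> ?D w)) (at x)"
      by (rule has_derivative_inner[OF dD dD])
    then have "((\<lambda>y. g c y v w) has_derivative (\<lambda>u. ?D v \<bullet> D2 u w + D2 u v \<bullet> ?D w)) (at x)"
      by (rule has_derivative_transform_within_open[OF _ S]) (simp add: g)
    from frechet_derivative_at[OF this, symmetric] show ?thesis by simp
  qed
  have gx: "g c x v w = ?D v \<bullet> ?D w" for v w using g S(2) by blast
  have "levi_civita g c x = B"
    unfolding levi_civita_def
  proof (rule the_equality, intro conjI allI)
    show "bilinear B" by (fact bil)
    show "B u v = B v u" for u v by (simp add: B_def sym)
    show "frechet_derivative (\<lambda>y. g c y v w) (at x) u = g c x (B u v) w + g c x v (B u w)" for u v w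
      by (simp add: dg gx D)
  next
    fix C assume C: "bilinear C \<and> (\<forall>u v. C u v = C v u) \<and>
      (\<forall>u v w. frechet_derivative (\<lambda>y. g c y v w) (at x) u = g c x (C u v) w + g c x v (C u w))"
    \<comment> \<open>Uniqueness as in the Koszul formula: \<open>T\<close> is symmetric in its
      first two arguments, since both maps are torsion-free, and skew in the last two, since both
      are metric. Such a trilinear expression vanishes.\<close>
    define T where "T u v w = (D2 u v - ?D (C u v)) \<bullet> ?D w" for u v w
    have T1: "T u v w = T v u w" for u v w using C sym by (simp add: T_def)
    have T2: "T u v w = - T u w v" for u v w
    proof -
      have "D2 u v \<bullet> ?D w + ?D v \<bullet> D2 u w = ?D (C u v) \<bullet> ?D w + ?D v \<bullet> ?D (C u w)"
        using C dg[of v w u] by (simp add: gx)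
      then show ?thesis by (simp add: T_def inner_diff_left inner_diff_right inner_commute algebra_simps)
    qed
    have T0: "T u v w = 0" for u v w
      using T1[of u v w] T1[of u w v] T1[of w v u] T2[of u v w] T2[of w u v] T2[of v w u] by linarith
    have "B u v = C u v" for u v
    proof -
      have "?D (B u v - C u v) \<bullet> ?D (B u v - C u v) = T u v (B u v - C u v)"
        by (simp add: T_def D.diff D)
      then have "?D (B u v) = ?D (C u v)" by (simp add: T0 D.diff)
      then show ?thesis by (rule injD)
    qed
    then show "C = B" by (intro ext) simp
  qed
  then show ?thesis by (simp add: D D2_def)
qed

section \<open>Holonomy of flat atlases\<close>

lemma adjacent_cover:
  assumes "finite S" "{0, 1} \<subseteq> S" "S \<subseteq> {0..1}" "x \<in> {0..1::real}"
  shows "\<exists>a b. adjacent S a b \<and> x \<in> {a..b}"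
\<comment> \<open>No point of \<open>S\<close> lies to the right of 1, so this endpoint belongs to
  the last piece; every other \<open>x\<close> lies in the piece that starts at or before
  it.\<close>
proof (cases "x = 1")
  case True
  define a where "a = Max {s \<in> S. s < 1}"
  have ne: "finite {s \<in> S. s < 1}" "{s \<in> S. s < 1} \<noteq> {}" using assms by force+
  have a: "a \<in> S" "a < 1" using Max_in[OF ne] by (auto simp: a_def)
  have "s \<le> a" if "s \<in> S" "s < 1" for s using Max_ge[OF ne(1)] that by (auto simp: a_def)
  then have "adjacent S a 1" using a assms by (force simp: adjacent_def)
  then show ?thesis using True a by force
next
  case False
  define a where "a = Max {s \<in> S. s \<le> x}"
  define b where "b = Min {s \<in> S. x < s}"
  have ne: "finite {s \<in> S. s \<le> x}" "{s \<in> S. s \<le> x} \<noteq> {}" using assms by force+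
  have ne': "finite {s \<in> S. x < s}" "{s \<in> S. x < s} \<noteq> {}" using assms False by force+
  have a: "a \<in> S" "a \<le> x" using Max_in[OF ne] by (auto simp: a_def)
  have b: "b \<in> S" "x < b" using Min_in[OF ne'] by (auto simp: b_def)
  have "s \<le> a" if "s \<in> S" "s \<le> x" for s using Max_ge[OF ne(1)] that by (auto simp: a_def)
  moreover have "b \<le> s" if "s \<in> S" "x < s" for s using Min_le[OF ne'(1)] that by (auto simp: b_def)
  ultimately have "S \<inter> {a<..<b} = {}" by force
  then have "adjacent S a b" using a b by (auto simp: adjacent_def)
  then show ?thesis using a b by force
qed

lemma linear_Basis_expansion:
  fixes f :: "'e::euclidean_space \<Rightarrow> 'b::real_vector"
  assumes "linear f"
  shows "(\<Sum>b\<in>Basis. (w \<bullet> b) *\<^sub>R f b) = f w"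
proof -
  interpret linear f by fact
  from arg_cong[OF euclidean_representation[of w], of f] show ?thesis unfolding sum scale .
qed

text \<open>A flat affine structure in developing coordinates: \<open>L c\<close> flattens the chart
  \<open>c\<close>, and \<open>H\<close> collects the linear parts of the changes.
  \<open>L_change\<close> is local in \<open>y\<close> because an overlap of charts may be
  disconnected, with different group elements on different components.\<close>

locale flat_atlas =
  fixes X :: "'a topology" and \<A> :: "('a, 'e::euclidean_space) chart set"
    and L :: "('a, 'e) chart \<Rightarrow> 'e \<Rightarrow> 'f::euclidean_space" and H :: "('f \<Rightarrow> 'f) set"
  assumes cover: "\<And>x. x \<in> topspace X \<Longrightarrow> \<exists>c\<in>\<A>. x \<in> fst c"
    and openin_chart: "\<And>c. c \<in> \<A> \<Longrightarrow> openin X (fst c)"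
    and inj_chart: "\<And>c. c \<in> \<A> \<Longrightarrow> inj_on (snd c) (fst c)"
    and open_chart: "\<And>c. c \<in> \<A> \<Longrightarrow> open (snd c ` fst c)"
    and transition_differentiable: "\<And>c d y. c \<in> \<A> \<Longrightarrow> d \<in> \<A> \<Longrightarrow> y \<in> snd c ` (fst c \<inter> fst d) \<Longrightarrow>
      transition c d differentiable at y"
    and L_smooth: "\<And>c. c \<in> \<A> \<Longrightarrow> smooth_on (L c) (snd c ` fst c)"
    and L_bij: "\<And>c y. c \<in> \<A> \<Longrightarrow> y \<in> snd c ` fst c \<Longrightarrow> bij (frechet_derivative (L c) (at y))"
    and L_change: "\<And>c d y. c \<in> \<A> \<Longrightarrow> d \<in> \<A> \<Longrightarrow> y \<in> snd c ` (fst c \<inter> fst d) \<Longrightarrow>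
      \<exists>\<rho>\<in>H. \<exists>r N. open N \<and> y \<in> N \<and> (\<forall>z\<in>N. L d (transition c d z) = \<rho> (L c z) + r)"
    and H_linear: "\<And>\<rho>. \<rho> \<in> H \<Longrightarrow> linear \<rho>"
    and H_inner: "\<And>\<rho> v w. \<rho> \<in> H \<Longrightarrow> \<rho> v \<bullet> \<rho> w = v \<bullet> w"
    and H_id: "id \<in> H"
    and H_comp: "\<And>\<rho> \<sigma>. \<rho> \<in> H \<Longrightarrow> \<sigma> \<in> H \<Longrightarrow> \<rho> \<circ> \<sigma> \<in> H"
begin

abbreviation DL :: "('a, 'e) chart \<Rightarrow> 'e \<Rightarrow> 'e \<Rightarrow> 'f" where
  "DL c y \<equiv> frechet_derivative (L c) (at y)"

definition metric :: "('a, 'e) chart \<Rightarrow> 'e \<Rightarrow> 'e \<Rightarrow> 'e \<Rightarrow> real" where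
  "metric c y v w = DL c y v \<bullet> DL c y w"

lemma linear_DL:
  assumes "c \<in> \<A>" "y \<in> snd c ` fst c"
  shows "linear (DL c y)"
  using smooth_on_has_derivative[OF L_smooth[OF assms(1)] open_chart[OF assms(1)] assms(2)]
  by (rule has_derivative_linear)

lemma transition_apply: "c \<in> \<A> \<Longrightarrow> x \<in> fst c \<Longrightarrow> transition c d (snd c x) = snd d x"
  by (simp add: transition_def inv_into_f_f[OF inj_chart])

lemma DL_transition:
  assumes c: "c \<in> \<A>" and d: "d \<in> \<A>" and x: "x \<in> fst c \<inter> fst d"
  shows "\<exists>\<rho>\<in>H. \<forall>v. DL d (snd d x) (frechet_derivative (transition c d) (at (snd c x)) v)
    = \<rho> (DL c (snd c x) v)"
proof -
  let ?y = "snd c x"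
  have y: "?y \<in> snd c ` (fst c \<inter> fst d)" using x by auto
  obtain \<rho> r N where \<rho>: "\<rho> \<in> H" and N: "open N" "?y \<in> N" "\<And>z. z \<in> N \<Longrightarrow> L d (transition c d z) = \<rho> (L c z) + r"
    using L_change[OF c d y] by blast
  have \<tau>: "(transition c d has_derivative frechet_derivative (transition c d) (at ?y)) (at ?y)"
    using transition_differentiable[OF c d y] frechet_derivative_works by blast
  have "snd d x \<in> snd d ` fst d" using x by auto
  then have "(L d has_derivative DL d (snd d x)) (at (transition c d ?y))"
    using smooth_on_has_derivative[OF L_smooth[OF d] open_chart[OF d]] x transition_apply[OF c] by simp
  from has_derivative_compose[OF \<tau> this]
  have 1: "((\<lambda>z. L d (transition c d z)) has_derivative
      (\<lambda>v. DL d (snd d x) (frechet_derivative (transition c d) (at ?y) v))) (at ?y)" .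
  have \<rho>': "bounded_linear \<rho>" using H_linear[OF \<rho>] by (simp add: linear_conv_bounded_linear)
  have "(L c has_derivative DL c ?y) (at ?y)"
    by (rule smooth_on_has_derivative[OF L_smooth[OF c] open_chart[OF c]]) (use x in auto)
  from has_derivative_add_const[OF bounded_linear.has_derivative[OF \<rho>' this], of r]
  have "((\<lambda>z. \<rho> (L c z) + r) has_derivative (\<lambda>v. \<rho> (DL c ?y v))) (at ?y)" .
  then have "((\<lambda>z. L d (transition c d z)) has_derivative (\<lambda>v. \<rho> (DL c ?y v))) (at ?y)"
    by (rule has_derivative_transform_within_open[OF _ N(1,2)]) (simp add: N(3))
  from has_derivative_unique[OF 1 this] show ?thesis using \<rho> by metis
qed

lemma riemannian_metric: "riemannian_metric \<A> metric"
  unfolding riemannian_metric_def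
proof (intro conjI ballI allI impI)
  fix c y v w assume c: "c \<in> \<A>" and y: "y \<in> snd c ` fst c"
  interpret linear "DL c y" by (rule linear_DL[OF c y])
  show "bilinear (metric c y)"
    unfolding bilinear_def metric_def
    by (auto intro!: linearI simp: add scale inner_add_left inner_add_right)
  show "metric c y v w = metric c y w v" by (simp add: metric_def inner_commute)
  show "metric c y v v > 0" if "v \<noteq> 0"
    using L_bij[OF c y] that zero unfolding metric_def by (metis bij_is_inj inj_eq inner_gt_zero_iff)
next
  fix c v w assume c: "c \<in> \<A>"
  show "smooth_on (\<lambda>x. metric c x v w) (snd c ` fst c)"
    unfolding metric_def
    by (intro smooth_on_bilinear[OF bounded_bilinear_inner] smooth_on_frechet_derivative L_smooth open_chart c)
next
  fix c d y v w assume c: "c \<in> \<A>" and d: "d \<in> \<A>" and "y \<in> snd c ` (fst c \<inter> fst d)"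
  then obtain x where x: "x \<in> fst c \<inter> fst d" "y = snd c x" by auto
  obtain \<rho> where \<rho>: "\<rho> \<in> H"
    "\<And>v. DL d (snd d x) (frechet_derivative (transition c d) (at (snd c x)) v) = \<rho> (DL c (snd c x) v)"
    using DL_transition[OF c d x(1)] by blast
  show "metric c y v w = metric d (transition c d y)
      (frechet_derivative (transition c d) (at y) v) (frechet_derivative (transition c d) (at y) w)"
    using x transition_apply[OF c, of x d] by (simp add: metric_def \<rho> H_inner)
qed

section \<open>Parallel fields in the developing map\<close>

text \<open>The field pushed forward by \<open>DL\<close>. The coordinate expansion leaves only
  derivatives in fixed directions, so the product rule applies along the curve.\<close>

definition frame :: "(real \<Rightarrow> 'a) \<Rightarrow> (real \<Rightarrow> ('a, 'e) chart \<Rightarrow> 'e) \<Rightarrow> ('a, 'e) chart \<Rightarrow> real \<Rightarrow> 'f" where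
  "frame \<gamma> Y c t = (\<Sum>b\<in>Basis. (Y t c \<bullet> b) *\<^sub>R DL c (snd c (\<gamma> t)) b)"

lemma frame_eq: "c \<in> \<A> \<Longrightarrow> \<gamma> t \<in> fst c \<Longrightarrow> frame \<gamma> Y c t = DL c (snd c (\<gamma> t)) (Y t c)"
  unfolding frame_def by (intro linear_Basis_expansion linear_DL) auto

text \<open>Differentiating \<open>DL Y\<close> gives \<open>D2 w Y + DL Y'\<close> with
  \<open>w\<close> the velocity. By \<open>levi_civita_pullback\<close> the transport equation says
  that \<open>DL Y' = - D2 w Y\<close>.\<close>

lemma frame_derivative:
  assumes \<gamma>: "piecewise_C1_curve X \<A> S \<gamma>" and Y: "parallel_along \<A> metric S \<gamma> Y"
    and ab: "adjacent S a b" and c: "c \<in> \<A>" and t: "t \<in> {a..b}" "\<gamma> t \<in> fst c"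
  shows "(frame \<gamma> Y c has_derivative (\<lambda>_. 0)) (at t within {a..b})"
proof -
  let ?x = "snd c (\<gamma> t)"
  have x: "?x \<in> snd c ` fst c" using t by auto
  define D2 where "D2 u v = frechet_derivative (\<lambda>y. DL c y v) (at ?x) u" for u v
  have dD: "((\<lambda>y. DL c y v) has_derivative (\<lambda>u. D2 u v)) (at ?x)" for v
    unfolding D2_def
    by (rule smooth_on_has_derivative[OF smooth_on_frechet_derivative[OF L_smooth[OF c]] open_chart[OF c] x])
  have "a < b" using ab by (simp add: adjacent_def)
  have "\<exists>D. \<forall>t\<in>{t \<in> {a..b}. \<gamma> t \<in> fst c}.
      ((snd c \<circ> \<gamma>) has_vector_derivative D t) (at t within {a..b})"
    using \<gamma> ab c unfolding piecewise_C1_curve_def case_prod_unfold by blast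
  then obtain w where w: "((snd c \<circ> \<gamma>) has_vector_derivative w) (at t within {a..b})"
    using t by blast
  have "vector_derivative (snd c \<circ> \<gamma>) (at t within {a..b}) = w"
    by (rule vector_derivative_within_closed_interval[OF \<open>a < b\<close> t(1) w])
  then have Y': "((\<lambda>s. Y s c) has_vector_derivative - levi_civita metric c ?x w (Y t c)) (at t within {a..b})"
    using Y ab c t unfolding parallel_along_def by metis
  define Y' where "Y' = - levi_civita metric c ?x w (Y t c)"
  \<comment> \<open>Linearity of \<open>D2\<close> in its first argument is that of a derivative;
    symmetry transfers it to the second, where the field \<open>Y\<close> is inserted.\<close>
  have "D2 u v = D2 v u" for u v
    unfolding D2_def by (rule second_derivative_symmetric[OF L_smooth[OF c] open_chart[OF c] x])
  then have "D2 w = (\<lambda>u. D2 u w)" by (rule ext)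
  then have lin: "linear (D2 w)" using has_derivative_linear[OF dD, of w] by simp
  have *: "((\<lambda>s. DL c ((snd c \<circ> \<gamma>) s) e) has_derivative (\<lambda>r. D2 (r *\<^sub>R w) e)) (at t within {a..b})" for e
    by (rule has_derivative_compose[OF w[unfolded has_vector_derivative_def], of "\<lambda>y. DL c y e"])
      (simp add: dD)
  have D2r: "D2 (r *\<^sub>R w) e = r *\<^sub>R D2 w e" for r e
    using linear_scale[OF has_derivative_linear[OF dD[of e]], of r w] .
  have "((\<lambda>s. \<Sum>e\<in>Basis. (Y s c \<bullet> e) *\<^sub>R DL c ((snd c \<circ> \<gamma>) s) e) has_derivative
      (\<lambda>r. \<Sum>e\<in>Basis. (Y t c \<bullet> e) *\<^sub>R D2 (r *\<^sub>R w) e + ((r *\<^sub>R Y') \<bullet> e) *\<^sub>R DL c ((snd c \<circ> \<gamma>) t) e)) (at t within {a..b})"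
    using Y' unfolding Y'_def[symmetric] has_vector_derivative_def
    by (intro has_derivative_sum has_derivative_scaleR has_derivative_inner_left *)
  moreover have "(\<Sum>e\<in>Basis. (Y t c \<bullet> e) *\<^sub>R D2 (r *\<^sub>R w) e + ((r *\<^sub>R Y') \<bullet> e) *\<^sub>R DL c ((snd c \<circ> \<gamma>) t) e) = 0" for r
  proof -
    interpret DL: linear "DL c ?x" by (rule linear_DL[OF c x])
    have "(\<Sum>e\<in>Basis. (Y t c \<bullet> e) *\<^sub>R D2 (r *\<^sub>R w) e + ((r *\<^sub>R Y') \<bullet> e) *\<^sub>R DL c ((snd c \<circ> \<gamma>) t) e) =
        r *\<^sub>R (\<Sum>e\<in>Basis. (Y t c \<bullet> e) *\<^sub>R D2 w e) + (\<Sum>e\<in>Basis. ((r *\<^sub>R Y') \<bullet> e) *\<^sub>R DL c ?x e)"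
      by (simp add: D2r sum.distrib scaleR_sum_right mult.commute)
    also have "\<dots> = r *\<^sub>R D2 w (Y t c) + DL c ?x (r *\<^sub>R Y')"
      by (simp only: linear_Basis_expansion[OF lin] linear_Basis_expansion[OF DL.linear_axioms])
    also have "DL c ?x (r *\<^sub>R Y') = - r *\<^sub>R DL c ?x (levi_civita metric c ?x w (Y t c))"
      by (simp add: Y'_def DL.scale DL.neg)
    also have "DL c ?x (levi_civita metric c ?x w (Y t c)) = D2 w (Y t c)"
      unfolding D2_def
      by (rule levi_civita_pullback[OF L_smooth[OF c] open_chart[OF c] x L_bij[OF c x]])
        (simp add: metric_def)
    finally show ?thesis by simp
  qed
  ultimately show ?thesis unfolding frame_def[abs_def] by simp
qed

text \<open>The derivative vanishes within each piece of the subdivision, and continuity carries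
  constancy across the finitely many break points. The neighbourhood is chosen before
  \<open>Y\<close>: it serves all parallel fields at once.\<close>

lemma frame_locally_constant:
  assumes \<gamma>: "piecewise_C1_curve X \<A> S \<gamma>" and c: "c \<in> \<A>" and t: "t \<in> {0..1}" "\<gamma> t \<in> fst c"
  shows "\<exists>T. openin (top_of_set {0..1}) T \<and> t \<in> T \<and>
    (\<forall>s\<in>T. \<gamma> s \<in> fst c \<and> (\<forall>Y. parallel_along \<A> metric S \<gamma> Y \<longrightarrow> frame \<gamma> Y c s = frame \<gamma> Y c t))"
proof -
  have cont: "continuous_map (top_of_set {0..1}) X \<gamma>"
    and S: "finite S" "{0, 1} \<subseteq> S" "S \<subseteq> {0..1}"
    using \<gamma> by (auto simp: piecewise_C1_curve_def)
  have "openin (top_of_set {0..1}) {s \<in> {0..1}. \<gamma> s \<in> fst c}"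
    using openin_continuous_map_preimage[OF cont openin_chart[OF c]] by simp
  then obtain e where e: "e > 0" "cball t e \<inter> {0..1} \<subseteq> {s \<in> {0..1}. \<gamma> s \<in> fst c}"
    using t unfolding openin_contains_cball by blast
  \<comment> \<open>Closed, so that continuity can be glued from the closed pieces of the
    subdivision; the neighbourhood finally returned is the open ball of the same radius.\<close>
  define T' where "T' = cball t e \<inter> {0..1}"
  have T': "s \<in> {0..1}" "\<gamma> s \<in> fst c" if "s \<in> T'" for s using that e(2) by (auto simp: T'_def)
  have "convex T'" unfolding T'_def by (intro convex_Int convex_cball convex_real_interval)
  have const: "frame \<gamma> Y c s = frame \<gamma> Y c t"
    if Y: "parallel_along \<A> metric S \<gamma> Y" and s: "s \<in> T'" for Y s
  proof (rule has_derivative_zero_unique_strong_convex[OF \<open>convex T'\<close> S(1) _ _ refl _ s])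
    define J where "J = {(a, b). adjacent S a b}"
    have "finite J"
      by (rule finite_subset[of _ "S \<times> S"]) (auto simp: J_def adjacent_def S)
    have "T' = (\<Union>p\<in>J. {fst p..snd p} \<inter> T')"
      using adjacent_cover[OF S] T'(1) by (fastforce simp: J_def)
    moreover have "continuous_on (\<Union>p\<in>J. {fst p..snd p} \<inter> T') (frame \<gamma> Y c)"
    proof (rule continuous_on_closed_Union[OF \<open>finite J\<close>])
      fix p assume p: "p \<in> J"
      show "closed ({fst p..snd p} \<inter> T')" unfolding T'_def by (intro closed_Int) auto
      show "continuous_on ({fst p..snd p} \<inter> T') (frame \<gamma> Y c)"
        unfolding continuous_on_eq_continuous_within
      proof
        fix s assume s: "s \<in> {fst p..snd p} \<inter> T'"
        have "(frame \<gamma> Y c has_derivative (\<lambda>_. 0)) (at s within {fst p..snd p})"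
          using s p T' by (intro frame_derivative[OF \<gamma> Y _ c]) (auto simp: J_def)
        then have "continuous (at s within {fst p..snd p}) (frame \<gamma> Y c)"
          by (rule has_derivative_continuous)
        then show "continuous (at s within {fst p..snd p} \<inter> T') (frame \<gamma> Y c)"
          by (rule continuous_within_subset) auto
      qed
    qed
    ultimately show "continuous_on T' (frame \<gamma> Y c)" by simp
    show "t \<in> T'" using t e(1) by (simp add: T'_def)
    fix x assume x: "x \<in> T' - S"
    obtain a b where ab: "adjacent S a b" "x \<in> {a..b}" using adjacent_cover[OF S] T' x by blast
    have "a < x" "x < b" using ab x by (auto simp: adjacent_def less_le)
    then have "(frame \<gamma> Y c has_derivative (\<lambda>_. 0)) (at x)"
      using frame_derivative[OF \<gamma> Y ab(1) c ab(2)] T'(2)[of x] x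
      by (simp only: at_within_Icc_at[OF \<open>a < x\<close> \<open>x < b\<close>] Diff_iff)
    then show "(frame \<gamma> Y c has_derivative (\<lambda>_. 0)) (at x within T')"
      by (rule has_derivative_at_withinI)
  qed
  show ?thesis
  proof (intro exI[of _ "ball t e \<inter> {0..1}"] conjI ballI allI impI)
    show "openin (top_of_set {0..1}) (ball t e \<inter> {0..1})"
      by (metis inf_commute open_ball openin_open_Int)
    show "t \<in> ball t e \<inter> {0..1}" using t e by simp
    fix s assume "s \<in> ball t e \<inter> {0..1}"
    then have s: "s \<in> T'" by (auto simp: T'_def)
    then show "\<gamma> s \<in> fst c" by (rule T')
    show "frame \<gamma> Y c s = frame \<gamma> Y c t" if "parallel_along \<A> metric S \<gamma> Y" for Y
      using const[OF that s] .
  qed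
qed

lemma frame_transition:
  assumes c: "c \<in> \<A>" and d: "d \<in> \<A>" and t: "t \<in> {0..1}" "\<gamma> t \<in> fst c \<inter> fst d"
  shows "\<exists>\<rho>\<in>H. \<forall>Y. parallel_along \<A> metric S \<gamma> Y \<longrightarrow> frame \<gamma> Y d t = \<rho> (frame \<gamma> Y c t)"
proof -
  obtain \<rho> where \<rho>: "\<rho> \<in> H" "\<And>v. DL d (snd d (\<gamma> t))
      (frechet_derivative (transition c d) (at (snd c (\<gamma> t))) v) = \<rho> (DL c (snd c (\<gamma> t)) v)"
    using DL_transition[OF c d t(2)] by blast
  have "frame \<gamma> Y d t = \<rho> (frame \<gamma> Y c t)" if "parallel_along \<A> metric S \<gamma> Y" for Y
  proof -
    have "Y t d = frechet_derivative (transition c d) (at (snd c (\<gamma> t))) (Y t c)"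
      using that c d t unfolding parallel_along_def by blast
    then show ?thesis using frame_eq[OF c] frame_eq[OF d] t(2) \<rho>(2) by simp
  qed
  then show ?thesis using \<rho>(1) by blast
qed

text \<open>Connectedness of \<open>{0..1}\<close> propagates, along the loop, the relation to the
  initial frame: within one chart the frame is constant, and each change of chart composes
  \<open>\<rho>\<close> with an element of \<open>H\<close>.\<close>

lemma holonomy_in_H:
  assumes c: "c \<in> \<A>" and p: "p \<in> fst c" and h: "h \<in> holonomy_group X \<A> metric c p"
  shows "\<exists>\<rho>\<in>H. \<forall>v. DL c (snd c p) (blinfun_apply h v) = \<rho> (DL c (snd c p) v)"
proof -
  obtain S \<gamma> where \<gamma>: "piecewise_C1_curve X \<A> S \<gamma>" "\<gamma> 0 = p" "\<gamma> 1 = p"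
    and hY: "\<And>v. \<exists>Y. parallel_along \<A> metric S \<gamma> Y \<and> Y 0 c = v \<and> Y 1 c = blinfun_apply h v"
    using h unfolding holonomy_group_def by blast
  \<comment> \<open>One \<open>\<rho>\<close> has to serve every parallel field: different
    \<open>v\<close> give different fields \<open>Y\<close>, but \<open>h\<close> must be conjugate
    to a single element of \<open>H\<close>.\<close>
  define P where "P t \<longleftrightarrow> (\<exists>d\<in>\<A>. \<gamma> t \<in> fst d \<and> (\<exists>\<rho>\<in>H. \<forall>Y. parallel_along \<A> metric S \<gamma> Y \<longrightarrow>
    frame \<gamma> Y d t = \<rho> (frame \<gamma> Y c 0)))" for t
  have "P 1"
  proof (rule connected_induction_simple[of "{0..1::real}" 0])
    show "P 0" unfolding P_def using c p \<gamma>(2) H_id by (intro bexI[of _ c] conjI bexI[of _ id]) auto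
    fix a :: real assume a: "a \<in> {0..1}"
    have "\<gamma> a \<in> topspace X"
      using \<gamma>(1) a continuous_map_image_subset_topspace unfolding piecewise_C1_curve_def by fastforce
    then obtain d where d: "d \<in> \<A>" "\<gamma> a \<in> fst d" using cover by blast
    obtain T where T: "openin (top_of_set {0..1}) T" "a \<in> T"
      "\<And>s. s \<in> T \<Longrightarrow> \<gamma> s \<in> fst d"
      "\<And>s Y. s \<in> T \<Longrightarrow> parallel_along \<A> metric S \<gamma> Y \<Longrightarrow> frame \<gamma> Y d s = frame \<gamma> Y d a"
      using frame_locally_constant[OF \<gamma>(1) d(1) a d(2)] by blast
    have "P y" if x: "x \<in> T" and y: "y \<in> T" and Px: "P x" for x y
    proof -
      obtain d' \<rho> where d': "d' \<in> \<A>" "\<gamma> x \<in> fst d'" and \<rho>: "\<rho> \<in> H"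
        "\<And>Y. parallel_along \<A> metric S \<gamma> Y \<Longrightarrow> frame \<gamma> Y d' x = \<rho> (frame \<gamma> Y c 0)"
        using Px unfolding P_def by blast
      have "x \<in> {0..1}" using x T(1) openin_imp_subset by blast
      then obtain \<rho>' where \<rho>': "\<rho>' \<in> H"
        "\<And>Y. parallel_along \<A> metric S \<gamma> Y \<Longrightarrow> frame \<gamma> Y d x = \<rho>' (frame \<gamma> Y d' x)"
        using frame_transition[OF d'(1) d(1), of x \<gamma> S] d' T(3)[OF x] by blast
      have "frame \<gamma> Y d y = (\<rho>' \<circ> \<rho>) (frame \<gamma> Y c 0)" if "parallel_along \<A> metric S \<gamma> Y" for Y
        using T(4)[OF x that] T(4)[OF y that] \<rho>(2)[OF that] \<rho>'(2)[OF that] by simp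
      then show "P y" unfolding P_def using d(1) T(3)[OF y] H_comp[OF \<rho>'(1) \<rho>(1)] by blast
    qed
    then show "\<exists>T. openin (top_of_set {0..1}) T \<and> a \<in> T \<and> (\<forall>x\<in>T. \<forall>y\<in>T. P x \<longrightarrow> P y)"
      using T(1,2) by blast
  qed (auto intro: connected_Icc)
  then obtain d \<rho> where d: "d \<in> \<A>" "\<gamma> 1 \<in> fst d" and \<rho>: "\<rho> \<in> H"
    "\<And>Y. parallel_along \<A> metric S \<gamma> Y \<Longrightarrow> frame \<gamma> Y d 1 = \<rho> (frame \<gamma> Y c 0)"
    unfolding P_def by blast
  \<comment> \<open>The propagation may end in a chart \<open>d\<close> other than \<open>c\<close>;
    a last change of chart returns to the tangent space in which \<open>h\<close> is
    expressed.\<close>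
  have "\<gamma> 1 \<in> fst d \<inter> fst c" using d p \<gamma>(3) by simp
  then obtain \<rho>' where \<rho>': "\<rho>' \<in> H"
    "\<And>Y. parallel_along \<A> metric S \<gamma> Y \<Longrightarrow> frame \<gamma> Y c 1 = \<rho>' (frame \<gamma> Y d 1)"
    using frame_transition[OF d(1) c, of 1 \<gamma> S] by auto
  show ?thesis
  proof (intro bexI[of _ "\<rho>' \<circ> \<rho>"] allI)
    fix v
    obtain Y where Y: "parallel_along \<A> metric S \<gamma> Y" "Y 0 c = v" "Y 1 c = blinfun_apply h v"
      using hY by blast
    show "DL c (snd c p) (blinfun_apply h v) = (\<rho>' \<circ> \<rho>) (DL c (snd c p) v)"
      using \<rho>'(2)[OF Y(1)] \<rho>(2)[OF Y(1)] frame_eq[OF c, of \<gamma> _ Y] Y(2,3) \<gamma>(2,3) p by simp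
  qed (rule H_comp[OF \<rho>'(1) \<rho>(1)])
qed

text \<open>\<open>DL\<close> is injective at \<open>p\<close>, so each \<open>\<rho>\<close> is
  realised by at most one \<open>h\<close>.\<close>

lemma finite_holonomy:
  assumes "finite H" and c: "c \<in> \<A>" and p: "p \<in> fst c"
  shows "finite (holonomy_group X \<A> metric c p)"
proof -
  define R where "R \<rho> = {h. \<forall>v. DL c (snd c p) (blinfun_apply h v) = \<rho> (DL c (snd c p) v)}" for \<rho>
  have inj: "inj (DL c (snd c p))" using L_bij[OF c] p by (simp add: bij_is_inj)
  have "h = h'" if "h \<in> R \<rho>" "h' \<in> R \<rho>" for h h' \<rho>
  proof (rule blinfun_eqI)
    fix v
    have "DL c (snd c p) (blinfun_apply h v) = DL c (snd c p) (blinfun_apply h' v)"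
      using that by (simp add: R_def)
    then show "blinfun_apply h v = blinfun_apply h' v" using inj by (rule injD[rotated])
  qed
  then have "finite (R \<rho>)" for \<rho>
    by (metis finite.emptyI finite.insertI finite_subset insertI1 subsetI equals0I)
  moreover have "holonomy_group X \<A> metric c p \<subseteq> (\<Union>\<rho>\<in>H. R \<rho>)"
    using holonomy_in_H[OF c p] by (auto simp: R_def)
  ultimately show ?thesis using \<open>finite H\<close> by (meson finite_UN_I finite_subset)
qed

end

section \<open>Quotients by discrete groups of isometries\<close>

lemma submanifold_atlasD:
  assumes "(V, \<phi>) \<in> submanifold_atlas S"
  shows submanifold_chart_openin: "openin (top_of_set S) V"
    and submanifold_chart_open: "open (\<phi> ` V)"
    and submanifold_chart_homeomorphism: "homeomorphism V (\<phi> ` V) \<phi> (inv_into V \<phi>)"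
    and submanifold_chart_smooth: "smooth_on (inv_into V \<phi>) (\<phi> ` V)"
    and submanifold_chart_immersion: "\<And>x. x \<in> \<phi> ` V \<Longrightarrow> inj (frechet_derivative (inv_into V \<phi>) (at x))"
    and submanifold_chart_subset: "V \<subseteq> S"
    and submanifold_chart_inv: "\<And>v. v \<in> V \<Longrightarrow> inv_into V \<phi> (\<phi> v) = v"
    and submanifold_chart_inj: "inj_on \<phi> V"
proof -
  show h: "homeomorphism V (\<phi> ` V) \<phi> (inv_into V \<phi>)" and o: "openin (top_of_set S) V"
    and "open (\<phi> ` V)" "smooth_on (inv_into V \<phi>) (\<phi> ` V)"
    and "\<And>x. x \<in> \<phi> ` V \<Longrightarrow> inj (frechet_derivative (inv_into V \<phi>) (at x))"
    using assms by (auto simp: submanifold_atlas_def)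
  show "V \<subseteq> S" using o openin_imp_subset by blast
  show i: "\<And>v. v \<in> V \<Longrightarrow> inv_into V \<phi> (\<phi> v) = v" using h by (simp add: homeomorphism_def)
  then show "inj_on \<phi> V" by (rule inj_on_inverseI)
qed

text \<open>Used to shrink charts until the quotient map is injective on their domains.\<close>

lemma submanifold_atlas_restrict:
  assumes c: "(V, \<phi>) \<in> submanifold_atlas S" and W: "openin (top_of_set S) W" "W \<subseteq> V"
  shows "(W, \<phi>) \<in> submanifold_atlas S"
proof -
  note D = submanifold_atlasD[OF c]
  have inv: "inv_into W \<phi> z = inv_into V \<phi> z" if "z \<in> \<phi> ` W" for z
    using that W(2) inv_into_f_f[OF inj_on_subset[OF D(8) W(2)]] D(7) by auto
  have "\<phi> ` W = \<phi> ` V \<inter> inv_into V \<phi> -` W"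
    using W(2) D(7) by auto
  moreover have "openin (top_of_set (\<phi> ` V)) (\<phi> ` V \<inter> inv_into V \<phi> -` W)"
  proof (rule continuous_openin_preimage[of _ _ V])
    show "continuous_on (\<phi> ` V) (inv_into V \<phi>)" using D(3) by (simp add: homeomorphism_def)
    show "inv_into V \<phi> \<in> \<phi> ` V \<rightarrow> V" by (auto intro: inv_into_into)
    show "openin (top_of_set V) W"
      using W D(6) openin_subset_trans by blast
  qed
  ultimately have open': "open (\<phi> ` W)" using D(2) by (metis openin_open_eq)
  have sub: "\<phi> ` W \<subseteq> \<phi> ` V" using W(2) by auto
  have "homeomorphism W (\<phi> ` W) \<phi> (inv_into V \<phi>)"
    by (rule homeomorphism_of_subsets[OF D(3) W(2) sub refl])
  then have hom: "homeomorphism W (\<phi> ` W) \<phi> (inv_into W \<phi>)"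
    by (rule homeomorphism_cong) (simp_all add: inv)
  have "smooth_on (inv_into W \<phi>) (\<phi> ` W)"
    by (rule smooth_on_cong[OF open' _ smooth_on_subset[OF D(4) sub]]) (simp add: inv)
  moreover have "inj (frechet_derivative (inv_into W \<phi>) (at x))" if "x \<in> \<phi> ` W" for x
  proof -
    have "frechet_derivative (inv_into V \<phi>) (at x) = frechet_derivative (inv_into W \<phi>) (at x)"
      using that sub inv
      by (intro frechet_derivative_transform_within_open[OF smooth_on_differentiable_at[OF D(4,2)] open']) auto
    then show ?thesis using D(5)[of x] that sub by auto
  qed
  ultimately show ?thesis using W(1) open' hom by (simp add: submanifold_atlas_def)
qed

lemma topspace_quotient_topology: "topspace (quotient_topology X \<pi>) = \<pi> ` topspace X"
proof
  have "openin (quotient_topology X \<pi>) (\<pi> ` topspace X)"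
    unfolding openin_quotient_topology
    by (smt (verit, best) Collect_cong Collect_mem_eq image_eqI openin_topspace order_refl)
  then show "\<pi> ` topspace X \<subseteq> topspace (quotient_topology X \<pi>)" by (rule openin_subset)
  show "topspace (quotient_topology X \<pi>) \<subseteq> \<pi> ` topspace X"
    using openin_topspace[of "quotient_topology X \<pi>"] unfolding openin_quotient_topology by blast
qed

lemma continuous_map_quotient_topology: "continuous_map X (quotient_topology X \<pi>) \<pi>"
  unfolding continuous_map topspace_quotient_topology openin_quotient_topology by auto

text \<open>\<open>T_separated\<close> is a displacement bound uniform in the point, stronger than a
  properly discontinuous action. The maps act on the whole ambient space, so isometry and smoothness
  are stated there, and only \<open>T_maps\<close> refers to \<open>S\<close>.\<close>

locale isometry_action =
  fixes S :: "'a::euclidean_space set" and T :: "('a \<Rightarrow> 'a) set" and \<delta> :: real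
    and \<pi> :: "'a \<Rightarrow> 'b" and charts :: "('a, real^'n) chart set"
  defines "charts \<equiv> submanifold_atlas S"
  assumes T_id: "id \<in> T"
    and T_comp: "\<And>f g. f \<in> T \<Longrightarrow> g \<in> T \<Longrightarrow> f \<circ> g \<in> T"
    and T_inv: "\<And>f. f \<in> T \<Longrightarrow> \<exists>g\<in>T. g \<circ> f = id \<and> f \<circ> g = id"
    and T_dist: "\<And>f x y. f \<in> T \<Longrightarrow> dist (f x) (f y) = dist x y"
    and T_maps: "\<And>f x. f \<in> T \<Longrightarrow> x \<in> S \<Longrightarrow> f x \<in> S"
    and T_smooth: "\<And>f. f \<in> T \<Longrightarrow> smooth_on f UNIV"
    and \<delta>_pos: "\<delta> > 0"
    and T_separated: "\<And>f x. f \<in> T \<Longrightarrow> x \<in> S \<Longrightarrow> dist (f x) x < \<delta> \<Longrightarrow> f = id"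
    and \<pi>_eq: "\<And>x y. x \<in> S \<Longrightarrow> y \<in> S \<Longrightarrow> \<pi> x = \<pi> y \<longleftrightarrow> (\<exists>f\<in>T. y = f x)"
    and charts_cover: "\<And>x. x \<in> S \<Longrightarrow> \<exists>c\<in>charts. x \<in> fst c"
begin

abbreviation Q :: "'b topology" where "Q \<equiv> quotient_topology (top_of_set S) \<pi>"

lemma topspace_Q: "topspace Q = \<pi> ` S"
  by (simp add: topspace_quotient_topology)

lemma T_continuous: "f \<in> T \<Longrightarrow> continuous_on A f"
  using smooth_on_imp_continuous_on[OF T_smooth] continuous_on_subset by blast

text \<open>The saturation of \<open>U\<close> is the union of its preimages under the elements of
  \<open>T\<close>, each of them open in \<open>S\<close>.\<close>

lemma openin_Q_image:
  assumes "openin (top_of_set S) U"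
  shows "openin Q (\<pi> ` U)"
proof -
  have U: "U \<subseteq> S" using assms openin_imp_subset by blast
  have eq: "{x \<in> S. \<pi> x \<in> \<pi> ` U} = (\<Union>f\<in>T. S \<inter> f -` U)"
    using U \<pi>_eq by (auto simp: image_iff) blast+
  have "openin (top_of_set S) (S \<inter> f -` U)" if "f \<in> T" for f
    by (rule continuous_openin_preimage[OF T_continuous[OF that] _ assms]) (use T_maps that in auto)
  then have "openin (top_of_set S) (\<Union>f\<in>T. S \<inter> f -` U)" by blast
  then show ?thesis
    unfolding openin_quotient_topology topspace_euclidean_subtopology eq using U by auto
qed

text \<open>At most one element of \<open>T\<close> brings \<open>x\<close> within
  \<open>\<delta> / 2\<close> of \<open>y\<close>, since two such images of \<open>x\<close> would
  be less than \<open>\<delta>\<close> apart. Hence the orbit of \<open>x\<close> stays at some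
  distance \<open>e > 0\<close> from \<open>y\<close>, and balls of radius \<open>e / 2\<close> have
  disjoint images because \<open>T\<close> acts by isometries.\<close>

lemma Hausdorff_Q: "Hausdorff_space Q"
  unfolding Hausdorff_space_def topspace_Q
proof (intro allI impI, elim conjE imageE)
  fix p q x y assume "p \<noteq> q" and p: "p = \<pi> x" and q: "q = \<pi> y" and x: "x \<in> S" and y: "y \<in> S"
  then have ne: "f x \<noteq> y" if "f \<in> T" for f using \<pi>_eq[OF x y] that by blast
  have "\<exists>e>0. \<forall>f\<in>T. e \<le> dist (f x) y"
  proof (cases "\<exists>f\<in>T. dist (f x) y < \<delta> / 2")
    case True
    then obtain f0 where f0: "f0 \<in> T" "dist (f0 x) y < \<delta> / 2" by blast
    obtain g where g: "g \<in> T" "g \<circ> f0 = id" "f0 \<circ> g = id" using T_inv[OF f0(1)] by blast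
    have "f = f0" if f: "f \<in> T" "dist (f x) y < \<delta> / 2" for f
    proof -
      have "dist (f x) (f0 x) < \<delta>" using f(2) f0(2) dist_triangle_half_l[of "f x" y \<delta> "f0 x"]
        by (simp add: dist_commute)
      then have "dist ((g \<circ> f) x) x < \<delta>"
        using T_dist[OF g(1), of "f x" "f0 x"] g(2) by (metis comp_apply id_apply)
      then have "g \<circ> f = id" using T_separated[OF T_comp[OF g(1) f(1)] x] by blast
      then show ?thesis using g(3) by (metis comp_assoc comp_id id_comp)
    qed
    then have "min (\<delta> / 2) (dist (f0 x) y) \<le> dist (f x) y" if "f \<in> T" for f
      using that by (cases "dist (f x) y < \<delta> / 2") auto
    then show ?thesis using ne[OF f0(1)] \<delta>_pos
      by (intro exI[of _ "min (\<delta> / 2) (dist (f0 x) y)"]) auto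
  next
    case False
    then show ?thesis using \<delta>_pos by (intro exI[of _ "\<delta> / 2"]) force
  qed
  then obtain e where e: "e > 0" "\<And>f. f \<in> T \<Longrightarrow> e \<le> dist (f x) y" by blast
  show "\<exists>U V. openin Q U \<and> openin Q V \<and> p \<in> U \<and> q \<in> V \<and> disjnt U V"
  proof (intro exI conjI)
    show "openin Q (\<pi> ` (S \<inter> ball x (e / 2)))" "openin Q (\<pi> ` (S \<inter> ball y (e / 2)))"
      by (auto intro!: openin_Q_image openin_open_Int)
    show "p \<in> \<pi> ` (S \<inter> ball x (e / 2))" "q \<in> \<pi> ` (S \<inter> ball y (e / 2))"
      using p q x y e(1) by auto
    have False if u: "u \<in> S" "dist x u < e / 2" and v: "v \<in> S" "dist y v < e / 2" and eq: "\<pi> u = \<pi> v" for u v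
    proof -
      obtain f where f: "f \<in> T" "v = f u" using \<pi>_eq[OF u(1) v(1)] eq by blast
      have "dist (f x) v < e / 2" using T_dist[OF f(1)] f(2) u(2) by simp
      then have "dist (f x) y < e" using v(2) dist_triangle[of "f x" y v] by (simp add: dist_commute)
      then show False using e(2)[OF f(1)] by simp
    qed
    then show "disjnt (\<pi> ` (S \<inter> ball x (e / 2))) (\<pi> ` (S \<inter> ball y (e / 2)))"
      by (force simp: disjnt_def)
  qed
qed

lemma second_countable_Q: "second_countable Q"
proof (rule second_countable_open_map_image)
  show "continuous_map (top_of_set S) Q \<pi>" by (rule continuous_map_quotient_topology)
  show "open_map (top_of_set S) Q \<pi>" by (simp add: open_map_def openin_Q_image)
  show "\<pi> ` topspace (top_of_set S) = topspace Q" by (simp add: topspace_Q)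
  show "second_countable (top_of_set S)"
  proof (rule second_countable_subtopology)
    obtain B :: "'a set set" where B: "countable B" "topological_basis B"
      using ex_countable_basis by blast
    have "\<exists>V\<in>B. x \<in> V \<and> V \<subseteq> U" if "open U" "x \<in> U" for U x
      using B(2) that by (meson topological_basisE)
    then show "second_countable (euclidean :: 'a topology)"
      unfolding second_countable_def using B topological_basis_open by (intro exI[of _ B]) auto
  qed
qed

lemma inj_on_small: "inj_on \<pi> (S \<inter> ball x (\<delta> / 2))"
proof (rule inj_onI)
  fix u v assume u: "u \<in> S \<inter> ball x (\<delta> / 2)" and v: "v \<in> S \<inter> ball x (\<delta> / 2)" and "\<pi> u = \<pi> v"
  then obtain f where f: "f \<in> T" "v = f u" using \<pi>_eq by blast
  have "dist v u < \<delta>" using u v by (auto intro: dist_triangle_half_r)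
  then have "f = id" using T_separated[OF f(1)] f(2) u by auto
  then show "u = v" using f(2) by simp
qed

lemma small_chart:
  assumes "x \<in> S"
  obtains V \<phi> where "(V, \<phi>) \<in> charts" "inj_on \<pi> V" "x \<in> V"
proof -
  obtain V \<phi> where c: "(V, \<phi>) \<in> charts" "x \<in> V" using charts_cover[OF assms] by fastforce
  have VS: "openin (top_of_set S) V" "V \<subseteq> S"
    using submanifold_atlasD[OF c(1)[unfolded charts_def]] by auto
  let ?W = "V \<inter> ball x (\<delta> / 2)"
  have "openin (top_of_set S) ?W" using VS by (intro openin_Int_open) auto
  then have "(?W, \<phi>) \<in> charts" using submanifold_atlas_restrict c(1) unfolding charts_def by blast
  moreover have "inj_on \<pi> ?W" using inj_on_subset[OF inj_on_small] VS by blast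
  ultimately show thesis using that c(2) \<delta>_pos by auto
qed

definition qchart :: "'a set \<times> ('a \<Rightarrow> real^'n) \<Rightarrow> ('b, real^'n) chart" where
  "qchart c = (\<pi> ` fst c, snd c \<circ> inv_into (fst c) \<pi>)"

definition admissible :: "('a, real^'n) chart \<Rightarrow> bool" where
  "admissible c \<longleftrightarrow> c \<in> charts \<and> inj_on \<pi> (fst c)"

lemma quotient_atlas_eq: "quotient_atlas \<pi> charts = qchart ` Collect admissible"
  by (force simp: quotient_atlas_def qchart_def admissible_def)

context
  fixes V \<phi> assumes adm: "admissible (V, \<phi>)"
begin

lemma adm_chart: "(V, \<phi>) \<in> submanifold_atlas S" and adm_inj: "inj_on \<pi> V"
  using adm by (auto simp: admissible_def charts_def)

lemmas admD = submanifold_atlasD[OF adm_chart]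

lemma qchart_apply: "v \<in> V \<Longrightarrow> snd (qchart (V, \<phi>)) (\<pi> v) = \<phi> v"
  by (simp add: qchart_def inv_into_f_f[OF adm_inj])

lemma qchart_inj: "inj_on (snd (qchart (V, \<phi>))) (\<pi> ` V)"
  using qchart_apply admD(8) by (auto simp: inj_on_def)

lemma qchart_image: "A \<subseteq> V \<Longrightarrow> snd (qchart (V, \<phi>)) ` (\<pi> ` A) = \<phi> ` A"
  unfolding image_image using qchart_apply by (intro image_cong) auto

lemma qchart_inv: "v \<in> V \<Longrightarrow> chart_inv (qchart (V, \<phi>)) (\<phi> v) = \<pi> v"
  using inv_into_f_f[OF qchart_inj, of "\<pi> v"] qchart_apply by (simp add: qchart_def)

lemma qchart_homeomorphic:
  "homeomorphic_map (subtopology Q (\<pi> ` V)) (top_of_set (\<phi> ` V)) (snd (qchart (V, \<phi>)))"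
  unfolding homeomorphic_map_maps
proof (intro exI)
  have top: "topspace (subtopology Q (\<pi> ` V)) = \<pi> ` V"
    using admD(6) by (auto simp: topspace_Q)
  have c1: "continuous_map (subtopology Q (\<pi> ` V)) (top_of_set (\<phi> ` V)) (snd (qchart (V, \<phi>)))"
    unfolding continuous_map top
  proof (intro conjI allI impI)
    show "snd (qchart (V, \<phi>)) ` \<pi> ` V \<subseteq> topspace (top_of_set (\<phi> ` V))"
      using qchart_image[OF order_refl] by simp
    fix U assume U: "openin (top_of_set (\<phi> ` V)) U"
    have "continuous_on V \<phi>" using admD(3) by (simp add: homeomorphism_def)
    then have "openin (top_of_set V) (V \<inter> \<phi> -` U)"
      by (rule continuous_openin_preimage[OF _ _ U]) auto
    then have "openin (top_of_set S) (V \<inter> \<phi> -` U)" using admD(1) openin_trans by blast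
    then have "openin Q (\<pi> ` (V \<inter> \<phi> -` U))" by (rule openin_Q_image)
    then have "openin (subtopology Q (\<pi> ` V)) (\<pi> ` (V \<inter> \<phi> -` U))"
      unfolding openin_subtopology by (intro exI[of _ "\<pi> ` (V \<inter> \<phi> -` U)"]) auto
    moreover have "{x \<in> \<pi> ` V. snd (qchart (V, \<phi>)) x \<in> U} = \<pi> ` (V \<inter> \<phi> -` U)"
      using qchart_apply by auto
    ultimately show "openin (subtopology Q (\<pi> ` V)) {x \<in> \<pi> ` V. snd (qchart (V, \<phi>)) x \<in> U}"
      by simp
  qed
  have c2: "continuous_map (top_of_set (\<phi> ` V)) (subtopology Q (\<pi> ` V)) (\<pi> \<circ> inv_into V \<phi>)"
  proof (rule continuous_map_into_subtopology)
    have "continuous_map (top_of_set (\<phi> ` V)) (top_of_set S) (inv_into V \<phi>)"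
      using admD(3,6) by (auto simp: homeomorphism_def intro: inv_into_into)
    then show "continuous_map (top_of_set (\<phi> ` V)) Q (\<pi> \<circ> inv_into V \<phi>)"
      using continuous_map_quotient_topology by (rule continuous_map_compose)
    show "(\<pi> \<circ> inv_into V \<phi>) \<in> topspace (top_of_set (\<phi> ` V)) \<rightarrow> \<pi> ` V"
      by (auto simp: admD(7))
  qed
  show "homeomorphic_maps (subtopology Q (\<pi> ` V)) (top_of_set (\<phi> ` V))
      (snd (qchart (V, \<phi>))) (\<pi> \<circ> inv_into V \<phi>)"
    unfolding homeomorphic_maps_def top using c1 c2 by (auto simp: qchart_apply admD(7))
qed

end

text \<open>Two representatives of the same class differ by some \<open>f\<close> in
  \<open>T\<close>. Continuity of \<open>f\<close> and openness of \<open>W\<close> make this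
  \<open>f\<close> valid near \<open>z\<close>; elsewhere on the overlap a different one may
  occur.\<close>

lemma local_transition:
  assumes c: "admissible (V, \<phi>)" and d: "admissible (W, \<psi>)"
    and z: "z \<in> snd (qchart (V, \<phi>)) ` (\<pi> ` V \<inter> \<pi> ` W)"
  obtains f N where "f \<in> T" "open N" "z \<in> N" "N \<subseteq> snd (qchart (V, \<phi>)) ` (\<pi> ` V \<inter> \<pi> ` W)"
    "\<And>y. y \<in> N \<Longrightarrow> f (inv_into V \<phi> y) \<in> W"
    "\<And>y. y \<in> N \<Longrightarrow> transition (qchart (V, \<phi>)) (qchart (W, \<psi>)) y = \<psi> (f (inv_into V \<phi> y))"
proof -
  note C = admD[OF c] and D = admD[OF d]
  obtain v w where vw: "v \<in> V" "w \<in> W" "\<pi> v = \<pi> w" "z = \<phi> v"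
    using z qchart_apply[OF c] by auto
  have vS: "v \<in> S" "w \<in> S" using vw C(6) D(6) by auto
  obtain f where f: "f \<in> T" "w = f v" using \<pi>_eq[OF vS] vw(3) by blast
  define N where "N = \<phi> ` V \<inter> (f \<circ> inv_into V \<phi>) -` W"
  have "openin (top_of_set (\<phi> ` V)) N"
    unfolding N_def
  proof (rule continuous_openin_preimage[OF _ _ D(1)])
    show "continuous_on (\<phi> ` V) (f \<circ> inv_into V \<phi>)"
      using C(3) by (intro continuous_on_compose T_continuous f(1)) (simp add: homeomorphism_def)
    show "f \<circ> inv_into V \<phi> \<in> \<phi> ` V \<rightarrow> S" using C(6,7) T_maps[OF f(1)] by auto
  qed
  then have N: "open N" using C(2) by (metis openin_open_eq)
  have y: "\<exists>u\<in>V. y = \<phi> u \<and> f u \<in> W \<and> \<pi> u = \<pi> (f u)" if yN: "y \<in> N" for y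
  proof -
    obtain u where u: "u \<in> V" "y = \<phi> u" "f u \<in> W" using yN C(7) by (auto simp: N_def)
    have "u \<in> S" "f u \<in> S" using u C(6) T_maps[OF f(1)] by auto
    then show ?thesis using u \<pi>_eq f(1) by blast
  qed
  show thesis
  proof (rule that[OF f(1) N])
    show "z \<in> N" using vw f(2) C(7) by (auto simp: N_def)
    show "N \<subseteq> snd (qchart (V, \<phi>)) ` (\<pi> ` V \<inter> \<pi> ` W)"
    proof
      fix y assume "y \<in> N"
      then obtain u where u: "u \<in> V" "y = \<phi> u" "f u \<in> W" "\<pi> u = \<pi> (f u)" using y by blast
      have "\<pi> u \<in> \<pi> ` W" unfolding u(4) using u(3) by (rule imageI)
      then have "\<pi> u \<in> \<pi> ` V \<inter> \<pi> ` W" using u(1) by blast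
      then show "y \<in> snd (qchart (V, \<phi>)) ` (\<pi> ` V \<inter> \<pi> ` W)"
        using u qchart_apply[OF c u(1)] by (metis image_eqI)
    qed
    show "f (inv_into V \<phi> y) \<in> W" if "y \<in> N" for y using that by (simp add: N_def)
    show "transition (qchart (V, \<phi>)) (qchart (W, \<psi>)) y = \<psi> (f (inv_into V \<phi> y))" if yN: "y \<in> N" for y
    proof -
      obtain u where u: "u \<in> V" "y = \<phi> u" "f u \<in> W" "\<pi> u = \<pi> (f u)" using y[OF yN] by blast
      then show ?thesis
        using qchart_inv[OF c u(1)] qchart_apply[OF d u(3)] C(7)[OF u(1)] by (simp add: transition_def)
    qed
  qed
qed

text \<open>A chart \<open>\<psi>\<close> is only a homeomorphism, and smoothness is known for its
  inverse alone. The transition is therefore treated as a continuous lift, through the immersion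
  \<open>inv_into W \<psi>\<close>, of the smooth map
  \<open>f \<circ> inv_into V \<phi>\<close>.\<close>

lemma smooth_transition:
  assumes c: "admissible (V, \<phi>)" and d: "admissible (W, \<psi>)"
  shows "smooth_on (transition (qchart (V, \<phi>)) (qchart (W, \<psi>))) (snd (qchart (V, \<phi>)) ` (\<pi> ` V \<inter> \<pi> ` W))"
proof (rule smooth_on_local)
  note C = admD[OF c] and D = admD[OF d]
  fix z assume z: "z \<in> snd (qchart (V, \<phi>)) ` (\<pi> ` V \<inter> \<pi> ` W)"
  obtain f N where f: "f \<in> T" and N: "open N" "z \<in> N" "N \<subseteq> snd (qchart (V, \<phi>)) ` (\<pi> ` V \<inter> \<pi> ` W)"
    "\<And>y. y \<in> N \<Longrightarrow> f (inv_into V \<phi> y) \<in> W"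
    "\<And>y. y \<in> N \<Longrightarrow> transition (qchart (V, \<phi>)) (qchart (W, \<psi>)) y = \<psi> (f (inv_into V \<phi> y))"
    by (rule local_transition[OF c d z]) blast
  have NV: "N \<subseteq> \<phi> ` V"
  proof -
    have "snd (qchart (V, \<phi>)) ` (\<pi> ` V \<inter> \<pi> ` W) \<subseteq> snd (qchart (V, \<phi>)) ` \<pi> ` V" by blast
    then show ?thesis using N(3) qchart_image[OF c order_refl] by blast
  qed
  have contf: "continuous_on N (\<lambda>y. f (inv_into V \<phi> y))"
  proof -
    have "continuous_on (\<phi> ` V) (inv_into V \<phi>)" using C(3) by (simp add: homeomorphism_def)
    from continuous_on_compose[OF continuous_on_subset[OF this NV] T_continuous[OF f]]
    show ?thesis by (simp add: o_def)
  qed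
  have "smooth_on (\<lambda>y. \<psi> (f (inv_into V \<phi> y))) N"
  proof (rule immersion_lift_smooth[OF D(2,4,5) N(1)])
    show "continuous_on N (\<lambda>y. \<psi> (f (inv_into V \<phi> y)))"
    proof (rule continuous_on_compose2[OF _ contf])
      show "continuous_on W \<psi>" using D(3) by (simp add: homeomorphism_def)
    qed (use N(4) in auto)
    show "(\<lambda>y. \<psi> (f (inv_into V \<phi> y))) ` N \<subseteq> \<psi> ` W" using N(4) by auto
    have "smooth_on (\<lambda>y. f (inv_into V \<phi> y)) N"
      by (rule smooth_on_compose[OF N(1) open_UNIV _ T_smooth[OF f] smooth_on_subset[OF C(4) NV]]) simp
    then show "smooth_on (\<lambda>y. inv_into W \<psi> (\<psi> (f (inv_into V \<phi> y)))) N"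
      by (rule smooth_on_cong[OF N(1), rotated]) (simp add: D(7) N(4))
  qed
  then have "smooth_on (transition (qchart (V, \<phi>)) (qchart (W, \<psi>))) N"
    by (rule smooth_on_cong[OF N(1), rotated]) (simp add: N(5))
  then show "\<exists>N. open N \<and> z \<in> N \<and> smooth_on (transition (qchart (V, \<phi>)) (qchart (W, \<psi>))) N"
    using N(1,2) by blast
qed

theorem smooth_manifold_quotient: "smooth_manifold Q (quotient_atlas \<pi> charts)"
  unfolding smooth_manifold_def
proof (intro conjI ballI)
  show "Hausdorff_space Q" by (rule Hausdorff_Q)
  show "second_countable Q" by (rule second_countable_Q)
  show "topspace Q = (\<Union>c\<in>quotient_atlas \<pi> charts. fst c)"
  proof
    show "topspace Q \<subseteq> (\<Union>c\<in>quotient_atlas \<pi> charts. fst c)"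
    proof
      fix p assume "p \<in> topspace Q"
      then obtain x where x: "x \<in> S" "p = \<pi> x" by (auto simp: topspace_Q)
      obtain V \<phi> where "(V, \<phi>) \<in> charts" "inj_on \<pi> V" "x \<in> V" by (rule small_chart[OF x(1)])
      then have "admissible (V, \<phi>)" "p \<in> fst (qchart (V, \<phi>))"
        using x(2) by (auto simp: admissible_def qchart_def)
      then show "p \<in> (\<Union>c\<in>quotient_atlas \<pi> charts. fst c)" unfolding quotient_atlas_eq by blast
    qed
    show "(\<Union>c\<in>quotient_atlas \<pi> charts. fst c) \<subseteq> topspace Q"
      unfolding quotient_atlas_eq topspace_Q using admD(6) by (fastforce simp: qchart_def)
  qed
next
  fix c assume "c \<in> quotient_atlas \<pi> charts"
  then obtain V \<phi> where c: "admissible (V, \<phi>)" "c = qchart (V, \<phi>)" unfolding quotient_atlas_eq by auto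
  note C = admD[OF c(1)]
  have "openin Q (\<pi> ` V)" by (rule openin_Q_image[OF C(1)])
  then have "openin Q (fst c) \<and> open (snd c ` fst c) \<and>
    homeomorphic_map (subtopology Q (fst c)) (top_of_set (snd c ` fst c)) (snd c)"
    using C(2) qchart_image[OF c(1) order_refl] qchart_homeomorphic[OF c(1)] c(2)
    by (simp add: qchart_def)
  then show "case c of (U, \<psi>) \<Rightarrow> openin Q U \<and> open (\<psi> ` U) \<and>
      homeomorphic_map (subtopology Q U) (top_of_set (\<psi> ` U)) \<psi>"
    by (simp add: case_prod_unfold)
next
  fix c d assume "c \<in> quotient_atlas \<pi> charts" "d \<in> quotient_atlas \<pi> charts"
  then obtain V \<phi> W \<psi> where "admissible (V, \<phi>)" "c = qchart (V, \<phi>)" "admissible (W, \<psi>)" "d = qchart (W, \<psi>)"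
    unfolding quotient_atlas_eq by auto
  then show "smooth_on (transition c d) (snd c ` (fst c \<inter> fst d))"
    using smooth_transition by (simp add: qchart_def)
qed

end

section \<open>Flat structure on the product with an interval\<close>

text \<open>\<open>F\<close> is the developing map upstairs. By \<open>F_equivariant\<close>,
  passing to another representative changes it by a Euclidean isometry that is independent of the
  interval coordinate, so the flat metric descends.\<close>

locale flat_isometry_action = isometry_action S T \<delta> \<pi> charts
  for S :: "'a::euclidean_space set" and T \<delta> and \<pi> :: "'a \<Rightarrow> 'b" and charts :: "('a, real^'n) chart set" +
  fixes F :: "'a \<times> real \<Rightarrow> 'f::euclidean_space" and H :: "('f \<Rightarrow> 'f) set" and lo hi :: real
  assumes F_smooth: "smooth_on F UNIV"
    and F_bij: "\<And>V \<phi> z t. (V, \<phi>) \<in> charts \<Longrightarrow> z \<in> \<phi> ` V \<Longrightarrow> lo < t \<Longrightarrow> t < hi \<Longrightarrow>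
      bij (frechet_derivative (\<lambda>(z, t). F (inv_into V \<phi> z, t)) (at (z, t)))"
    and F_equivariant: "\<And>f. f \<in> T \<Longrightarrow> \<exists>\<rho>\<in>H. \<exists>r. \<forall>x\<in>S. \<forall>t. F (f x, t) = \<rho> (F (x, t)) + r"
    and H_linear': "\<And>\<rho>. \<rho> \<in> H \<Longrightarrow> linear \<rho>"
    and H_inner': "\<And>\<rho> v w. \<rho> \<in> H \<Longrightarrow> \<rho> v \<bullet> \<rho> w = v \<bullet> w"
    and H_id': "id \<in> H"
    and H_comp': "\<And>\<rho> \<sigma>. \<rho> \<in> H \<Longrightarrow> \<sigma> \<in> H \<Longrightarrow> \<rho> \<circ> \<sigma> \<in> H"
begin

definition pchart :: "('a, real^'n) chart \<Rightarrow> ('b \<times> real, (real^'n) \<times> real) chart" where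
  "pchart c = (fst (qchart c) \<times> {lo<..<hi}, map_prod (snd (qchart c)) id)"

lemma times_interval_atlas_eq:
  "times_interval_atlas (quotient_atlas \<pi> charts) lo hi = pchart ` Collect admissible"
  unfolding times_interval_atlas_def quotient_atlas_eq image_image pchart_def
  by (simp add: case_prod_unfold)

text \<open>A chart of the quotient does not record the sheet it came from. Choosing one sheet makes
  \<open>developing\<close> a function of the chart alone; another sheet would change it by local
  isometries.\<close>

definition lift :: "('b \<times> real, (real^'n) \<times> real) chart \<Rightarrow> ('a, real^'n) chart" where
  "lift k = (SOME c. admissible c \<and> k = pchart c)"

definition developing :: "('b \<times> real, (real^'n) \<times> real) chart \<Rightarrow> (real^'n) \<times> real \<Rightarrow> 'f" where
  "developing k = (\<lambda>(z, t). F (inv_into (fst (lift k)) (snd (lift k)) z, t))"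

lemma atlas_cases:
  assumes "k \<in> times_interval_atlas (quotient_atlas \<pi> charts) lo hi"
  obtains V \<phi> where "admissible (V, \<phi>)" "k = pchart (V, \<phi>)"
    "developing k = (\<lambda>(z, t). F (inv_into V \<phi> z, t))"
proof -
  have "\<exists>c. admissible c \<and> k = pchart c" using assms unfolding times_interval_atlas_eq by blast
  then have "admissible (lift k) \<and> k = pchart (lift k)" unfolding lift_def by (rule someI_ex)
  then show thesis using that[of "fst (lift k)" "snd (lift k)"] by (simp add: developing_def)
qed

lemma pchart_simps:
  "fst (pchart (V, \<phi>)) = \<pi> ` V \<times> {lo<..<hi}"
  "snd (pchart (V, \<phi>)) = map_prod (snd (qchart (V, \<phi>))) id"
  by (simp_all add: pchart_def qchart_def)

lemma pchart_image:
  assumes "admissible (V, \<phi>)"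
  shows "snd (pchart (V, \<phi>)) ` fst (pchart (V, \<phi>)) = \<phi> ` V \<times> {lo<..<hi}"
  using qchart_image[OF assms order_refl] by (simp add: pchart_simps map_prod_image)

lemma pchart_inj:
  assumes "admissible (V, \<phi>)"
  shows "inj_on (snd (pchart (V, \<phi>))) (fst (pchart (V, \<phi>)))"
  unfolding pchart_simps by (intro map_prod_inj_on qchart_inj[OF assms]) auto

lemma pchart_transition:
  assumes c: "admissible (V, \<phi>)" and zt: "z \<in> \<phi> ` V" "lo < t" "t < hi"
  shows "transition (pchart (V, \<phi>)) (pchart (W, \<psi>)) (z, t)
    = (transition (qchart (V, \<phi>)) (qchart (W, \<psi>)) z, t)"
proof -
  obtain v where v: "v \<in> V" "z = \<phi> v" using zt by auto
  have "inv_into (fst (pchart (V, \<phi>))) (snd (pchart (V, \<phi>))) (snd (pchart (V, \<phi>)) (\<pi> v, t)) = (\<pi> v, t)"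
    by (rule inv_into_f_f[OF pchart_inj[OF c]]) (use v zt in \<open>auto simp: pchart_simps\<close>)
  moreover have "snd (pchart (V, \<phi>)) (\<pi> v, t) = (z, t)"
    using v by (simp add: pchart_simps qchart_apply[OF c])
  ultimately show ?thesis
    using qchart_inv[OF c v(1)] v(2) by (simp add: transition_def pchart_simps)
qed

lemma pchart_overlap:
  "snd (pchart (V, \<phi>)) ` (fst (pchart (V, \<phi>)) \<inter> fst (pchart (W, \<psi>)))
    = snd (qchart (V, \<phi>)) ` (\<pi> ` V \<inter> \<pi> ` W) \<times> {lo<..<hi}"
proof -
  have "fst (pchart (V, \<phi>)) \<inter> fst (pchart (W, \<psi>)) = (\<pi> ` V \<inter> \<pi> ` W) \<times> {lo<..<hi}"
    by (auto simp: pchart_simps)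
  then show ?thesis by (simp add: pchart_simps map_prod_image)
qed

sublocale flat: flat_atlas "times_interval_topology Q lo hi"
  "times_interval_atlas (quotient_atlas \<pi> charts) lo hi" developing H
proof
  fix x assume "x \<in> topspace (times_interval_topology Q lo hi)"
  then obtain p t where x: "x = (p, t)" "p \<in> \<pi> ` S" "t \<in> {lo<..<hi}"
    by (auto simp: times_interval_topology_def topspace_Q)
  then obtain s where s: "s \<in> S" "p = \<pi> s" by auto
  obtain V \<phi> where V: "(V, \<phi>) \<in> charts" "inj_on \<pi> V" "s \<in> V" by (rule small_chart[OF s(1)])
  then have "admissible (V, \<phi>)" by (simp add: admissible_def)
  then show "\<exists>c\<in>times_interval_atlas (quotient_atlas \<pi> charts) lo hi. x \<in> fst c"
    unfolding times_interval_atlas_eq using x s(2) V(3)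
    by (intro bexI[of _ "pchart (V, \<phi>)"]) (auto simp: pchart_simps)
next
  fix k assume "k \<in> times_interval_atlas (quotient_atlas \<pi> charts) lo hi"
  then obtain V \<phi> where c: "admissible (V, \<phi>)" and k: "k = pchart (V, \<phi>)"
    and dev: "developing k = (\<lambda>(z, t). F (inv_into V \<phi> z, t))" by (rule atlas_cases)
  note C = admD[OF c]
  show "openin (times_interval_topology Q lo hi) (fst k)"
    unfolding k pchart_simps times_interval_topology_def openin_prod_Times_iff
    using openin_Q_image[OF C(1)] by simp
  show "inj_on (snd k) (fst k)" unfolding k by (rule pchart_inj[OF c])
  show op: "open (snd k ` fst k)"
    unfolding k pchart_image[OF c] by (intro open_Times C(2)) simp
  show "smooth_on (developing k) (snd k ` fst k)"
    unfolding dev case_prod_unfold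
  proof (rule smooth_on_compose[OF op open_UNIV _ F_smooth smooth_on_Pair[OF op]])
    show "smooth_on (\<lambda>p. inv_into V \<phi> (fst p)) (snd k ` fst k)"
      by (rule smooth_on_compose[OF op C(2) _ C(4) smooth_on_bounded_linear[OF bounded_linear_fst]])
        (auto simp: k pchart_image[OF c])
    show "smooth_on snd (snd k ` fst k)"
      by (rule smooth_on_bounded_linear[OF bounded_linear_snd])
  qed simp
  fix y assume "y \<in> snd k ` fst k"
  then show "bij (frechet_derivative (developing k) (at y))"
    using F_bij[of V \<phi>] c unfolding k pchart_image[OF c] dev[unfolded k] by (auto simp: admissible_def)
next
  fix k l y assume kl: "k \<in> times_interval_atlas (quotient_atlas \<pi> charts) lo hi"
    "l \<in> times_interval_atlas (quotient_atlas \<pi> charts) lo hi"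
    and y: "y \<in> snd k ` (fst k \<inter> fst l)"
  obtain V \<phi> where c: "admissible (V, \<phi>)" and k: "k = pchart (V, \<phi>)"
    and devk: "developing k = (\<lambda>(z, t). F (inv_into V \<phi> z, t))" using kl(1) by (rule atlas_cases)
  obtain W \<psi> where d: "admissible (W, \<psi>)" and l: "l = pchart (W, \<psi>)"
    and devl: "developing l = (\<lambda>(z, t). F (inv_into W \<psi> z, t))" using kl(2) by (rule atlas_cases)
  note C = admD[OF c] and D = admD[OF d]
  obtain z t where zt: "y = (z, t)" "z \<in> snd (qchart (V, \<phi>)) ` (\<pi> ` V \<inter> \<pi> ` W)" "t \<in> {lo<..<hi}"
    using y unfolding k l pchart_overlap by (rule SigmaE) blast
  obtain f N where f: "f \<in> T" and N: "open N" "z \<in> N" "N \<subseteq> snd (qchart (V, \<phi>)) ` (\<pi> ` V \<inter> \<pi> ` W)"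
    "\<And>y. y \<in> N \<Longrightarrow> f (inv_into V \<phi> y) \<in> W"
    "\<And>y. y \<in> N \<Longrightarrow> transition (qchart (V, \<phi>)) (qchart (W, \<psi>)) y = \<psi> (f (inv_into V \<phi> y))"
    by (rule local_transition[OF c d zt(2)]) blast
  have NV: "N \<subseteq> \<phi> ` V"
  proof -
    have "snd (qchart (V, \<phi>)) ` (\<pi> ` V \<inter> \<pi> ` W) \<subseteq> snd (qchart (V, \<phi>)) ` \<pi> ` V" by blast
    then show ?thesis using N(3) qchart_image[OF c order_refl] by blast
  qed
  have NI: "open (N \<times> {lo<..<hi})" "y \<in> N \<times> {lo<..<hi}"
    using N(1,2) zt by (auto intro: open_Times)
  have tr: "transition k l (z, t) = (transition (qchart (V, \<phi>)) (qchart (W, \<psi>)) z, t)"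
    if "(z, t) \<in> N \<times> {lo<..<hi}" for z t
    unfolding k l by (rule pchart_transition[OF c]) (use that NV in auto)
  have "smooth_on (transition (qchart (V, \<phi>)) (qchart (W, \<psi>))) N"
    by (rule smooth_on_subset[OF smooth_transition[OF c d] N(3)])
  then have "smooth_on (\<lambda>p. transition (qchart (V, \<phi>)) (qchart (W, \<psi>)) (fst p)) (N \<times> {lo<..<hi})"
    by (rule smooth_on_compose[OF NI(1) N(1) _ _ smooth_on_bounded_linear[OF bounded_linear_fst], rotated]) auto
  then have "smooth_on (\<lambda>p. (transition (qchart (V, \<phi>)) (qchart (W, \<psi>)) (fst p), snd p)) (N \<times> {lo<..<hi})"
    by (rule smooth_on_Pair[OF NI(1) _ smooth_on_bounded_linear[OF bounded_linear_snd]])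
  then have "smooth_on (transition k l) (N \<times> {lo<..<hi})"
    by (rule smooth_on_cong[OF NI(1), rotated]) (use tr in auto)
  then show "transition k l differentiable at y"
    using NI by (rule smooth_on_differentiable_at)
  obtain \<rho> r where \<rho>: "\<rho> \<in> H" "\<And>x t. x \<in> S \<Longrightarrow> F (f x, t) = \<rho> (F (x, t)) + r"
    using F_equivariant[OF f] by blast
  \<comment> \<open>On \<open>N\<close> the point of the sheet \<open>W\<close> is \<open>f\<close>
    applied to the point of the sheet \<open>V\<close>, so the two developing maps differ by the
    affine map that belongs to \<open>f\<close>.\<close>
  have "developing l (transition k l p) = \<rho> (developing k p) + r" if pN: "p \<in> N \<times> {lo<..<hi}" for p
  proof -
    obtain z t where p: "p = (z, t)" "z \<in> N" "(z, t) \<in> N \<times> {lo<..<hi}" using pN by auto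
    have "inv_into V \<phi> z \<in> S" using C(6) NV p(2) inv_into_into[of z \<phi> V] by blast
    then show ?thesis
      unfolding p(1) tr[OF p(3)] devk devl using N(4,5)[OF p(2)] D(7) \<rho>(2) by simp
  qed
  then show "\<exists>\<rho>\<in>H. \<exists>r N. open N \<and> y \<in> N \<and> (\<forall>z\<in>N. developing l (transition k l z) = \<rho> (developing k z) + r)"
    using \<rho>(1) NI by blast
qed (auto simp: H_inner' H_id' linear_add[OF H_linear'] linear_scale[OF H_linear'] intro: H_comp')

end

section \<open>Charts of the group\<close>

text \<open>The quaternion with first column \<open>p\<close>, defined on all of
  \<open>\<complex>\<^sup>2\<close> as a real-linear map so that it can be differentiated
  freely.\<close>

definition su2 :: "complex \<times> complex \<Rightarrow> complex^2^2" where
  "su2 p = vector [vector [fst p, - cnj (snd p)], vector [snd p, cnj (fst p)]]"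

definition diag2 :: "complex \<Rightarrow> complex^2^2" where
  "diag2 z = vector [vector [z, 0], vector [0, cnj z]]"

lemma su2_nth [simp]:
  "su2 p $ 1 $ 1 = fst p" "su2 p $ 1 $ 2 = - cnj (snd p)" "su2 p $ 2 $ 1 = snd p" "su2 p $ 2 $ 2 = cnj (fst p)"
  by (simp_all add: su2_def)

lemma diag2_nth [simp]:
  "diag2 z $ 1 $ 1 = z" "diag2 z $ 1 $ 2 = 0" "diag2 z $ 2 $ 1 = 0" "diag2 z $ 2 $ 2 = cnj z"
  by (simp_all add: diag2_def)

lemma linear_su2: "linear su2"
  by (rule linearI) (simp_all add: vec_eq_iff forall_2)

text \<open>SU(2) is the unit sphere of pairs via the first column; compactness, the charts and the
  polar map all rest on this description.\<close>

lemma SU2_iff: "A \<in> SU \<longleftrightarrow> (\<exists>p. norm p = 1 \<and> A = su2 p)" for A :: "complex^2^2"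
proof
  assume "A \<in> SU"
  then have A: "A ** map_matrix cnj (transpose A) = mat 1" and det: "det A = 1" by (auto simp: SU_def)
  define a b c d where abcd: "a = A $ 1 $ 1" "b = A $ 1 $ 2" "c = A $ 2 $ 1" "d = A $ 2 $ 2"
  have 1: "a * cnj a + b * cnj b = 1" and 2: "a * cnj c + b * cnj d = 0"
    using A by (simp_all add: vec_eq_iff forall_2 matrix_matrix_mult_def sum_2 map_matrix_def transpose_def mat_def abcd)
  have 3: "a * d - b * c = 1" using det by (simp add: det_2 abcd)
  have 4: "cnj a * c + cnj b * d = 0"
    using arg_cong[OF 2, of cnj] by simp
  have d: "d = cnj a"
  proof -
    \<comment> \<open>Inserting the norm of the first row as a factor 1 and regrouping produces the
      determinant and the conjugate orthogonality relation.\<close>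
    have "d = d * (a * cnj a + b * cnj b)" using 1 by simp
    also have "\<dots> = cnj a * (a * d - b * c) + b * (cnj a * c + cnj b * d)" by (simp add: algebra_simps)
    finally show ?thesis using 3 4 by simp
  qed
  have c: "c = - cnj b"
  proof -
    have "c = c * (a * cnj a + b * cnj b)" using 1 by simp
    also have "\<dots> = a * (cnj a * c + cnj b * d) - cnj b * (a * d - b * c)" by (simp add: algebra_simps)
    finally show ?thesis using 3 4 by simp
  qed
  have "A = su2 (a, c)" using c d by (simp add: vec_eq_iff forall_2 abcd[symmetric])
  moreover have "norm (a, c) = 1"
  proof -
    have "complex_of_real ((norm a)\<^sup>2 + (norm c)\<^sup>2) = a * cnj a + b * cnj b"
      unfolding c by (simp only: norm_minus_cancel complex_mod_cnj of_real_add complex_norm_square)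
    then have "(norm a)\<^sup>2 + (norm c)\<^sup>2 = 1" unfolding 1 using of_real_eq_1_iff by blast
    then show ?thesis by (simp add: norm_prod_def)
  qed
  ultimately show "\<exists>p. norm p = 1 \<and> A = su2 p" by blast
next
  assume "\<exists>p. norm p = 1 \<and> A = su2 p"
  then obtain w z where A: "A = su2 (w, z)" and "norm (w, z) = 1" by auto
  then have "(norm w)\<^sup>2 + (norm z)\<^sup>2 = 1" by (simp add: norm_prod_def)
  then have "complex_of_real ((norm w)\<^sup>2 + (norm z)\<^sup>2) = 1" by (simp only: of_real_1)
  then have "w * cnj w + z * cnj z = 1" by (simp only: of_real_add complex_norm_square)
  then show "A \<in> SU"
    unfolding A SU_def
    by (simp add: vec_eq_iff forall_2 matrix_matrix_mult_def sum_2 map_matrix_def transpose_def mat_def det_2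
        mult.commute add.commute)
qed

lemma compact_SU2: "compact (SU :: (complex^2^2) set)"
proof -
  have "SU = su2 ` sphere 0 1" by (simp add: set_eq_iff SU2_iff image_iff Bex_def)
  moreover have "continuous_on (sphere 0 1) su2"
    by (rule linear_continuous_on) (simp add: linear_su2 linear_conv_bounded_linear[symmetric])
  ultimately show ?thesis using compact_continuous_image compact_sphere by metis
qed

lemma diag2_mult: "diag2 z ** diag2 z' = diag2 (z * z')"
  by (simp add: vec_eq_iff forall_2 matrix_matrix_mult_def sum_2)

lemma diag2_1: "diag2 1 = mat 1"
  by (simp add: vec_eq_iff forall_2 mat_def)

lemma diag2_su2: "diag2 z ** su2 p = su2 (z * fst p, cnj z * snd p)"
  by (simp add: vec_eq_iff forall_2 matrix_matrix_mult_def sum_2)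

lemma diag2_eq_su2: "diag2 z = su2 (z, 0)"
  by (simp add: vec_eq_iff forall_2)

lemma diag2_in_SU: "norm z = 1 \<Longrightarrow> diag2 z \<in> SU"
  unfolding SU2_iff diag2_eq_su2 by (intro exI[of _ "(z, 0)"]) (simp add: norm_prod_def)

lemma diag2_mult_in_SU: "norm z = 1 \<Longrightarrow> B \<in> SU \<Longrightarrow> diag2 z ** B \<in> SU"
proof -
  assume z: "norm z = 1" and "B \<in> SU"
  then obtain p where p: "norm p = 1" "B = su2 p" using SU2_iff by blast
  have "norm (z * fst p, cnj z * snd p) = norm p" using z by (simp add: norm_prod_def norm_mult)
  then show "diag2 z ** B \<in> SU" unfolding SU2_iff p(2) diag2_su2 using p(1) by auto
qed

lemma norm_diag2_mult: "norm z = 1 \<Longrightarrow> norm (diag2 z ** B) = norm B" for B :: "complex^2^2"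
  by (simp add: norm_vec_def L2_set_def sum_2 matrix_matrix_mult_def norm_mult)

lemma norm_diag2_apply: "norm z = 1 \<Longrightarrow> norm (diag2 z *v q) = norm q"
  by (simp add: norm_vec_def L2_set_def sum_2 matrix_vector_mult_def norm_mult)

text \<open>The first row of \<open>B\<close> is a unit vector and is multiplied by
  \<open>z\<close>, so the displacement is bounded below uniformly in \<open>B\<close>.\<close>

lemma dist_diag2_mult_self: "B \<in> SU \<Longrightarrow> norm (z - 1) \<le> dist (diag2 z ** B) B"
proof -
  assume "B \<in> SU"
  then obtain p where p: "norm p = 1" "B = su2 p" using SU2_iff by blast
  have "(diag2 z ** B - B) $ 1 = (\<chi> j. (z - 1) * B $ 1 $ j)"
    by (simp add: vec_eq_iff forall_2 matrix_matrix_mult_def sum_2 algebra_simps)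
  then have "norm ((diag2 z ** B - B) $ 1) = norm (z - 1) * norm (B $ 1)"
    by (simp add: norm_vec_def L2_set_def sum_2 norm_mult power_mult_distrib real_sqrt_mult
        flip: distrib_left)
  also have "norm (B $ 1) = 1"
    using p by (simp add: norm_vec_def L2_set_def sum_2 norm_prod_def)
  finally show ?thesis using Finite_Cartesian_Product.norm_nth_le[of "diag2 z ** B - B" 1] by (simp add: dist_norm)
qed

lemma norm_root_of_unity:
  fixes z :: complex
  assumes "z ^ p = 1" "p > 0" shows "norm z = 1"
proof -
  have "norm z ^ p = 1 ^ p" using assms(1) by (metis norm_one norm_power power_one)
  then show ?thesis by (rule power_eq_imp_eq_base) (use assms(2) in auto)
qed

section \<open>Cayley charts of SU(2)\<close>

text \<open>Differentiating \<open>f (g x) = x\<close> shows that \<open>g\<close> is an immersion;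
  for this \<open>f\<close> has to be differentiable in the ambient space.\<close>

lemma submanifold_chartI:
  fixes f :: "'a::euclidean_space \<Rightarrow> 'e::euclidean_space"
  assumes V: "openin (top_of_set S) V" and U: "open U" "smooth_on g U"
    and f: "\<And>v. v \<in> V \<Longrightarrow> f differentiable at v"
    and inv: "\<And>v. v \<in> V \<Longrightarrow> f v \<in> U \<and> g (f v) = v" "\<And>x. x \<in> U \<Longrightarrow> g x \<in> V \<and> f (g x) = x"
  shows "(V, f) \<in> submanifold_atlas S"
proof -
  have im: "f ` V = U" using inv by force
  have inj: "inj_on f V" using inv by (metis inj_onI)
  have g: "inv_into V f x = g x" if "x \<in> U" for x
    using inv_into_f_f[OF inj, of "g x"] inv(2)[OF that] by simp
  have "homeomorphism V U f g"
    using inv smooth_on_imp_continuous_on[OF U(2)] f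
    by (intro homeomorphismI) (auto intro!: continuous_at_imp_continuous_on differentiable_imp_continuous_within)
  then have hom: "homeomorphism V U f (inv_into V f)"
    by (rule homeomorphism_cong) (simp_all add: g)
  have sm: "smooth_on (inv_into V f) U"
    by (rule smooth_on_cong[OF U(1) _ U(2)]) (simp add: g)
  have "inj (frechet_derivative (inv_into V f) (at x))" if x: "x \<in> U" for x
  proof -
    have d: "(inv_into V f has_derivative frechet_derivative (inv_into V f) (at x)) (at x)"
      by (rule smooth_on_has_derivative[OF sm U(1) x])
    have "f differentiable at (inv_into V f x)" using f inv(2)[OF x] g[OF x] by simp
    then obtain f' where "(f has_derivative f') (at (inv_into V f x))" by (auto simp: differentiable_def)
    from has_derivative_compose[OF d this]
    have "((\<lambda>x. x) has_derivative (\<lambda>v. f' (frechet_derivative (inv_into V f) (at x) v))) (at x)"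
      by (rule has_derivative_transform_within_open[OF _ U(1) x]) (simp add: g inv)
    from has_derivative_unique[OF this has_derivative_ident] show ?thesis
      by (metis injI)
  qed
  then show ?thesis
    unfolding submanifold_atlas_def mem_Collect_eq prod.case im using V U(1) hom sm by blast
qed

text \<open>The Cayley transform, composed with multiplication by \<open>s = 1\<close> or \<open>s = -1\<close>; its two versions
  parametrise the complements of \<open>-1\<close> and \<open>1\<close> in \<open>SU(2)\<close>.\<close>

definition cayley :: "real \<Rightarrow> complex \<times> real \<Rightarrow> complex \<times> complex" where
  "cayley s y = (s / (1 + ((norm (fst y))\<^sup>2 + (snd y)\<^sup>2))) *\<^sub>R
     (of_real (1 - ((norm (fst y))\<^sup>2 + (snd y)\<^sup>2)) + of_real (2 * snd y) * \<i>, 2 * fst y)"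

text \<open>At \<open>cayley s y\<close> the denominator \<open>s + Re\<close> equals
  \<open>2 * s / (1 + n)\<close>, where \<open>n\<close> is the squared norm of \<open>y\<close>;
  this is the common factor of the remaining coordinates.\<close>

definition cayley_inv :: "real \<Rightarrow> complex^2^2 \<Rightarrow> complex \<times> real" where
  "cayley_inv s B = (1 / (s + Re (B $ 1 $ 1))) *\<^sub>R (B $ 2 $ 1, Im (B $ 1 $ 1))"

lemma norm_sq_prod: "(norm p)\<^sup>2 = (norm (fst p))\<^sup>2 + (norm (snd p))\<^sup>2"
  by (simp add: norm_prod_def)

lemma cayley_denom_pos: "1 + ((norm \<zeta>)\<^sup>2 + \<tau>\<^sup>2) > (0::real)"
  by (smt (verit) zero_le_power2)

lemma
  assumes s: "s\<^sup>2 = 1"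
  shows norm_cayley: "norm (cayley s y) = 1"
    and cayley_ne: "s + Re (fst (cayley s y)) \<noteq> 0"
    and cayley_inv_cayley: "cayley_inv s (su2 (cayley s y)) = y"
proof -
  obtain \<zeta> \<tau> where y: "y = (\<zeta>, \<tau>)" by (cases y)
  define n where "n = (norm \<zeta>)\<^sup>2 + \<tau>\<^sup>2"
  have n: "1 + n > 0" unfolding n_def by (rule cayley_denom_pos)
  have c: "cayley s y = (s / (1 + n)) *\<^sub>R (of_real (1 - n) + of_real (2 * \<tau>) * \<i>, 2 * \<zeta>)"
    by (simp add: cayley_def y n_def)
  have "(norm (of_real (1 - n) + of_real (2 * \<tau>) * \<i>, 2 * \<zeta>))\<^sup>2 = (1 - n)\<^sup>2 + (2 * \<tau>)\<^sup>2 + (2 * norm \<zeta>)\<^sup>2"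
    unfolding norm_sq_prod by (simp add: cmod_power2 norm_mult)
  also have "\<dots> = (1 - n)\<^sup>2 + 4 * n" by (simp add: n_def power_mult_distrib)
  also have "\<dots> = (1 + n)\<^sup>2" by (simp add: power2_eq_square algebra_simps)
  finally have N: "norm (of_real (1 - n) + of_real (2 * \<tau>) * \<i>, 2 * \<zeta>) = 1 + n"
    using n by (simp add: power2_eq_iff_nonneg)
  have "\<bar>s\<bar> = 1" using s by (simp add: power2_eq_1_iff) auto
  then show "norm (cayley s y) = 1"
    unfolding c norm_scaleR N using n by simp
  have s0: "s \<noteq> 0" using s by auto
  have "Re (fst (cayley s y)) = s * (1 - n) / (1 + n)" unfolding c by simp
  then have re: "s + Re (fst (cayley s y)) = 2 * s / (1 + n)"
    using n by (simp add: field_simps)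
  then show "s + Re (fst (cayley s y)) \<noteq> 0" using n s0 by simp
  have "Im (fst (cayley s y)) = 2 * s / (1 + n) * \<tau>" "snd (cayley s y) = (2 * s / (1 + n)) *\<^sub>R \<zeta>"
    unfolding c by (simp_all add: scaleR_conv_of_real)
  then show "cayley_inv s (su2 (cayley s y)) = y"
    unfolding cayley_inv_def su2_nth re using n s0 by (simp add: y)
qed

lemma cayley_cayley_inv:
  assumes s: "s\<^sup>2 = 1" and p: "norm p = 1" and ne: "s + Re (fst p) \<noteq> 0"
  shows "cayley s (cayley_inv s (su2 p)) = p"
proof -
  obtain w z where wz: "p = (w, z)" by (cases p)
  define a b where "a = Re w" "b = Im w"
  have sa: "s + a \<noteq> 0" using ne by (simp add: wz a_b_def)
  have s0: "s \<noteq> 0" using s by auto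
  have 1: "a\<^sup>2 + b\<^sup>2 + (norm z)\<^sup>2 = 1"
    using p norm_sq_prod[of p] by (simp add: wz a_b_def cmod_power2)
  define \<tau> where "\<tau> = b / (s + a)"
  define \<zeta> where "\<zeta> = (1 / (s + a)) *\<^sub>R z"
  have y: "cayley_inv s (su2 p) = (\<zeta>, \<tau>)"
    by (simp add: cayley_inv_def wz a_b_def \<tau>_def \<zeta>_def)
  define n where "n = (norm \<zeta>)\<^sup>2 + \<tau>\<^sup>2"
  have "n = ((norm z)\<^sup>2 + b\<^sup>2) / (s + a)\<^sup>2"
    unfolding n_def \<tau>_def \<zeta>_def by (simp add: power_divide add_divide_distrib)
  \<comment> \<open>On the unit sphere the left side is \<open>1 - a\<^sup>2\<close>, and
    \<open>s\<^sup>2 = 1\<close> makes this a difference of squares, which cancels one factor of the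
    denominator.\<close>
  also have "(norm z)\<^sup>2 + b\<^sup>2 = (s - a) * (s + a)" using 1 s by (simp add: power2_eq_square algebra_simps)
  finally have n: "n = (s - a) / (s + a)" using sa by (simp add: power2_eq_square)
  have n1: "1 + n = 2 * s / (s + a)" "1 - n = 2 * a / (s + a)" using sa by (simp_all add: n field_simps)
  have f: "s / (1 + n) = (s + a) / 2" unfolding n1 using s0 by simp
  have "cayley s (\<zeta>, \<tau>) = ((s + a) / 2) *\<^sub>R (of_real (1 - n) + of_real (2 * \<tau>) * \<i>, 2 * \<zeta>)"
    using f by (simp add: cayley_def n_def)
  also have "\<dots> = (w, z)"
    unfolding n1 \<tau>_def \<zeta>_def using sa
    by (auto simp: prod_eq_iff complex_eq_iff a_b_def divide_eq_eq distrib_left distrib_right)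
  finally show ?thesis unfolding y unfolding wz .
qed

lemma smooth_cayley: "smooth_on (cayley s) UNIV"
proof -
  have num: "smooth_on (\<lambda>y::complex \<times> real. (norm (fst y))\<^sup>2 + (snd y)\<^sup>2) UNIV"
    unfolding power2_norm_eq_inner unfolding power2_eq_square
    by (intro smooth_on_add smooth_on_bilinear[OF bounded_bilinear_inner] smooth_on_bilinear[OF bounded_bilinear_mult]
        smooth_on_bounded_linear bounded_linear_fst bounded_linear_snd open_UNIV)
  have den: "smooth_on (\<lambda>y::complex \<times> real. s / (1 + ((norm (fst y))\<^sup>2 + (snd y)\<^sup>2))) UNIV"
  proof (rule smooth_on_divide[OF open_UNIV smooth_on_const smooth_on_add[OF open_UNIV smooth_on_const num]])
    show "1 + ((norm (fst y))\<^sup>2 + (snd y)\<^sup>2) \<noteq> 0" for y :: "complex \<times> real"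
      using cayley_denom_pos[of "fst y" "snd y"] by simp
  qed
  have one: "smooth_on (\<lambda>y::complex \<times> real. 1 + - 1 * ((norm (fst y))\<^sup>2 + (snd y)\<^sup>2)) UNIV"
    by (rule smooth_on_add[OF open_UNIV smooth_on_const
          smooth_on_bilinear[OF bounded_bilinear_mult open_UNIV smooth_on_const num]])
  have "smooth_on (\<lambda>y::complex \<times> real. of_real (1 + - 1 * ((norm (fst y))\<^sup>2 + (snd y)\<^sup>2)) + of_real (2 * snd y) * \<i>) UNIV"
    by (intro smooth_on_add smooth_on_linear_compose[OF bounded_linear_of_real open_UNIV one] open_UNIV
        smooth_on_bounded_linear bounded_linear_mult_const bounded_linear_compose[OF bounded_linear_of_real]
        bounded_linear_const_mult bounded_linear_snd)
  then have fst': "smooth_on (\<lambda>y::complex \<times> real. of_real (1 - ((norm (fst y))\<^sup>2 + (snd y)\<^sup>2)) + of_real (2 * snd y) * \<i>) UNIV"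
    by (rule smooth_on_cong[OF open_UNIV, rotated]) (simp add: algebra_simps)
  show ?thesis
    unfolding cayley_def[abs_def]
    by (intro smooth_on_bilinear[OF bounded_bilinear_scaleR open_UNIV den] smooth_on_Pair[OF open_UNIV fst']
        smooth_on_bounded_linear bounded_linear_const_mult bounded_linear_fst)
qed

lemma smooth_cayley_inv: "smooth_on (cayley_inv s) {B. s + Re (B $ 1 $ 1) \<noteq> 0}"
  and open_cayley_domain: "open {B :: complex^2^2. s + Re (B $ 1 $ 1) \<noteq> 0}"
proof -
  have nth: "bounded_linear (\<lambda>B :: complex^2^2. B $ i $ j)" for i j
    by (rule bounded_linear_compose[OF bounded_linear_vec_nth bounded_linear_vec_nth])
  have re: "bounded_linear (\<lambda>B :: complex^2^2. Re (B $ i $ j))"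
    and im: "bounded_linear (\<lambda>B :: complex^2^2. Im (B $ i $ j))" for i j
    using bounded_linear_compose[OF bounded_linear_Re nth] bounded_linear_compose[OF bounded_linear_Im nth]
    by simp_all
  have "continuous_on UNIV (\<lambda>B :: complex^2^2. s + Re (B $ 1 $ 1))"
    by (intro continuous_intros linear_continuous_on re)
  then show op: "open {B :: complex^2^2. s + Re (B $ 1 $ 1) \<noteq> 0}"
    using open_vimage[of "- {0}" "\<lambda>B :: complex^2^2. s + Re (B $ 1 $ 1)"]
    by (simp add: vimage_def open_Compl)
  show "smooth_on (cayley_inv s) {B. s + Re (B $ 1 $ 1) \<noteq> 0}"
    unfolding cayley_inv_def[abs_def]
    by (intro smooth_on_bilinear[OF bounded_bilinear_scaleR op] smooth_on_divide[OF op] smooth_on_add[OF op]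
        smooth_on_Pair[OF op] smooth_on_const smooth_on_bounded_linear re im nth) simp
qed

lemma SU2_chart_cover:
  fixes x :: "(complex^2^2) \<times> (complex^2)"
  assumes "x \<in> SU \<times> UNIV"
  shows "\<exists>c\<in>(submanifold_atlas (SU \<times> UNIV) :: ((complex^2^2) \<times> (complex^2), real^7) chart set). x \<in> fst c"
proof -
  \<comment> \<open>Three Cayley coordinates and four translation coordinates are repackaged
    linearly as the model space.\<close>
  have "DIM((complex \<times> real) \<times> (complex^2)) = DIM(real^7)" by simp
  from isomorphisms_UNIV_UNIV[OF this]
  obtain J :: "(complex \<times> real) \<times> (complex^2) \<Rightarrow> real^7" and J' where
    J: "linear J" "linear J'" "\<And>x. J' (J x) = x" "\<And>y. J (J' y) = y" by metis
  have bJ: "bounded_linear J" "bounded_linear J'" using J by (auto simp: linear_conv_bounded_linear)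
  obtain w where x: "norm w = 1" "fst x = su2 w" using assms SU2_iff by (metis mem_Times_iff)
  \<comment> \<open>The version \<open>s = 1\<close> misses only the points with
    \<open>Re (fst w) = -1\<close>; at those, \<open>s = -1\<close> gives the denominator
    -2.\<close>
  define s :: real where "s = (if Re (fst w) = -1 then -1 else 1)"
  have s: "s\<^sup>2 = 1" and sx: "s + Re (fst w) \<noteq> 0" by (auto simp: s_def)
  define O' where "O' = {B :: complex^2^2. s + Re (B $ 1 $ 1) \<noteq> 0} \<times> (UNIV :: (complex^2) set)"
  define V where "V = SU \<times> UNIV \<inter> O'"
  define f where "f = (\<lambda>p :: (complex^2^2) \<times> (complex^2). J (cayley_inv s (fst p), snd p))"
  define g where "g = (\<lambda>y. (su2 (cayley s (fst (J' y))), snd (J' y)))"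
  have O': "open O'" unfolding O'_def by (intro open_Times open_cayley_domain open_UNIV)
  have bsu2: "bounded_linear su2" using linear_su2 by (simp add: linear_conv_bounded_linear)
  have "(V, f) \<in> submanifold_atlas (SU \<times> UNIV)"
  proof (rule submanifold_chartI[OF _ open_UNIV])
    show "openin (top_of_set (SU \<times> UNIV)) V" unfolding V_def using O' by (rule openin_open_Int)
    show "smooth_on g UNIV"
      unfolding g_def
    proof (rule smooth_on_Pair[OF open_UNIV])
      have "smooth_on (\<lambda>y. cayley s (fst (J' y))) UNIV"
        by (rule smooth_on_compose[OF open_UNIV open_UNIV _ smooth_cayley])
          (auto intro!: smooth_on_bounded_linear bounded_linear_compose[OF bounded_linear_fst] bJ)
      then show "smooth_on (\<lambda>y. su2 (cayley s (fst (J' y)))) UNIV"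
        by (rule smooth_on_linear_compose[OF bsu2 open_UNIV])
      show "smooth_on (\<lambda>y. snd (J' y)) UNIV"
        by (intro smooth_on_bounded_linear bounded_linear_compose[OF bounded_linear_snd] bJ)
    qed
    have "smooth_on (\<lambda>p. cayley_inv s (fst p)) O'"
      by (rule smooth_on_compose[OF O' open_cayley_domain _ smooth_cayley_inv smooth_on_bounded_linear[OF bounded_linear_fst]])
        (auto simp: O'_def)
    then have "smooth_on f O'"
      unfolding f_def
      by (intro smooth_on_linear_compose[OF bJ(1) O'] smooth_on_Pair[OF O'] smooth_on_bounded_linear[OF bounded_linear_snd])
    then show "f differentiable at v" if "v \<in> V" for v
      using O' that by (intro smooth_on_differentiable_at) (auto simp: V_def)
    show "f v \<in> UNIV \<and> g (f v) = v" if v: "v \<in> V" for v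
    proof -
      obtain p where p: "norm p = 1" "fst v = su2 p" using v SU2_iff by (auto simp: V_def)
      moreover have "s + Re (fst p) \<noteq> 0" using v p(2) by (auto simp: V_def O'_def)
      ultimately have "su2 (cayley s (cayley_inv s (fst v))) = fst v"
        using cayley_cayley_inv[OF s p(1)] by simp
      then show ?thesis by (simp add: f_def g_def J)
    qed
    show "g y \<in> V \<and> f (g y) = y" if "y \<in> UNIV" for y
    proof
      have "su2 (cayley s (fst (J' y))) \<in> SU" using norm_cayley[OF s] SU2_iff by blast
      then show "g y \<in> V" using cayley_ne[OF s] by (simp add: g_def V_def O'_def)
      show "f (g y) = y" by (simp add: f_def g_def cayley_inv_cayley[OF s] J)
    qed
  qed
  moreover have "x \<in> V" using assms sx x by (simp add: V_def O'_def mem_Times_iff)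
  ultimately show ?thesis by force
qed

section \<open>The developing map\<close>

text \<open>Left translation by \<open>(k, r)\<close> in \<open>G\<close>, extended to an affine map
  of the ambient space.\<close>

definition act :: "complex^2^2 \<Rightarrow> complex^2 \<Rightarrow> (complex^2^2) \<times> (complex^2) \<Rightarrow> (complex^2^2) \<times> (complex^2)" where
  "act k r x = (k ** fst x, k *v snd x + r)"

lemma act_comp: "act k r \<circ> act k' r' = act (k ** k') (k *v r' + r)"
  by (auto simp: act_def fun_eq_iff matrix_mul_assoc matrix_vector_mul_assoc matrix_vector_right_distrib)

lemma act_id: "act (mat 1) 0 = id"
  by (auto simp: act_def fun_eq_iff)

lemma smooth_act: "smooth_on (act k r) UNIV"
proof -
  have "linear (\<lambda>B::complex^2^2. k ** B)" "linear (\<lambda>q. k *v q)"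
    by (auto intro!: linearI
        simp: vec_eq_iff forall_2 matrix_matrix_mult_def matrix_vector_mult_def sum_2 algebra_simps)
  then have "bounded_linear (\<lambda>B::complex^2^2. k ** B)" "bounded_linear (\<lambda>q. k *v q)"
    by (simp_all add: linear_conv_bounded_linear)
  then show ?thesis
    unfolding act_def[abs_def]
    by (intro smooth_on_Pair smooth_on_add smooth_on_const open_UNIV smooth_on_bounded_linear
        bounded_linear_compose[OF _ bounded_linear_fst] bounded_linear_compose[OF _ bounded_linear_snd])
qed

lemma dist_act: "norm z = 1 \<Longrightarrow> dist (act (diag2 z) r x) (act (diag2 z) r y) = dist x y"
proof -
  assume z: "norm z = 1"
  have "diag2 z ** fst x - diag2 z ** fst y = diag2 z ** (fst x - fst y)"
    "diag2 z *v snd x + r - (diag2 z *v snd y + r) = diag2 z *v (snd x - snd y)"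
    by (simp_all add: vec_eq_iff forall_2 matrix_matrix_mult_def matrix_vector_mult_def sum_2 algebra_simps)
  then show ?thesis
    by (simp add: act_def dist_prod_def dist_norm norm_diag2_mult[OF z] norm_diag2_apply[OF z])
qed

text \<open>Two copies of \<open>diag2 z\<close>: coordinates 1, 2 carry the scaled first column and
  3, 4 the translation part. The entries \<open>z\<close> and \<open>cnj z\<close> pair off, so the
  determinant is 1 for unit \<open>z\<close>.\<close>

definition rotation4 :: "complex \<Rightarrow> complex^4 \<Rightarrow> complex^4" where
  "rotation4 z v = (\<chi> i. (if i = 1 \<or> i = 3 then z else cnj z) * v $ i)"

definition diag4 :: "complex \<Rightarrow> complex^4^4" where
  "diag4 z = (\<chi> i j. if i = j then (if i = 1 \<or> i = 3 then z else cnj z) else 0)"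

lemma diag4_apply: "diag4 z *v v = rotation4 z v"
  by (simp add: vec_eq_iff diag4_def rotation4_def matrix_vector_mult_def if_distrib[of "\<lambda>x. x * _"] cong: if_cong)

lemma diag4_in_SU:
  assumes "norm z = 1" shows "diag4 z \<in> SU"
proof -
  have z: "z * cnj z = 1" using assms complex_norm_square[of z] by simp
  have "det (diag4 z) = (\<Prod>i\<in>UNIV. diag4 z $ i $ i)"
    by (rule det_diagonal) (simp add: diag4_def)
  also have "\<dots> = z * (cnj z * (z * cnj z))" unfolding UNIV_4 by (simp add: diag4_def)
  also have "\<dots> = 1" unfolding z by (simp add: z)
  finally have "det (diag4 z) = 1" .
  moreover have "diag4 z ** map_matrix cnj (transpose (diag4 z)) = mat 1"
    using z by (simp add: vec_eq_iff forall_4 diag4_def matrix_matrix_mult_def sum_4 map_matrix_def transpose_def mat_def mult.commute)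
  ultimately show ?thesis by (simp add: SU_def)
qed

lemma linear_rotation4: "linear (rotation4 z)"
  by (rule linearI) (simp_all add: vec_eq_iff rotation4_def algebra_simps)

lemma rotation4_inner:
  assumes "norm z = 1" shows "rotation4 z v \<bullet> rotation4 z w = v \<bullet> w"
proof -
  have "(u * a) \<bullet> (u * b) = (norm u)\<^sup>2 * (a \<bullet> b)" for u a b :: complex
    unfolding inner_complex_def cmod_power2 by (simp add: power2_eq_square algebra_simps)
  then show ?thesis using assms by (auto simp: inner_vec_def rotation4_def intro!: sum.cong)
qed

lemma rotation4_1: "rotation4 1 = id"
  by (auto simp: rotation4_def fun_eq_iff vec_eq_iff)

lemma rotation4_comp: "rotation4 z \<circ> rotation4 z' = rotation4 (z * z')"
  by (auto simp: rotation4_def fun_eq_iff vec_eq_iff)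

definition col4 :: "complex^2^2 \<Rightarrow> complex^4" where
  "col4 B = (\<chi> i. if i = 1 then B $ 1 $ 1 else if i = 2 then B $ 2 $ 1 else 0)"

definition tail4 :: "complex^2 \<Rightarrow> complex^4" where
  "tail4 q = (\<chi> i. if i = 3 then q $ 1 else if i = 4 then q $ 2 else 0)"

text \<open>Polar coordinates on the first factor of \<open>\<complex>\<^sup>2 \<times> \<complex>\<^sup>2\<close>: the unit vector in \<open>\<complex>\<^sup>2\<close> is the
  first column of the matrix.\<close>

definition polar :: "((complex^2^2) \<times> (complex^2)) \<times> real \<Rightarrow> complex^4" where
  "polar x = snd x *\<^sub>R col4 (fst (fst x)) + tail4 (snd (fst x))"

lemma bounded_linear_col4: "bounded_linear col4" and bounded_linear_tail4: "bounded_linear tail4"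
  unfolding linear_conv_bounded_linear[symmetric]
  by (auto intro!: linearI simp: vec_eq_iff col4_def tail4_def)

lemma smooth_polar: "smooth_on polar UNIV"
  unfolding polar_def[abs_def]
  by (intro smooth_on_add smooth_on_bilinear[OF bounded_bilinear_scaleR] open_UNIV smooth_on_bounded_linear
      bounded_linear_snd bounded_linear_compose[OF bounded_linear_col4]
      bounded_linear_compose[OF bounded_linear_tail4] bounded_linear_compose[OF bounded_linear_fst]
      bounded_linear_compose[OF bounded_linear_snd] bounded_linear_fst)

text \<open>Left multiplication acts on the first column by the matrix itself and commutes with
  scaling by \<open>t\<close>; translations of \<open>q\<close> stay translations.\<close>

lemma polar_act: "polar (act (diag2 z) r x, t) = rotation4 z (polar (x, t)) + tail4 r"
  by (simp add: polar_def act_def vec_eq_iff forall_4 rotation4_def col4_def tail4_def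
      matrix_matrix_mult_def matrix_vector_mult_def sum_2 algebra_simps)

lemma col4_tail4_eq_0: "col4 B + tail4 q = 0 \<Longrightarrow> col4 B = 0 \<and> tail4 q = 0 \<and> q = 0"
  by (simp add: vec_eq_iff forall_4 forall_2 col4_def tail4_def)

lemma col4_SU: "B \<in> SU \<Longrightarrow> col4 B \<bullet> col4 B = 1"
proof -
  assume "B \<in> SU"
  then obtain p where p: "norm p = 1" "B = su2 p" using SU2_iff by blast
  have "col4 B \<bullet> col4 B = (norm p)\<^sup>2"
    by (simp add: p(2) inner_vec_def sum_4 col4_def norm_prod_def power2_norm_eq_inner)
  then show ?thesis using p(1) by simp
qed

lemma su2_col4: "B \<in> SU \<Longrightarrow> su2 (col4 B $ 1, col4 B $ 2) = B"
  using SU2_iff[of B] by (auto simp: col4_def)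

text \<open>Since \<open>|A e\<^sub>1| = 1\<close> on \<open>SU(2)\<close>, tangent vectors of \<open>SU(2)\<close> move \<open>A e\<^sub>1\<close> orthogonally to itself,
  and they are determined by that motion.\<close>

lemma bij_polar_derivative:
  fixes \<phi> :: "(complex^2^2) \<times> (complex^2) \<Rightarrow> real^7"
  assumes c: "(V, \<phi>) \<in> submanifold_atlas (SU \<times> UNIV)" and z: "z \<in> \<phi> ` V" and t: "t > 0"
  shows "bij (frechet_derivative (\<lambda>(z, t). polar (inv_into V \<phi> z, t)) (at (z, t)))"
proof -
  note C = submanifold_atlasD[OF c]
  define \<Phi> where "\<Phi> = inv_into V \<phi>"
  define D where "D = frechet_derivative \<Phi> (at z)"
  have d\<Phi>: "(\<Phi> has_derivative D) (at z)"
    unfolding D_def \<Phi>_def by (rule smooth_on_has_derivative[OF C(4,2) z])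
  have injD: "inj D" unfolding D_def \<Phi>_def by (rule C(5)[OF z])
  have linD: "linear D" by (rule has_derivative_linear[OF d\<Phi>])
  have SU: "fst (\<Phi> y) \<in> SU" if "y \<in> \<phi> ` V" for y
    using C(6) that inv_into_into[OF that] unfolding \<Phi>_def by (auto simp: mem_Times_iff)
  have dcol: "((\<lambda>y. col4 (fst (\<Phi> y))) has_derivative (\<lambda>v. col4 (fst (D v)))) (at z)"
    by (rule bounded_linear.has_derivative[OF bounded_linear_compose[OF bounded_linear_col4 bounded_linear_fst] d\<Phi>])
  define L where "L = (\<lambda>(z, t). polar (\<Phi> z, t))"
  define L' where "L' = (\<lambda>(v, s). t *\<^sub>R col4 (fst (D v)) + s *\<^sub>R col4 (fst (\<Phi> z)) + tail4 (snd (D v)))"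
  have "(L has_derivative L') (at (z, t))"
  proof -
    have f: "(fst has_derivative fst) (at (z, t))" and s: "(snd has_derivative snd) (at (z, t))"
      by (auto intro!: derivative_eq_intros)
    have 1: "((\<lambda>p. col4 (fst (\<Phi> (fst p)))) has_derivative (\<lambda>v. col4 (fst (D (fst v))))) (at (z, t))"
      by (rule has_derivative_compose[OF f]) (simp add: dcol)
    have 2: "((\<lambda>p. tail4 (snd (\<Phi> (fst p)))) has_derivative (\<lambda>v. tail4 (snd (D (fst v))))) (at (z, t))"
      by (rule bounded_linear.has_derivative[OF bounded_linear_compose[OF bounded_linear_tail4 bounded_linear_snd]
            has_derivative_compose[OF f]]) (simp add: d\<Phi>)
    show ?thesis
      using has_derivative_add[OF has_derivative_scaleR[OF s 1] 2]
      by (simp add: L_def L'_def polar_def case_prod_unfold)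
  qed
  then have L': "frechet_derivative L (at (z, t)) = L'" and linL': "linear L'"
    using frechet_derivative_at has_derivative_linear by metis+
  have orth: "col4 (fst (D v)) \<bullet> col4 (fst (\<Phi> z)) = 0" for v
  proof -
    have "((\<lambda>y. col4 (fst (\<Phi> y)) \<bullet> col4 (fst (\<Phi> y))) has_derivative
        (\<lambda>v. col4 (fst (\<Phi> z)) \<bullet> col4 (fst (D v)) + col4 (fst (D v)) \<bullet> col4 (fst (\<Phi> z)))) (at z)"
      by (rule has_derivative_inner[OF dcol dcol])
    moreover have "((\<lambda>y. col4 (fst (\<Phi> y)) \<bullet> col4 (fst (\<Phi> y))) has_derivative (\<lambda>v. 0)) (at z)"
      by (rule has_derivative_transform_within_open[OF has_derivative_const C(2) z]) (simp add: col4_SU SU)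
    ultimately have "(\<lambda>v. col4 (fst (\<Phi> z)) \<bullet> col4 (fst (D v)) + col4 (fst (D v)) \<bullet> col4 (fst (\<Phi> z))) = (\<lambda>v. 0)"
      by (rule has_derivative_unique)
    from fun_cong[OF this, of v] show ?thesis by (simp add: inner_commute)
  qed
  \<comment> \<open>On SU(2) the matrix is a fixed linear function of its first column, and
    differentiating this identity gives the same relation for tangent vectors.\<close>
  have det: "fst (D v) = 0" if "col4 (fst (D v)) = 0" for v
  proof -
    have bl: "bounded_linear (\<lambda>u :: complex^4. su2 (u $ 1, u $ 2))"
      using linear_su2 bounded_linear_compose[of su2 "\<lambda>u :: complex^4. (u $ 1, u $ 2)"]
      by (simp add: linear_conv_bounded_linear bounded_linear_Pair bounded_linear_vec_nth)
    have "((\<lambda>y. su2 (col4 (fst (\<Phi> y)) $ 1, col4 (fst (\<Phi> y)) $ 2)) has_derivative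
        (\<lambda>v. su2 (col4 (fst (D v)) $ 1, col4 (fst (D v)) $ 2))) (at z)"
      by (rule bounded_linear.has_derivative[OF bl dcol])
    then have "((\<lambda>y. fst (\<Phi> y)) has_derivative (\<lambda>v. su2 (col4 (fst (D v)) $ 1, col4 (fst (D v)) $ 2))) (at z)"
      by (rule has_derivative_transform_within_open[OF _ C(2) z]) (simp add: su2_col4 SU)
    moreover have "((\<lambda>y. fst (\<Phi> y)) has_derivative (\<lambda>v. fst (D v))) (at z)"
      by (rule has_derivative_fst[OF d\<Phi>])
    ultimately have "(\<lambda>v. fst (D v)) = (\<lambda>v. su2 (col4 (fst (D v)) $ 1, col4 (fst (D v)) $ 2))"
      using has_derivative_unique by blast
    from fun_cong[OF this, of v] that show ?thesis using linear_0[OF linear_su2] by (simp add: zero_prod_def)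
  qed
  have "x = 0" if "L' x = 0" for x
  proof -
    obtain v s where x: "x = (v, s)" by (cases x)
    interpret col4: bounded_linear col4 by (rule bounded_linear_col4)
    have "col4 (t *\<^sub>R fst (D v) + s *\<^sub>R fst (\<Phi> z)) + tail4 (snd (D v)) = 0"
      using that by (simp add: x L'_def col4.add col4.scaleR)
    from col4_tail4_eq_0[OF this] have 1: "t *\<^sub>R col4 (fst (D v)) + s *\<^sub>R col4 (fst (\<Phi> z)) = 0" and 2: "snd (D v) = 0"
      by (simp_all add: col4.add col4.scaleR)
    \<comment> \<open>Pairing with the unit radial vector isolates the radial component
      \<open>s\<close>; the tangential part then vanishes because \<open>t > 0\<close>.\<close>
    have "(t *\<^sub>R col4 (fst (D v)) + s *\<^sub>R col4 (fst (\<Phi> z))) \<bullet> col4 (fst (\<Phi> z)) = s"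
      by (simp add: inner_add_left orth col4_SU SU z)
    then have s: "s = 0" using 1 by simp
    then have "col4 (fst (D v)) = 0" using 1 t by simp
    then have "D v = 0" using det 2 by (simp add: prod_eq_iff)
    then have "v = 0" using injD linear_0[OF linD] by (metis injD inj_eq)
    then show "x = 0" by (simp add: x s zero_prod_def)
  qed
  then have injL': "inj L'" using linear_injective_0[OF linL'] by blast
  \<comment> \<open>Both spaces have real dimension 8. Composing with an isomorphism gives an
    endomorphism, for which injectivity implies surjectivity.\<close>
  have "DIM(complex^4) = DIM((real^7) \<times> real)" by simp
  from isomorphisms_UNIV_UNIV[OF this]
  obtain f :: "complex^4 \<Rightarrow> (real^7) \<times> real" and g where
    fg: "linear f" "\<And>x. g (f x) = x" "\<And>y. f (g y) = y" by metis
  have "inj (f \<circ> L')" using injL' fg(2) by (metis inj_compose inj_on_inverseI)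
  then have "surj (f \<circ> L')" using linear_injective_imp_surjective linear_compose[OF linL' fg(1)] by blast
  then have "surj L'" unfolding surj_def comp_def using fg(2) by metis
  then show ?thesis using injL' L' by (simp add: bij_def L_def \<Phi>_def)
qed

lemma integer_vector_norm: "(\<And>i. x $ i \<in> \<int>) \<Longrightarrow> x \<noteq> 0 \<Longrightarrow> norm x \<ge> 1" for x :: "real^'n"
proof -
  assume x: "\<And>i. x $ i \<in> \<int>" "x \<noteq> 0"
  then obtain i where i: "x $ i \<noteq> 0" by (auto simp: vec_eq_iff)
  then have "1 \<le> \<bar>x $ i\<bar>" using x(1) by (rule Ints_nonzero_abs_ge1[rotated])
  also have "\<dots> \<le> norm x" by (rule component_le_norm_cart)
  finally show ?thesis .
qed

section \<open>The quotient\<close>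

text \<open>Supplies the inverse generators in \<open>generate\<close>. Uniqueness follows by
  multiplying \<open>y ** diag2 z = mat 1\<close> on the right by
  \<open>diag2 (cnj z)\<close>.\<close>

lemma inv_SU_group_diag2:
  assumes z: "norm z = 1" shows "inv\<^bsub>SU_group\<^esub> (diag2 z) = diag2 (cnj z)"
proof -
  have c: "z * cnj z = 1" "cnj z * z = 1" using z complex_norm_square[of z] by (simp_all add: mult.commute)
  have 1: "diag2 z ** diag2 (cnj z) = mat 1" "diag2 (cnj z) ** diag2 z = mat 1"
    by (simp_all add: diag2_mult c diag2_1)
  show ?thesis
    unfolding m_inv_def
  proof (rule the_equality)
    show "diag2 (cnj z) \<in> carrier SU_group \<and> diag2 z \<otimes>\<^bsub>SU_group\<^esub> diag2 (cnj z) = \<one>\<^bsub>SU_group\<^esub> \<and>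
        diag2 (cnj z) \<otimes>\<^bsub>SU_group\<^esub> diag2 z = \<one>\<^bsub>SU_group\<^esub>"
      using 1 diag2_in_SU z by (simp add: SU_group_def)
    fix y assume "y \<in> carrier SU_group \<and> diag2 z \<otimes>\<^bsub>SU_group\<^esub> y = \<one>\<^bsub>SU_group\<^esub> \<and>
        y \<otimes>\<^bsub>SU_group\<^esub> diag2 z = \<one>\<^bsub>SU_group\<^esub>"
    then have "y ** diag2 z = mat 1" by (simp add: SU_group_def)
    then have "y ** diag2 z ** diag2 (cnj z) = diag2 (cnj z)" by simp
    then show "y = diag2 (cnj z)" by (simp add: matrix_mul_assoc[symmetric] 1)
  qed
qed

text \<open>The lattice condition is carried as an equality of sets: an inclusion would not pass to
  the inverse generator.\<close>

lemma generate_diag2_cases: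
  assumes z: "z ^ p = 1" "p > 0" and \<Lambda>: "(\<lambda>q. diag2 z *v q) ` \<Lambda> = \<Lambda>"
    and k: "k \<in> generate SU_group {diag2 z}"
  shows "\<exists>u. k = diag2 u \<and> u ^ p = 1 \<and> (\<lambda>q. diag2 u *v q) ` \<Lambda> = \<Lambda>"
  using k
proof (induction rule: generate.induct)
  case one
  then show ?case by (intro exI[of _ 1]) (simp add: SU_group_def diag2_1)
next
  case (incl h)
  then show ?case using z \<Lambda> by auto
next
  case (inv h)
  have n: "norm z = 1" by (rule norm_root_of_unity[OF z])
  have c: "cnj z * z = 1" using n complex_norm_square[of z] by (simp add: mult.commute)
  have "(\<lambda>q. diag2 (cnj z) *v q) ` \<Lambda> = (\<lambda>q. diag2 (cnj z) *v q) ` (\<lambda>q. diag2 z *v q) ` \<Lambda>" by (simp add: \<Lambda>)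
  also have "\<dots> = \<Lambda>" by (simp add: image_image matrix_vector_mul_assoc diag2_mult c diag2_1)
  finally have "(\<lambda>q. diag2 (cnj z) *v q) ` \<Lambda> = \<Lambda>" .
  moreover have "cnj z ^ p = 1" using z(1) by (metis complex_cnj_one complex_cnj_power)
  ultimately show ?case using inv inv_SU_group_diag2[OF n] by auto
next
  case (eng h1 h2)
  then obtain u v where u: "h1 = diag2 u" "u ^ p = 1" "(\<lambda>q. diag2 u *v q) ` \<Lambda> = \<Lambda>"
    and v: "h2 = diag2 v" "v ^ p = 1" "(\<lambda>q. diag2 v *v q) ` \<Lambda> = \<Lambda>" by blast
  have "(\<lambda>q. diag2 (u * v) *v q) ` \<Lambda> = (\<lambda>q. diag2 u *v q) ` (\<lambda>q. diag2 v *v q) ` \<Lambda>"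
    by (simp add: image_image matrix_vector_mul_assoc diag2_mult)
  then have "(\<lambda>q. diag2 (u * v) *v q) ` \<Lambda> = \<Lambda>" by (simp add: u v)
  then show ?case using u v by (intro exI[of _ "u * v"]) (simp add: SU_group_def diag2_mult power_mult_distrib)
qed

text \<open>For \<open>k = diag2 u\<close> with \<open>u ^ p = 1\<close> the inverse is the power
  with exponent \<open>p - 1\<close>, which repeated products keep in the generated set.\<close>

lemma generate_diag2_inverse:
  assumes "z ^ p = 1" "p > 0" "(\<lambda>q. diag2 z *v q) ` \<Lambda> = \<Lambda>" and k: "k \<in> generate SU_group {diag2 z}"
  shows "\<exists>k'\<in>generate SU_group {diag2 z}. k' ** k = mat 1 \<and> k ** k' = mat 1"
proof -
  obtain u where u: "k = diag2 u" "u ^ p = 1" using generate_diag2_cases[OF assms] by blast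
  have pow: "diag2 (u ^ n) \<in> generate SU_group {diag2 z}" for n
  proof (induction n)
    case 0
    then show ?case using generate.one[of SU_group "{diag2 z}"] by (simp add: SU_group_def diag2_1)
  next
    case (Suc n)
    then show ?case
      using generate.eng[OF k[unfolded u(1)] Suc] by (simp add: SU_group_def diag2_mult)
  qed
  have "u * u ^ (p - 1) = 1" using u(2) \<open>p > 0\<close> by (metis power_minus_mult mult.commute)
  then show ?thesis
    using pow[of "p - 1"] by (intro bexI[of _ "diag2 (u ^ (p - 1))"])
      (simp_all add: u(1) diag2_mult mult.commute diag2_1)
qed

theorem theorem4p1:
  fixes p :: nat and \<beta> :: real and \<phi> :: "real^4 \<Rightarrow> complex^2"
  assumes "prime p"
    and "cis \<beta> ^ p = 1" and "\<forall>k. 0 < k \<and> k < p \<longrightarrow> cis \<beta> ^ k \<noteq> 1"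
    and "linear \<phi>" and "bij \<phi>"
    and "(\<lambda>q. A_mat \<beta> *v q) ` Z4_lattice \<phi> = Z4_lattice \<phi>"
  shows "smooth_manifold (M_top \<phi> \<beta>) (M_atlas \<phi> \<beta>) \<and> compact_space (M_top \<phi> \<beta>) \<and>
    (\<exists>b c g. b < c \<and>
       (let X = times_interval_topology (M_top \<phi> \<beta>) b c;
            \<A> = times_interval_atlas (M_atlas \<phi> \<beta>) b c
        in riemannian_metric \<A> g \<and>
           (\<forall>k\<in>\<A>. \<forall>x\<in>fst k.
              discrete (holonomy_group X \<A> g k x) \<and>
              (\<exists>\<iota> :: (real^7) \<times> real \<Rightarrow> complex^4.
                 linear \<iota> \<and> bij \<iota> \<and> (\<forall>v w. g k (snd k x) v w = \<iota> v \<bullet> \<iota> w) \<and>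
                 (\<forall>h\<in>holonomy_group X \<A> g k x. \<exists>A\<in>SU. \<forall>v. \<iota> (blinfun_apply h v) = A *v \<iota> v)))))"
proof -
  define \<Lambda> where "\<Lambda> = Z4_lattice \<phi>"
  define K where "K = generate SU_group {A_mat \<beta>}"
  define T where "T = {act k r | k r. k \<in> K \<and> r \<in> \<Lambda>}"
  have p: "p > 0" using assms(1) prime_gt_0_nat by blast
  have A: "A_mat \<beta> = diag2 (cis \<beta>)" by (simp add: A_mat_def diag2_def cis_cnj)
  note inv\<Lambda> = assms(6)[unfolded A, folded \<Lambda>_def]
  have K: "\<exists>u. k = diag2 u \<and> u ^ p = 1 \<and> (\<lambda>q. diag2 u *v q) ` \<Lambda> = \<Lambda>" if "k \<in> K" for k
    using generate_diag2_cases[OF assms(2) p inv\<Lambda>] that unfolding K_def A by blast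
  have Kinv: "\<exists>k'\<in>K. k' ** k = mat 1 \<and> k ** k' = mat 1" if "k \<in> K" for k
    using generate_diag2_inverse[OF assms(2) p inv\<Lambda>] that unfolding K_def A by blast
  have Kone: "mat 1 \<in> K"
    using generate.one[of SU_group "{A_mat \<beta>}"] unfolding K_def by (simp add: SU_group_def)
  have Kmult: "k ** k' \<in> K" if "k \<in> K" "k' \<in> K" for k k'
    using generate.eng[OF that[unfolded K_def]] unfolding K_def by (simp add: SU_group_def)
  have K\<Lambda>: "k *v r \<in> \<Lambda>" if "k \<in> K" "r \<in> \<Lambda>" for k r using K[OF that(1)] that(2) by blast
  have \<Lambda>0: "0 \<in> \<Lambda>"
    unfolding \<Lambda>_def Z4_lattice_def using linear_0[OF assms(4)] by (intro image_eqI[of _ _ 0]) auto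
  have \<Lambda>add: "r + r' \<in> \<Lambda>" if rr: "r \<in> \<Lambda>" "r' \<in> \<Lambda>" for r r'
  proof -
    obtain x y where "r = \<phi> x" "\<forall>i. x $ i \<in> \<int>" "r' = \<phi> y" "\<forall>i. y $ i \<in> \<int>"
      using rr by (auto simp: \<Lambda>_def Z4_lattice_def)
    then show ?thesis
      unfolding \<Lambda>_def Z4_lattice_def using linear_add[OF assms(4)] by (intro image_eqI[of _ _ "x + y"]) auto
  qed
  have \<Lambda>neg: "- r \<in> \<Lambda>" if r: "r \<in> \<Lambda>" for r
  proof -
    obtain x where "r = \<phi> x" "\<forall>i. x $ i \<in> \<int>" using r by (auto simp: \<Lambda>_def Z4_lattice_def)
    then show ?thesis
      unfolding \<Lambda>_def Z4_lattice_def using linear_neg[OF assms(4)] by (intro image_eqI[of _ _ "- x"]) auto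
  qed
  have Tcases: "\<exists>u r. f = act (diag2 u) r \<and> diag2 u \<in> K \<and> u ^ p = 1 \<and> norm u = 1 \<and> r \<in> \<Lambda>" if "f \<in> T" for f
    using that K norm_root_of_unity[OF _ p] unfolding T_def by blast
  have Tid: "id \<in> T"
    unfolding T_def using Kone \<Lambda>0 act_id[symmetric] by blast
  have Tcomp: "f \<circ> g \<in> T" if fg: "f \<in> T" "g \<in> T" for f g
  proof -
    obtain k r k' r' where "f = act k r" "g = act k' r'" "k \<in> K" "k' \<in> K" "r \<in> \<Lambda>" "r' \<in> \<Lambda>"
      using fg by (auto simp: T_def)
    then show ?thesis unfolding T_def using act_comp Kmult \<Lambda>add K\<Lambda> by blast
  qed
  have Tinv: "\<exists>g\<in>T. g \<circ> f = id \<and> f \<circ> g = id" if fT: "f \<in> T" for f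
  proof -
    obtain k r where f: "f = act k r" "k \<in> K" "r \<in> \<Lambda>" using fT by (auto simp: T_def)
    obtain k' where k': "k' \<in> K" "k' ** k = mat 1" "k ** k' = mat 1" using Kinv[OF f(2)] by blast
    \<comment> \<open>The inverse of \<open>(k, r)\<close> in the semidirect product is
      \<open>(k', - k' r)\<close>.\<close>
    have "k *v (- (k' *v r)) + r = 0"
      using k'(3) by (metis add.left_inverse matrix_vector_mul_assoc matrix_vector_mul_lid vec.neg)
    then have "act k' (- (k' *v r)) \<circ> f = id" "f \<circ> act k' (- (k' *v r)) = id"
      unfolding f(1) act_comp k' by (simp_all add: act_id)
    moreover have "act k' (- (k' *v r)) \<in> T" unfolding T_def using k'(1) \<Lambda>neg K\<Lambda> f(3) by blast
    ultimately show ?thesis by blast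
  qed
  have T_image: "T = (\<lambda>h. act (fst h) (snd h)) ` (K \<times> \<Lambda>)"
    unfolding T_def image_def by (simp only: set_eq_iff mem_Collect_eq Bex_def mem_Times_iff) (metis fst_conv snd_conv)
  have orbit: "orbit \<phi> \<beta> x = (\<lambda>f. f x) ` T" for x
    unfolding orbit_def r_coset_def Gam_def G_def T_image image_image K_def[symmetric] \<Lambda>_def[symmetric]
    by (simp add: act_def case_prod_unfold UNION_singleton_eq_range)
  \<comment> \<open>\<open>\<delta>1\<close> is a gap between 1 and the other \<open>p\<close>-th
    roots of unity. \<open>\<delta>2\<close> bounds \<open>\<phi>\<close> below, hence bounds below
    the nonzero lattice vectors, as nonzero integer vectors have norm at least 1.\<close>
  have "finite {z :: complex. z ^ p = 1}" using p by (intro finite_roots_unity) simp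
  from finite_set_avoid[OF this, of 1] obtain \<delta>1 where
    \<delta>1: "\<delta>1 > 0" "\<And>z :: complex. z ^ p = 1 \<Longrightarrow> z \<noteq> 1 \<Longrightarrow> \<delta>1 \<le> dist 1 z" by blast
  obtain \<delta>2 where \<delta>2: "\<delta>2 > 0" "\<And>x. \<delta>2 * norm x \<le> norm (\<phi> x)"
    using linear_inj_bounded_below_pos[OF assms(4) bij_is_inj[OF assms(5)]] by blast
  have \<Lambda>norm: "\<delta>2 \<le> norm r" if r: "r \<in> \<Lambda>" "r \<noteq> 0" for r
  proof -
    obtain x where x: "r = \<phi> x" "\<And>i. x $ i \<in> \<int>" using r(1) by (auto simp: \<Lambda>_def Z4_lattice_def)
    have "x \<noteq> 0" using r(2) x(1) linear_0[OF assms(4)] by auto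
    then have "1 \<le> norm x" using integer_vector_norm x(2) by blast
    then have "\<delta>2 * 1 \<le> \<delta>2 * norm x" using \<delta>2(1) by (intro mult_left_mono) auto
    then show ?thesis using \<delta>2(2)[of x] x(1) by simp
  qed
  define \<delta> where "\<delta> = min \<delta>1 \<delta>2"
  \<comment> \<open>The matrix component forces \<open>u = 1\<close>; what remains of
    \<open>f\<close> is a translation, so its displacement is \<open>r\<close> and the lattice gap
    applies.\<close>
  have sep: "f = id" if f: "f \<in> T" and x: "x \<in> SU \<times> UNIV" and d: "dist (f x) x < \<delta>" for f x
  proof -
    obtain u r where u: "f = act (diag2 u) r" "u ^ p = 1" "r \<in> \<Lambda>" using Tcases[OF f] by blast
    have "norm (u - 1) \<le> dist (diag2 u ** fst x) (fst x)" using x by (intro dist_diag2_mult_self) auto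
    also have "\<dots> \<le> dist (f x) x" using dist_fst_le[of "f x" x] by (simp add: u(1) act_def)
    finally have "dist 1 u < \<delta>1" using d by (simp add: \<delta>_def dist_norm norm_minus_commute)
    then have u1: "diag2 u = mat 1" using \<delta>1(2)[OF u(2)] diag2_1 by force
    have "norm r \<le> dist (f x) x" using dist_snd_le[of "f x" x] by (simp add: u(1) u1 act_def dist_norm)
    then have "r = 0" using \<Lambda>norm[OF u(3)] d by (force simp: \<delta>_def)
    then show "f = id" by (simp add: u(1) u1 act_id)
  qed
  have orbit_eq: "orbit \<phi> \<beta> x = orbit \<phi> \<beta> y \<longleftrightarrow> (\<exists>f\<in>T. y = f x)" for x y
  proof
    assume "orbit \<phi> \<beta> x = orbit \<phi> \<beta> y"
    moreover have "y \<in> orbit \<phi> \<beta> y" unfolding orbit using Tid by (metis id_apply image_eqI)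
    ultimately show "\<exists>f\<in>T. y = f x" unfolding orbit by auto
  next
    assume "\<exists>f\<in>T. y = f x"
    then obtain f where f: "f \<in> T" "y = f x" by blast
    obtain g where g: "g \<in> T" "g \<circ> f = id" using Tinv[OF f(1)] by blast
    have x: "x = g y" using g(2) f(2) by (metis comp_apply id_apply)
    have "h y \<in> orbit \<phi> \<beta> x" if "h \<in> T" for h
      unfolding orbit f(2) using Tcomp[OF that f(1)] by (metis comp_apply image_eqI)
    moreover have "h x \<in> orbit \<phi> \<beta> y" if "h \<in> T" for h
      unfolding orbit using Tcomp[OF that g(1)] x by (metis comp_apply image_eqI)
    ultimately show "orbit \<phi> \<beta> x = orbit \<phi> \<beta> y" by (auto simp: orbit)
  qed
  \<comment> \<open>Indexed by all \<open>p\<close>-th roots of unity: this set is finite, closed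
    under products, and contains every \<open>u\<close> with \<open>diag2 u\<close> in
    \<open>K\<close>.\<close>
  define H where "H = rotation4 ` {z. z ^ p = 1}"
  have finH: "finite H" unfolding H_def using p by (intro finite_imageI finite_roots_unity) simp
  have Hnorm: "norm z = 1" if "z ^ p = 1" for z :: complex by (rule norm_root_of_unity[OF that p])
  \<comment> \<open>The interval from 1 to 2 is a convenient choice away from radius 0, where the
    polar map degenerates.\<close>
  interpret flat_isometry_action "SU \<times> UNIV" T \<delta> "orbit \<phi> \<beta>"
    "submanifold_atlas (SU \<times> UNIV) :: ((complex^2^2) \<times> (complex^2), real^7) chart set" polar H 1 2
  proof (unfold_locales)
    show "id \<in> T" by (fact Tid)
    show "f \<circ> g \<in> T" if "f \<in> T" "g \<in> T" for f g using Tcomp[OF that] .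
    show "\<exists>g\<in>T. g \<circ> f = id \<and> f \<circ> g = id" if "f \<in> T" for f using Tinv[OF that] .
    show "dist (f x) (f y) = dist x y" if "f \<in> T" for f x y using Tcases[OF that] dist_act by blast
    show "f x \<in> SU \<times> UNIV" if "f \<in> T" "x \<in> SU \<times> UNIV" for f x
      using Tcases[OF that(1)] that(2) diag2_mult_in_SU by (force simp: act_def)
    show "smooth_on f UNIV" if "f \<in> T" for f using Tcases[OF that] smooth_act by blast
    show "\<delta> > 0" using \<delta>1(1) \<delta>2(1) by (simp add: \<delta>_def)
    show "f = id" if "f \<in> T" "x \<in> SU \<times> UNIV" "dist (f x) x < \<delta>" for f x using sep[OF that] .
    show "orbit \<phi> \<beta> x = orbit \<phi> \<beta> y \<longleftrightarrow> (\<exists>f\<in>T. y = f x)" for x y by (rule orbit_eq)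
    show "\<exists>c\<in>(submanifold_atlas (SU \<times> UNIV) :: ((complex^2^2) \<times> (complex^2), real^7) chart set). x \<in> fst c"
      if "x \<in> SU \<times> UNIV" for x by (rule SU2_chart_cover[OF that])
    show "smooth_on polar UNIV" by (rule smooth_polar)
    show "bij (frechet_derivative (\<lambda>(z, t). polar (inv_into V \<psi> z, t)) (at (z, t)))"
      if "(V, \<psi>) \<in> submanifold_atlas (SU \<times> UNIV)" "z \<in> \<psi> ` V" "1 < t" "t < 2"
      for V and \<psi> :: "(complex^2^2) \<times> (complex^2) \<Rightarrow> real^7" and z t
      using that by (intro bij_polar_derivative) auto
    show "\<exists>\<rho>\<in>H. \<exists>r. \<forall>x\<in>SU \<times> UNIV. \<forall>t. polar (f x, t) = \<rho> (polar (x, t)) + r" if "f \<in> T" for f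
    proof -
      obtain u r where "f = act (diag2 u) r" "u ^ p = 1" using Tcases[OF \<open>f \<in> T\<close>] by blast
      then show ?thesis unfolding H_def using polar_act by blast
    qed
    show "\<rho> (v + w) = \<rho> v + \<rho> w" "\<rho> (r *\<^sub>R v) = r *\<^sub>R \<rho> v" if "\<rho> \<in> H" for \<rho> v w r
      using that linear_add[OF linear_rotation4] linear_scale[OF linear_rotation4] by (auto simp: H_def)
    show "\<rho> v \<bullet> \<rho> w = v \<bullet> w" if "\<rho> \<in> H" for \<rho> v w
      using that rotation4_inner Hnorm by (auto simp: H_def)
    show "id \<in> H" unfolding H_def rotation4_1[symmetric] by (intro imageI) simp
    show "\<rho> \<circ> \<sigma> \<in> H" if "\<rho> \<in> H" "\<sigma> \<in> H" for \<rho> \<sigma>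
      using that by (auto simp: H_def rotation4_comp power_mult_distrib)
  qed
  have carrier: "carrier G = SU \<times> UNIV" by (simp add: G_def)
  have M: "M_top \<phi> \<beta> = Q" "M_atlas \<phi> \<beta> = quotient_atlas (orbit \<phi> \<beta>) (submanifold_atlas (SU \<times> UNIV))"
    by (simp_all add: M_top_def M_atlas_def carrier)
  have compact: "compact_space Q"
  proof -
    \<comment> \<open>Compact because SU(2) and the cube are. It meets every orbit: subtracting the
      integer parts of the coordinates of \<open>q\<close>, a translation in \<open>T\<close>, moves
      \<open>q\<close> into the image of the cube.\<close>
    define C where "C = (SU :: (complex^2^2) set) \<times> \<phi> ` cbox 0 1"
    have "continuous_on (cbox 0 1) \<phi>"
      using assms(4) by (intro linear_continuous_on) (simp add: linear_conv_bounded_linear)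
    then have "compact C"
      unfolding C_def by (intro compact_Times compact_SU2 compact_continuous_image compact_cbox)
    then have "compactin (top_of_set (SU \<times> UNIV)) C"
      by (auto simp: compactin_subtopology C_def)
    then have "compactin Q (orbit \<phi> \<beta> ` C)"
      using continuous_map_quotient_topology by (rule image_compactin)
    moreover have "topspace Q \<subseteq> orbit \<phi> \<beta> ` C"
    proof
      fix y assume "y \<in> topspace Q"
      then obtain B q where y: "B \<in> SU" "y = orbit \<phi> \<beta> (B, q)" by (auto simp: topspace_Q)
      obtain x where q: "q = \<phi> x" using bij_is_surj[OF assms(5)] by blast
      define n :: "real^4" where "n = (\<chi> i. of_int \<lfloor>x $ i\<rfloor>)"
      have n: "\<phi> (- n) \<in> \<Lambda>" unfolding \<Lambda>_def Z4_lattice_def by (rule imageI) (simp add: n_def)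
      have "act (mat 1) (\<phi> (- n)) \<in> T" unfolding T_def using Kone n by blast
      moreover have "act (mat 1) (\<phi> (- n)) (B, q) = (B, \<phi> (x - n))"
        using linear_add[OF assms(4), of x "- n"] by (simp add: act_def q)
      ultimately have "y = orbit \<phi> \<beta> (B, \<phi> (x - n))" unfolding y(2) using orbit_eq by metis
      moreover have "x - n \<in> cbox 0 1"
        unfolding mem_box_cart by (auto simp: n_def) linarith
      ultimately show "y \<in> orbit \<phi> \<beta> ` C" using y(1) by (auto simp: C_def)
    qed
    ultimately show ?thesis
      unfolding compact_space_def using compactin_subset_topspace by (metis subset_antisym)
  qed
  have holonomy: "discrete (holonomy_group (times_interval_topology Q 1 2)
        (times_interval_atlas (quotient_atlas (orbit \<phi> \<beta>) (submanifold_atlas (SU \<times> UNIV))) 1 2) flat.metric k x) \<and>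
      (\<exists>\<iota> :: (real^7) \<times> real \<Rightarrow> complex^4.
         linear \<iota> \<and> bij \<iota> \<and> (\<forall>v w. flat.metric k (snd k x) v w = \<iota> v \<bullet> \<iota> w) \<and>
         (\<forall>h\<in>holonomy_group (times_interval_topology Q 1 2)
            (times_interval_atlas (quotient_atlas (orbit \<phi> \<beta>) (submanifold_atlas (SU \<times> UNIV))) 1 2) flat.metric k x.
            \<exists>A\<in>SU. \<forall>v. \<iota> (blinfun_apply h v) = A *v \<iota> v))"
    if k: "k \<in> times_interval_atlas (quotient_atlas (orbit \<phi> \<beta>) (submanifold_atlas (SU \<times> UNIV))) 1 2"
      and x: "x \<in> fst k" for k x
  \<comment> \<open>The derivative of the developing map is an isometry of the tangent space onto
    \<open>\<complex>\<^sup>4\<close>, and it conjugates every holonomy element to some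
    \<open>diag4 z\<close>.\<close>
  proof (intro conjI exI[of _ "flat.DL k (snd k x)"] allI ballI)
    have sx: "snd k x \<in> snd k ` fst k" using x by (rule imageI)
    show "discrete (holonomy_group (times_interval_topology Q 1 2)
        (times_interval_atlas (quotient_atlas (orbit \<phi> \<beta>) (submanifold_atlas (SU \<times> UNIV))) 1 2) flat.metric k x)"
      using flat.finite_holonomy[OF finH k x] unfolding discrete_def
      by (simp add: isolated_in_islimpt_iff islimpt_finite)
    show "linear (flat.DL k (snd k x))" by (rule flat.linear_DL[OF k sx])
    show "bij (flat.DL k (snd k x))" by (rule flat.L_bij[OF k sx])
    show "flat.metric k (snd k x) v w = flat.DL k (snd k x) v \<bullet> flat.DL k (snd k x) w" for v w
      by (rule flat.metric_def)
    fix h assume "h \<in> holonomy_group (times_interval_topology Q 1 2)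
        (times_interval_atlas (quotient_atlas (orbit \<phi> \<beta>) (submanifold_atlas (SU \<times> UNIV))) 1 2) flat.metric k x"
    from flat.holonomy_in_H[OF k x this] obtain z where z: "z ^ p = 1"
      "\<And>v. flat.DL k (snd k x) (blinfun_apply h v) = rotation4 z (flat.DL k (snd k x) v)"
      unfolding H_def by blast
    show "\<exists>A\<in>SU. \<forall>v. flat.DL k (snd k x) (blinfun_apply h v) = A *v flat.DL k (snd k x) v"
      using z diag4_in_SU[OF Hnorm[OF z(1)]] by (intro bexI[of _ "diag4 z"]) (simp_all add: diag4_apply)
  qed
  show ?thesis
    unfolding M Let_def
    using smooth_manifold_quotient compact flat.riemannian_metric holonomy
    by (intro conjI exI[of _ "1::real"] exI[of _ "2::real"] exI[of _ flat.metric] ballI) auto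
qed

end
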